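(* Let $0<s<\frac12$, and let $\{t_n\}_{n=1}^\infty\subset(0,1)$ be a decreasing sequence converging to zero such that the sequence of differences $t_n-t_{n+1}$ is decreasing in $n$. Then $$\lim_{n\to\infty}e^{it_n\square}f(x)=f(x)\quad\text{for a.e. }x\in\mathbb{R}^2$$ holds for all $f\in H^s(\mathbb{R}^2)$ if and only if $\{t_n\}_{n=1}^\infty\in\ell^{r(s),\infty}(\mathbb{N})$, where $r(s)=\frac{s}{1-s}$.
   Context: For $t\in\mathbb{R}$ the nonelliptic Schrödinger operator on $\mathbb{R}^2$ is $$e^{it\square}f(x):=\int_{\mathbb{R}^2}e^{i(x\cdot\xi+t\xi_1\xi_2)}\widehat f(\xi)\,d\xi,$$ interpreted in the $L^2$ sense, where $\widehat f$ is the Fourier transform of $f$, normalized so that $e^{i0\square}f=f$, i.e. $\widehat f(\xi)=(2\pi)^{-2}\int_{\mathbb{R}^2}e^{-ix\cdot\xi}f(x)\,dx$. $H^s(\mathbb{R}^2)$ is the usual $L^2$-based inhomogeneous Sobolev space. For $r>0$, a sequence $\{t_n\}_{n=1}^\infty\subset(0,1)$ belongs to $\ell^{r,\infty}(\mathbb{N})$ if and only if $\sup_{b>0}b^{r}\,\#\{n:t_n>b\}<\infty$. *)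

theory Defs
  imports "HOL-Analysis.Analysis"
begin

definition square_integrable :: "(real^2 \<Rightarrow> complex) \<Rightarrow> bool" where
  "square_integrable f \<longleftrightarrow>
     f \<in> borel_measurable lebesgue \<and> integrable lebesgue (\<lambda>x. (cmod (f x))\<^sup>2)"

text \<open>
  Integrals interpreted in the L2 sense: \<open>L2_integral F\<close> is a representative of the limit in
  L2, as \<open>R\<close> tends to infinity, of the truncated integrals of \<open>F y z\<close> over \<open>norm z < R\<close>,
  as functions of \<open>y\<close>. The limit is determined up to a null set only. The distance is taken
  in the extended nonnegative reals, so that a difference that fails to be square integrable
  has infinite distance rather than the default value 0 of the Bochner integral.
\<close>

definition is_L2_integral :: "(real^2 \<Rightarrow> real^2 \<Rightarrow> complex) \<Rightarrow> (real^2 \<Rightarrow> complex) \<Rightarrow> bool" where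
  "is_L2_integral F g \<longleftrightarrow> square_integrable g \<and>
     ((\<lambda>R. \<integral>\<^sup>+y. ennreal ((cmod ((LINT z:ball 0 R|lebesgue. F y z) - g y))\<^sup>2) \<partial>lebesgue)
        \<longlongrightarrow> 0) at_top"

definition L2_integral :: "(real^2 \<Rightarrow> real^2 \<Rightarrow> complex) \<Rightarrow> real^2 \<Rightarrow> complex" where
  "L2_integral F = (SOME g. is_L2_integral F g)"

definition fourier :: "(real^2 \<Rightarrow> complex) \<Rightarrow> real^2 \<Rightarrow> complex" where
  "fourier f \<xi> = complex_of_real (1 / (2 * pi)\<^sup>2) * L2_integral (\<lambda>\<xi> x. cis (- (x \<bullet> \<xi>)) * f x) \<xi>"

definition nonelliptic_propagator :: "real \<Rightarrow> (real^2 \<Rightarrow> complex) \<Rightarrow> real^2 \<Rightarrow> complex" where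
  "nonelliptic_propagator t f =
     L2_integral (\<lambda>x \<xi>. cis (x \<bullet> \<xi> + t * (\<xi> $ 1) * (\<xi> $ 2)) * fourier f \<xi>)"

text \<open>The space of order \<open>s \<ge> 0\<close>, as a set of functions rather than of a.e. classes.\<close>

definition sobolev :: "real \<Rightarrow> (real^2 \<Rightarrow> complex) set" where
  "sobolev s = {f. square_integrable f \<and>
     integrable lebesgue (\<lambda>\<xi>. (1 + (norm \<xi>)\<^sup>2) powr s * (cmod (fourier f \<xi>))\<^sup>2)}"

text \<open>Cardinalities are taken with the counting measure, since \<open>card\<close> is 0 on infinite sets.\<close>

definition weak_lspace :: "real \<Rightarrow> (nat \<Rightarrow> real) set" where
  "weak_lspace r = {t.
     (SUP b\<in>{0<..}. ennreal (b powr r) * emeasure (count_space UNIV) {n. t n > b}) < \<infinity>}"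

end

theory Submission
  imports Defs "HOL-Probability.Probability"
begin

text \<open>
  Put \<open>r = s / (1 - s)\<close>. On the Fourier side the propagator multiplies by the phase
  \<open>cis (t * \<xi>\<^sub>1 * \<xi>\<^sub>2)\<close>, so every \<open>L2\<close> estimate for it is an estimate for this multiplier.

  \<^bold>\<open>Background.\<close> The Fourier transform on \<open>L2\<close> of the plane rests on one computation: damping the
  transform of an integrable \<open>f\<close> by a Gaussian and transforming back convolves \<open>f\<close> with a heat
  kernel (\<open>FT_gauss_FT\<close>). Schur's test for that kernel gives a Bessel inequality (\<open>FT_Bessel\<close>), which
  makes the truncated integrals converge, and letting the damping tend to zero gives the
  inversion formula (\<open>is_FT_inversion\<close>).

  \<^bold>\<open>Sufficiency\<close> (\<open>a_e_convergence_of_weak_lspace\<close>). The times with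
  \<open>2 ^ - (l + 1) \<le> t n < 2 ^ - l\<close> number \<open>O(2 ^ (r l))\<close>. Each of them is joined to \<open>0\<close> by its dyadic
  approximations of levels \<open>l, ..., J\<close>, where \<open>J\<close> is about \<open>l / (1 - s)\<close>: at that level there are about
  \<open>2 ^ (J - l) = 2 ^ (r l)\<close> dyadic points below \<open>2 ^ - l\<close>, as many as times. A step of level \<open>j\<close> changes
  the solution by an energy of at most a constant times the integral of
  \<open>min 4 ((2 ^ - j * |\<xi>|\<^sup>2)\<^sup>2) * |G \<xi>|\<^sup>2\<close>, where \<open>G\<close> is the transform of the datum, and
  there are only \<open>2 ^ (j - l)\<close> different steps. Summing over the steps, with weights that grow
  geometrically as \<open>j\<close> falls below \<open>J\<close>, and then over \<open>j\<close> and \<open>l\<close>, produces a constant times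
  \<open>(1 + |\<xi>|\<^sup>2) powr s\<close>, without a logarithmic loss. Hence the squares of the deviations are summable over the
  blocks almost everywhere, and the deviations tend to zero.

  \<^bold>\<open>Necessity\<close> (\<open>gliding_hump_contradiction\<close>). If all gaps satisfied
  \<open>t n - t (n + 1) \<ge> c * t n powr (1 + r)\<close>, then \<open>t n powr (- r)\<close> would grow at least linearly and the
  sequence would be in the weak space. So outside of it there are gaps \<open>\<delta> < c * t n powr (1 + r)\<close> with
  arbitrarily small \<open>c\<close>, and all later gaps are at most \<open>\<delta>\<close>, as the gaps decrease. Let
  \<open>L = \<delta> powr (-1/2)\<close>. A datum of frequency \<open>\<xi>\<^sub>2\<close> in \<open>[L, L + 1]\<close> that is a comb of bumps of width
  \<open>1 / L\<close> in \<open>x\<^sub>1\<close> is carried along the first axis with speed about \<open>L\<close>, hence moves by at most its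
  own bump width between consecutive times; if the teeth are \<open>min (t n * L) 1\<close> apart, then every
  point of a fixed box is met by a bump at one of the times, although the Sobolev norm of the
  datum is at most a constant times a positive power of \<open>c\<close> (\<open>wave_comb_covering\<close>). A sum of such data,
  chosen one after the other, violates convergence on a set of positive measure.
\<close>


section \<open>Square norms and completeness\<close>

text \<open>
  The square of the \<open>L2\<close> norm, with values in the extended reals so that no integrability has to
  be established before estimates can be chained.
\<close>

definition sqnorm :: "'a measure \<Rightarrow> ('a \<Rightarrow> complex) \<Rightarrow> ennreal" where
  "sqnorm M f = (\<integral>\<^sup>+x. ennreal ((cmod (f x))\<^sup>2) \<partial>M)"

lemma sqnorm_cong_AE: "AE x in M. f x = g x \<Longrightarrow> sqnorm M f = sqnorm M g"
  unfolding sqnorm_def by (rule nn_integral_cong_AE) auto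

lemma sqnorm_mono: "(\<And>x. x \<in> space M \<Longrightarrow> cmod (f x) \<le> cmod (g x)) \<Longrightarrow> sqnorm M f \<le> sqnorm M g"
  unfolding sqnorm_def by (intro nn_integral_mono ennreal_leI power_mono) auto

lemma sqnorm_cmult:
  assumes [measurable]: "f \<in> borel_measurable M"
  shows "sqnorm M (\<lambda>x. c * f x) = ennreal ((cmod c)\<^sup>2) * sqnorm M f"
  unfolding sqnorm_def by (subst nn_integral_cmult[symmetric])
    (auto simp: norm_mult power_mult_distrib ennreal_mult intro!: nn_integral_cong)

lemma sqnorm_minus_commute: "sqnorm M (\<lambda>x. f x - g x) = sqnorm M (\<lambda>x. g x - f x)"
  unfolding sqnorm_def by (simp add: norm_minus_commute)

lemma cmod_add_sq_le: "(cmod (a + b))\<^sup>2 \<le> 2 * (cmod a)\<^sup>2 + 2 * (cmod b)\<^sup>2"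
proof -
  have "(cmod (a + b))\<^sup>2 \<le> (cmod a + cmod b)\<^sup>2"
    by (intro power_mono norm_triangle_ineq) auto
  also have "\<dots> \<le> 2 * (cmod a)\<^sup>2 + 2 * (cmod b)\<^sup>2"
    using zero_le_power2[of "cmod a - cmod b"] by (simp add: power2_sum power2_diff)
  finally show ?thesis .
qed

lemma sqnorm_add_le:
  assumes [measurable]: "f \<in> borel_measurable M" "g \<in> borel_measurable M"
  shows "sqnorm M (\<lambda>x. f x + g x) \<le> 2 * sqnorm M f + 2 * sqnorm M g"
proof -
  have "sqnorm M (\<lambda>x. f x + g x) \<le> (\<integral>\<^sup>+x. 2 * ennreal ((cmod (f x))\<^sup>2) + 2 * ennreal ((cmod (g x))\<^sup>2) \<partial>M)"
    unfolding sqnorm_def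
  proof (intro nn_integral_mono)
    fix x
    have "ennreal ((cmod (f x + g x))\<^sup>2) \<le> ennreal (2 * (cmod (f x))\<^sup>2 + 2 * (cmod (g x))\<^sup>2)"
      by (intro ennreal_leI cmod_add_sq_le)
    also have "\<dots> = 2 * ennreal ((cmod (f x))\<^sup>2) + 2 * ennreal ((cmod (g x))\<^sup>2)"
      by (simp add: ennreal_plus ennreal_mult)
    finally show "ennreal ((cmod (f x + g x))\<^sup>2) \<le> 2 * ennreal ((cmod (f x))\<^sup>2) + 2 * ennreal ((cmod (g x))\<^sup>2)" .
  qed
  also have "\<dots> = 2 * sqnorm M f + 2 * sqnorm M g"
    unfolding sqnorm_def by (simp add: nn_integral_add nn_integral_cmult)
  finally show ?thesis .
qed

lemma sqnorm_diff_triangle: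
  assumes [measurable]: "f \<in> borel_measurable M" "g \<in> borel_measurable M" "h \<in> borel_measurable M"
  shows "sqnorm M (\<lambda>x. f x - h x) \<le> 2 * sqnorm M (\<lambda>x. f x - g x) + 2 * sqnorm M (\<lambda>x. g x - h x)"
  using sqnorm_add_le[of "\<lambda>x. f x - g x" M "\<lambda>x. g x - h x"] by simp

lemma sqnorm_eq_0_iff:
  assumes [measurable]: "f \<in> borel_measurable M"
  shows "sqnorm M f = 0 \<longleftrightarrow> (AE x in M. f x = 0)"
  unfolding sqnorm_def by (subst nn_integral_0_iff_AE) auto

lemma sqnorm_finite_iff:
  assumes [measurable]: "f \<in> borel_measurable M"
  shows "sqnorm M f < \<infinity> \<longleftrightarrow> integrable M (\<lambda>x. (cmod (f x))\<^sup>2)"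
  unfolding sqnorm_def integrable_iff_bounded by simp

text \<open>
  Cauchy--Schwarz with weights. Geometric weights let a sum of increments be estimated by the sum
  of their squares with a constant independent of the number of increments.
\<close>

lemma cmod_sum_sq_weighted_le:
  fixes d :: "nat \<Rightarrow> complex" and w :: "nat \<Rightarrow> real"
  assumes "finite A" "\<And>k. k \<in> A \<Longrightarrow> w k > 0"
  shows "(cmod (\<Sum>k\<in>A. d k))\<^sup>2 \<le> (\<Sum>k\<in>A. 1 / w k) * (\<Sum>k\<in>A. w k * (cmod (d k))\<^sup>2)"
proof -
  have "(cmod (\<Sum>k\<in>A. d k))\<^sup>2 \<le> (\<Sum>k\<in>A. cmod (d k))\<^sup>2"
    by (intro power_mono norm_sum) auto
  also have "(\<Sum>k\<in>A. cmod (d k)) = (\<Sum>k\<in>A. (1 / sqrt (w k)) * (sqrt (w k) * cmod (d k)))"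
    using assms(2) by (intro sum.cong refl) (auto simp: less_imp_neq[symmetric])
  also have "(\<dots>)\<^sup>2 \<le> (\<Sum>k\<in>A. (1 / sqrt (w k))\<^sup>2) * (\<Sum>k\<in>A. (sqrt (w k) * cmod (d k))\<^sup>2)"
    by (rule Cauchy_Schwarz_ineq_sum)
  also have "(\<Sum>k\<in>A. (1 / sqrt (w k))\<^sup>2) = (\<Sum>k\<in>A. 1 / w k)"
    using assms(2) by (intro sum.cong refl) (simp add: power_divide less_imp_le)
  also have "(\<Sum>k\<in>A. (sqrt (w k) * cmod (d k))\<^sup>2) = (\<Sum>k\<in>A. w k * (cmod (d k))\<^sup>2)"
    using assms(2) by (intro sum.cong refl) (simp add: power_mult_distrib less_imp_le)
  finally show ?thesis .
qed

lemma sum_half_powers_le: "(\<Sum>k=K..<L. 1 / (2::real) ^ k) \<le> 2 * (1/2) ^ K"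
proof (cases "K \<le> L")
  case True
  have "(\<Sum>k=K..<L. 1 / (2::real) ^ k) = 2 * (1/2)^K - 2 * (1/2)^L"
    unfolding power_one_over[symmetric] using True by (induction L rule: dec_induct) auto
  then show ?thesis by simp
qed simp

text \<open>
  The hypothesis makes the sum of \<open>2 ^ k * (cmod (d k x))\<^sup>2\<close> finite at almost every \<open>x\<close>; at such
  points \<open>cmod_sum_sq_weighted_le\<close> bounds every block of the series, so that the series converges and
  the same bound passes to its tails.
\<close>

lemma Riesz_Fischer:
  fixes d :: "nat \<Rightarrow> 'a \<Rightarrow> complex"
  assumes [measurable]: "\<And>k. d k \<in> borel_measurable M"
    and fin: "(\<Sum>k. ennreal (2 ^ k) * sqnorm M (d k)) < \<infinity>"
  obtains g where "g \<in> borel_measurable M"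
    "\<And>K. sqnorm M (\<lambda>x. g x - (\<Sum>k<K. d k x)) \<le> ennreal (2 * (1/2)^K) * (\<Sum>k. ennreal (2 ^ k) * sqnorm M (d k))"
proof -
  define g where "g = (\<lambda>x. \<Sum>k. d k x)"
  define S where "S = (\<lambda>x. \<Sum>k. ennreal (2 ^ k * (cmod (d k x))\<^sup>2))"
  have [measurable]: "g \<in> borel_measurable M" "S \<in> borel_measurable M"
    unfolding g_def S_def by measurable
  have IS: "(\<integral>\<^sup>+x. S x \<partial>M) = (\<Sum>k. ennreal (2 ^ k) * sqnorm M (d k))"
    unfolding S_def sqnorm_def by (subst nn_integral_suminf) (auto simp: ennreal_mult nn_integral_cmult)
  have "AE x in M. S x \<noteq> \<infinity>"
    by (rule nn_integral_PInf_AE) (use fin IS in auto)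
  then have main: "AE x in M. \<forall>K. ennreal ((cmod (g x - (\<Sum>k<K. d k x)))\<^sup>2) \<le> ennreal (2 * (1/2)^K) * S x"
  proof eventually_elim
    case (elim x)
    have summ: "summable (\<lambda>k. 2 ^ k * (cmod (d k x))\<^sup>2)"
      by (rule summable_suminf_not_top) (use elim in \<open>auto simp: S_def\<close>)
    define s where "s = (\<Sum>k. 2 ^ k * (cmod (d k x))\<^sup>2)"
    have Ss: "S x = ennreal s" unfolding S_def s_def
      by (rule suminf_ennreal2) (auto intro: summ)
    have s0: "s \<ge> 0" unfolding s_def by (rule suminf_nonneg[OF summ]) auto
    have block: "(cmod (\<Sum>k=K..<L. d k x))\<^sup>2 \<le> 2 * (1/2)^K * s" for K L
    proof -
      have "(cmod (\<Sum>k=K..<L. d k x))\<^sup>2 \<le> (\<Sum>k=K..<L. 1 / 2^k) * (\<Sum>k=K..<L. 2^k * (cmod (d k x))\<^sup>2)"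
        by (rule cmod_sum_sq_weighted_le) auto
      also have "\<dots> \<le> (2 * (1/2)^K) * s"
        unfolding s_def by (intro mult_mono sum_half_powers_le sum_le_suminf summ) (auto intro: sum_nonneg)
      finally show ?thesis .
    qed
    have "summable (\<lambda>k. d k x)"
    proof (rule summable_norm_cancel, rule summable_comparison_test')
      show "summable (\<lambda>k. sqrt (2 * s) * (sqrt (1/2)) ^ k)"
        by (intro summable_mult summable_geometric) (simp add: real_sqrt_lt_1_iff)
      fix k :: nat
      have "(cmod (d k x))\<^sup>2 \<le> 2 * (1/2)^k * s" using block[of k "Suc k"] by simp
      then have "cmod (d k x) \<le> sqrt (2 * (1/2)^k * s)" by (rule real_le_rsqrt)
      also have "\<dots> = sqrt (2 * s) * (sqrt (1/2)) ^ k"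
        by (simp add: real_sqrt_mult real_sqrt_power mult_ac)
      finally show "norm (cmod (d k x)) \<le> sqrt (2 * s) * (sqrt (1/2)) ^ k" by simp
    qed
    then have lim: "(\<lambda>L. \<Sum>k<L. d k x) \<longlonglongrightarrow> g x" unfolding g_def by (rule summable_LIMSEQ)
    show ?case
    proof
      fix K
      have "(cmod (g x - (\<Sum>k<K. d k x)))\<^sup>2 \<le> 2 * (1/2)^K * s"
      proof (rule LIMSEQ_le_const2)
        show "(\<lambda>L. (cmod ((\<Sum>k<L. d k x) - (\<Sum>k<K. d k x)))\<^sup>2) \<longlonglongrightarrow> (cmod (g x - (\<Sum>k<K. d k x)))\<^sup>2"
          by (intro tendsto_intros lim)
        have "(cmod ((\<Sum>k<L. d k x) - (\<Sum>k<K. d k x)))\<^sup>2 \<le> 2 * (1/2)^K * s" if "L \<ge> K" for L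
        proof -
          have "(\<Sum>k<L. d k x) - (\<Sum>k<K. d k x) = (\<Sum>k=K..<L. d k x)"
            using that by (simp add: lessThan_atLeast0 sum_diff_nat_ivl)
          then show ?thesis using block[of K L] by simp
        qed
        then show "\<exists>N. \<forall>n\<ge>N. (cmod ((\<Sum>k<n. d k x) - (\<Sum>k<K. d k x)))\<^sup>2 \<le> 2 * (1/2)^K * s" by blast
      qed
      then show "ennreal ((cmod (g x - (\<Sum>k<K. d k x)))\<^sup>2) \<le> ennreal (2 * (1/2)^K) * S x"
        unfolding Ss using s0 by (subst ennreal_mult[symmetric]) (auto intro!: ennreal_leI)
    qed
  qed
  have "sqnorm M (\<lambda>x. g x - (\<Sum>k<K. d k x)) \<le> ennreal (2 * (1/2)^K) * (\<Sum>k. ennreal (2 ^ k) * sqnorm M (d k))" for K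
  proof -
    have "sqnorm M (\<lambda>x. g x - (\<Sum>k<K. d k x)) \<le> (\<integral>\<^sup>+x. ennreal (2 * (1/2)^K) * S x \<partial>M)"
      unfolding sqnorm_def by (rule nn_integral_mono_AE) (use main in auto)
    also have "\<dots> = ennreal (2 * (1/2)^K) * (\<integral>\<^sup>+x. S x \<partial>M)" by (rule nn_integral_cmult) simp
    finally show ?thesis using IS by simp
  qed
  then show thesis using that[of g] by auto
qed

lemma borel_measurable_cis [measurable (raw)]:
  "f \<in> borel_measurable M \<Longrightarrow> (\<lambda>x. cis (f x)) \<in> borel_measurable M"
  by (rule measurable_compose[of f M borel]) (auto intro!: borel_measurable_continuous_onI continuous_intros)

section \<open>Integration on the plane and Gaussian integrals\<close>

lemma real2_inner: "(x :: real^2) \<bullet> y = x $ 1 * y $ 1 + x $ 2 * y $ 2"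
  by (simp add: inner_vec_def sum_2)

lemma real2_norm_sq: "(norm (x :: real^2))\<^sup>2 = (x $ 1)\<^sup>2 + (x $ 2)\<^sup>2"
  unfolding power2_norm_eq_inner real2_inner by (simp add: power2_eq_square)

lemma vector2_measurable [measurable]:
  "(\<lambda>p. vector [fst p, snd p] :: real^2) \<in> borel_measurable (borel \<Otimes>\<^sub>M borel)"
proof -
  have "(\<lambda>p::real \<times> real. vector [fst p, snd p] :: real^2) = (\<lambda>p. fst p *\<^sub>R axis 1 1 + snd p *\<^sub>R axis 2 1)"
    by (auto simp: vec_eq_iff forall_2 axis_def)
  then show ?thesis by simp
qed

text \<open>
  Fubini's theorem in the two coordinates, for the type of vectors indexed by \<open>2\<close>, is obtained
  by transporting the product measure.
\<close>

lemma lborel_real2: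
  "(lborel :: (real^2) measure) = distr (lborel \<Otimes>\<^sub>M lborel) borel (\<lambda>p. vector [fst p, snd p])"
proof (rule lborel_eqI)
  fix l u :: "real^2" assume lu: "\<And>b. b \<in> Basis \<Longrightarrow> l \<bullet> b \<le> u \<bullet> b"
  have le: "l $ i \<le> u $ i" for i using lu[of "axis i 1"] by (auto simp: inner_axis Basis_vec_def)
  have "emeasure (distr (lborel \<Otimes>\<^sub>M lborel) borel (\<lambda>p. vector [fst p, snd p])) (box l u)
      = emeasure (lborel \<Otimes>\<^sub>M lborel) ({l$1<..<u$1} \<times> {l$2<..<u$2})"
    by (subst emeasure_distr) (auto simp: mem_box_cart forall_2 space_pair_measure intro!: arg_cong2[where f=emeasure])
  also have "\<dots> = ennreal (u$1 - l$1) * ennreal (u$2 - l$2)"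
    by (subst lborel.emeasure_pair_measure_Times) (auto simp: le)
  also have "\<dots> = ennreal ((u$1 - l$1) * (u$2 - l$2))"
    using le by (simp add: ennreal_mult)
  also have "(u$1 - l$1) * (u$2 - l$2) = (\<Prod>b\<in>Basis. (u - l) \<bullet> b)"
    by (simp add: Basis_vec_def UNION_singleton_eq_range prod.reindex inj_on_def axis_eq_axis inner_axis UNIV_2)
  finally show "emeasure (distr (lborel \<Otimes>\<^sub>M lborel) borel (\<lambda>p. vector [fst p, snd p])) (box l u) = ennreal (\<Prod>b\<in>Basis. (u - l) \<bullet> b)" .
qed simp

lemma nth_measurable [measurable]: "(\<lambda>x::real^2. x $ i) \<in> borel_measurable borel"
  by (intro borel_measurable_continuous_onI continuous_intros)

lemma
  fixes p q :: "real \<Rightarrow> complex"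
  assumes [measurable]: "integrable lborel p" "integrable lborel q"
  shows integrable_real2_prod: "integrable lborel (\<lambda>x::real^2. p (x $ 1) * q (x $ 2))"
    and integral_real2_prod: "(LINT x|lborel. p ((x::real^2) $ 1) * q (x $ 2)) = (LINT x|lborel. p x) * (LINT x|lborel. q x)"
proof -
  have [measurable]: "p \<in> borel_measurable borel" "q \<in> borel_measurable borel"
    using assms by (auto dest: borel_measurable_integrable)
  have i: "integrable (lborel \<Otimes>\<^sub>M lborel) (\<lambda>(x,y). p x * q y)"
  proof (rule lborel_pair.Fubini_integrable)
    have "integrable lborel (\<lambda>x. norm (p x) * (LINT y|lborel. norm (q y)))"
      by (intro integrable_mult_left integrable_norm assms)
    then show "integrable lborel (\<lambda>x. LINT y|lborel. norm (case (x, y) of (x, y) \<Rightarrow> p x * q y))"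
      by (simp add: norm_mult)
    show "AE x in lborel. integrable lborel (\<lambda>y. case (x, y) of (x, y) \<Rightarrow> p x * q y)"
      using assms by simp
  qed simp
  show "integrable lborel (\<lambda>x::real^2. p (x $ 1) * q (x $ 2))"
    using i by (subst lborel_real2, subst integrable_distr_eq) (auto simp: case_prod_beta')
  have "(LINT x|lborel. p ((x::real^2) $ 1) * q (x $ 2)) = (LINT z|(lborel \<Otimes>\<^sub>M lborel). (case z of (x,y) \<Rightarrow> p x * q y))"
    by (subst lborel_real2, subst integral_distr) (auto simp: case_prod_beta')
  also have "\<dots> = (LINT x|lborel. LINT y|lborel. p x * q y)"
    using lborel_pair.integral_fst'[OF i] by simp
  finally show "(LINT x|lborel. p ((x::real^2) $ 1) * q (x $ 2)) = (LINT x|lborel. p x) * (LINT x|lborel. q x)"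
    by simp
qed

text \<open>
  Rescaling reduces the integral to the characteristic function of the standard normal
  distribution.
\<close>

lemma
  assumes a: "a > 0"
  shows integrable_gauss_real: "integrable lborel (\<lambda>u::real. complex_of_real (exp (- a * u\<^sup>2 / 2)) * cis (u * w))"
    and integral_gauss_real: "(LINT u|lborel. complex_of_real (exp (- a * u\<^sup>2 / 2)) * cis (u * w)) = sqrt (2 * pi / a) * exp (- w\<^sup>2 / (2 * a))"
proof -
  define c where "c = 1 / sqrt a"
  have c: "c > 0" using a by (simp add: c_def)
  have ac: "a * c\<^sup>2 = 1" using a by (simp add: c_def power_divide)
  have id: "std_normal_density x *\<^sub>R cis (c * w * x) = (1 / sqrt (2*pi)) *\<^sub>R (complex_of_real (exp (- a * (c*x)\<^sup>2 / 2)) * cis (c * x * w))" for x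
  proof -
    have "a * (c * x)\<^sup>2 = x\<^sup>2" using ac by (simp add: power_mult_distrib flip: mult.assoc)
    moreover have "cis (c * w * x) = cis (c * x * w)" by (simp add: mult_ac)
    ultimately show ?thesis by (simp add: std_normal_density_def scaleR_conv_of_real)
  qed
  have int: "integrable lborel (\<lambda>x. std_normal_density x *\<^sub>R cis (c * w * x))"
    by (rule Bochner_Integration.integrable_bound[OF integrable_normal_density[of 1 0]]) auto
  have int2: "integrable lborel (\<lambda>x. complex_of_real (exp (- a * (c*x)\<^sup>2 / 2)) * cis (c * x * w))"
    using integrable_scaleR_right[of "sqrt (2*pi)", OF int[unfolded id]] by simp
  show "integrable lborel (\<lambda>u::real. complex_of_real (exp (- a * u\<^sup>2 / 2)) * cis (u * w))"
    using int2 c lborel_integrable_real_affine_iff[of c "\<lambda>u::real. complex_of_real (exp (- a * u\<^sup>2 / 2)) * cis (u * w)" 0] by simp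
  have "(LINT u|lborel. complex_of_real (exp (- a * u\<^sup>2 / 2)) * cis (u * w)) = c *\<^sub>R (LINT x|lborel. complex_of_real (exp (- a * (c*x)\<^sup>2 / 2)) * cis (c * x * w))"
    using c by (subst lborel_integral_real_affine[of c _ 0]) auto
  also have "(LINT x|lborel. complex_of_real (exp (- a * (c*x)\<^sup>2 / 2)) * cis (c * x * w)) = sqrt (2*pi) *\<^sub>R (LINT x|lborel. std_normal_density x *\<^sub>R cis (c * w * x))"
    unfolding id by simp
  also have "(LINT x|lborel. std_normal_density x *\<^sub>R cis (c * w * x)) = char std_normal_distribution (c * w)"
    unfolding char_def by (subst integral_density) (auto simp: cis_conv_exp)
  also have "\<dots> = exp (- (c * w)\<^sup>2 / 2)" by (simp add: char_std_normal_distribution)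
  also have "c *\<^sub>R (sqrt (2 * pi) *\<^sub>R complex_of_real (exp (- (c * w)\<^sup>2 / 2))) = sqrt (2 * pi / a) * exp (- w\<^sup>2 / (2 * a))"
    using a by (simp add: c_def power_mult_distrib power_divide real_sqrt_divide scaleR_conv_of_real field_simps)
  finally show "(LINT u|lborel. complex_of_real (exp (- a * u\<^sup>2 / 2)) * cis (u * w)) = sqrt (2 * pi / a) * exp (- w\<^sup>2 / (2 * a))" .
qed

lemma
  assumes a: "a > 0"
  shows integrable_gauss_real2: "integrable lborel (\<lambda>y::real^2. complex_of_real (exp (- a * (norm y)\<^sup>2 / 2)) * cis (y \<bullet> w))"
    and integral_gauss_real2: "(LINT y|lborel. complex_of_real (exp (- a * (norm (y::real^2))\<^sup>2 / 2)) * cis (y \<bullet> w)) = 2 * pi / a * exp (- (norm w)\<^sup>2 / (2 * a))"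
proof -
  have eq: "complex_of_real (exp (- a * (norm y)\<^sup>2 / 2)) * cis (y \<bullet> w) =
    (complex_of_real (exp (- a * (y$1)\<^sup>2 / 2)) * cis (y$1 * w$1)) * (complex_of_real (exp (- a * (y$2)\<^sup>2 / 2)) * cis (y$2 * w$2))" for y :: "real^2"
  proof -
    have "exp (- a * (norm y)\<^sup>2 / 2) = exp (- a * (y$1)\<^sup>2 / 2) * exp (- a * (y$2)\<^sup>2 / 2)"
      by (simp add: real2_norm_sq exp_add[symmetric] field_simps)
    then show ?thesis by (simp add: real2_inner cis_mult[symmetric])
  qed
  show "integrable lborel (\<lambda>y::real^2. complex_of_real (exp (- a * (norm y)\<^sup>2 / 2)) * cis (y \<bullet> w))"
    unfolding eq by (rule integrable_real2_prod[OF integrable_gauss_real[OF a] integrable_gauss_real[OF a]])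
  show "(LINT y|lborel. complex_of_real (exp (- a * (norm (y::real^2))\<^sup>2 / 2)) * cis (y \<bullet> w)) = 2 * pi / a * exp (- (norm w)\<^sup>2 / (2 * a))"
  proof -
    have s: "sqrt (2*pi/a) * sqrt (2*pi/a) = 2*pi/a" using a by simp
    have e: "exp (- (w$1)\<^sup>2 / (2 * a)) * exp (- (w$2)\<^sup>2 / (2 * a)) = exp (- (norm w)\<^sup>2 / (2 * a))"
      using a by (simp add: real2_norm_sq exp_add[symmetric] field_simps)
    show ?thesis
      unfolding eq integral_real2_prod[OF integrable_gauss_real[OF a] integrable_gauss_real[OF a]] integral_gauss_real[OF a]
      using s e by (metis (no_types, opaque_lifting) mult.assoc mult.left_commute of_real_mult)
  qed
qed

section \<open>The Fourier integral of an integrable function\<close>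

text \<open>
  The parameter \<open>\<sigma>\<close> is \<open>1\<close> or \<open>-1\<close>, so that the transform and its inverse, both without
  normalisation, are treated at once.
\<close>

definition FT :: "real \<Rightarrow> (real^2 \<Rightarrow> complex) \<Rightarrow> real^2 \<Rightarrow> complex" where
  "FT \<sigma> f y = (LINT z|lborel. cis (\<sigma> * (y \<bullet> z)) * f z)"

lemma FT_measurable [measurable]:
  assumes [measurable]: "f \<in> borel_measurable borel"
  shows "FT \<sigma> f \<in> borel_measurable borel"
  unfolding FT_def[abs_def] by measurable

lemma integrable_cis_mult:
  assumes "integrable M f" and [measurable]: "h \<in> borel_measurable M"
  shows "integrable M (\<lambda>z. cis (h z) * f z)"
proof -
  have [measurable]: "f \<in> borel_measurable M" using assms by auto
  show ?thesis by (rule Bochner_Integration.integrable_bound[OF assms(1)]) (auto simp: norm_mult)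
qed

lemma norm_FT_le:
  assumes "integrable lborel f"
  shows "cmod (FT \<sigma> f y) \<le> (LINT z|lborel. cmod (f z))"
proof -
  have "cmod (FT \<sigma> f y) \<le> (LINT z|lborel. cmod (cis (\<sigma> * (y \<bullet> z)) * f z))"
    unfolding FT_def by (rule integral_norm_bound)
  then show ?thesis by (simp add: norm_mult)
qed

lemma FT_diff:
  assumes "integrable lborel f" "integrable lborel g"
  shows "FT \<sigma> (\<lambda>z. f z - g z) y = FT \<sigma> f y - FT \<sigma> g y"
  unfolding FT_def by (subst Bochner_Integration.integral_diff[symmetric])
    (auto intro!: integrable_cis_mult assms simp: right_diff_distrib)

lemma FT_add:
  assumes "integrable lborel f" "integrable lborel g"
  shows "FT \<sigma> (\<lambda>z. f z + g z) y = FT \<sigma> f y + FT \<sigma> g y"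
  unfolding FT_def by (subst Bochner_Integration.integral_add[symmetric])
    (auto intro!: integrable_cis_mult assms simp: distrib_left)

lemma FT_cmult: "FT \<sigma> (\<lambda>z. c * f z) y = c * FT \<sigma> f y"
proof -
  have "FT \<sigma> (\<lambda>z. c * f z) y = (LINT z|lborel. c * (cis (\<sigma> * (y \<bullet> z)) * f z))"
    unfolding FT_def by (simp add: mult_ac)
  then show ?thesis unfolding FT_def by simp
qed

text \<open>
  The heat kernel at time \<open>a / 2\<close>, scaled to have total mass \<open>(2 * pi)\<^sup>2\<close>.
\<close>

definition heat :: "real \<Rightarrow> real^2 \<Rightarrow> real" where
  "heat a u = 2 * pi / a * exp (- (norm u)\<^sup>2 / (2 * a))"

lemma heat_nonneg: "a > 0 \<Longrightarrow> heat a u \<ge> 0"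
  by (simp add: heat_def)

lemma heat_measurable [measurable]: "heat a \<in> borel_measurable borel"
  unfolding heat_def[abs_def] by measurable

lemma
  assumes a: "a > 0"
  shows integrable_heat: "integrable lborel (heat a)"
    and integral_heat: "(LINT u|lborel. heat a u) = (2 * pi)\<^sup>2"
proof -
  have a': "1 / a > 0" using a by simp
  have eq: "exp (- (1 / a) * (norm y)\<^sup>2 / 2) = exp (- (norm y)\<^sup>2 / (2 * a))" for y :: "real^2"
    by simp
  have i: "integrable lborel (\<lambda>y::real^2. exp (- (norm y)\<^sup>2 / (2 * a)))"
    using integrable_gauss_real2[OF a', of 0] unfolding eq by (simp add: complex_of_real_integrable_eq)
  then show "integrable lborel (heat a)" unfolding heat_def[abs_def] by simp
  have "complex_of_real (LINT y|lborel. exp (- (norm (y::real^2))\<^sup>2 / (2 * a))) = complex_of_real (2 * pi * a)"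
    using integral_gauss_real2[OF a', of 0] unfolding eq by simp
  then have "(LINT y|lborel. exp (- (norm (y::real^2))\<^sup>2 / (2 * a))) = 2 * pi * a"
    by (simp only: of_real_eq_iff)
  then show "(LINT u|lborel. heat a u) = (2 * pi)\<^sup>2"
    unfolding heat_def using a by (simp add: power2_eq_square)
qed

lemma nn_integral_shift:
  fixes h :: "real^2 \<Rightarrow> ennreal"
  assumes [measurable]: "h \<in> borel_measurable borel"
  shows "(\<integral>\<^sup>+z. h (z - x) \<partial>lborel) = (\<integral>\<^sup>+z. h z \<partial>lborel)"
proof -
  have "(\<integral>\<^sup>+z. h z \<partial>lborel) = (\<integral>\<^sup>+z. h z \<partial>distr lborel borel ((+) (- x)))"
    by (simp add: lborel_distr_plus)
  also have "\<dots> = (\<integral>\<^sup>+z. h (- x + z) \<partial>lborel)" by (rule nn_integral_distr) auto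
  finally show ?thesis by simp
qed

lemma heat_commute: "heat a (x - z) = heat a (z - x)"
  by (simp add: heat_def norm_minus_commute)

lemma nn_integral_heat:
  assumes "a > 0"
  shows "(\<integral>\<^sup>+z. ennreal (heat a (z - x)) \<partial>lborel) = ennreal ((2 * pi)\<^sup>2)"
proof -
  have "(\<integral>\<^sup>+z. ennreal (heat a (z - x)) \<partial>lborel) = (\<integral>\<^sup>+z. ennreal (heat a z) \<partial>lborel)"
    by (rule nn_integral_shift) simp
  also have "\<dots> = ennreal (LINT u|lborel. heat a u)"
    by (rule nn_integral_eq_integral) (auto simp: assms integrable_heat heat_nonneg)
  finally show ?thesis by (simp add: assms integral_heat)
qed

lemma integrable_gauss_mult:
  fixes F :: "real^2 \<Rightarrow> complex"
  assumes a: "a > 0" and [measurable]: "F \<in> borel_measurable borel" and B: "\<And>y. cmod (F y) \<le> B"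
  shows "integrable lborel (\<lambda>y. complex_of_real (exp (- a * (norm y)\<^sup>2 / 2)) * F y)"
proof (rule Bochner_Integration.integrable_bound)
  show "integrable lborel (\<lambda>y::real^2. B * exp (- a * (norm y)\<^sup>2 / 2))"
    using integrable_gauss_real2[OF a, of 0] by (simp add: complex_of_real_integrable_eq)
  have "0 \<le> B" using norm_ge_zero B order_trans by blast
  then show "AE y in lborel. norm (complex_of_real (exp (- a * (norm y)\<^sup>2 / 2)) * F y) \<le> norm (B * exp (- a * (norm y)\<^sup>2 / 2))"
    using B by (auto simp: norm_mult mult.commute intro!: mult_left_mono)
qed simp

lemma integrable_gauss:
  "a > 0 \<Longrightarrow> integrable lborel (\<lambda>y::real^2. exp (- a * (norm y)\<^sup>2 / 2))"
  using integrable_gauss_real2[of a 0] by (simp add: complex_of_real_integrable_eq)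

text \<open>
  Exchange the two integrations: the inner one is then the Fourier integral of a Gaussian. The
  damping factor is what makes the double integral absolutely convergent.
\<close>

lemma FT_gauss_FT:
  assumes a: "a > 0" and \<sigma>: "\<bar>\<sigma>\<bar> = 1" and f: "integrable lborel f"
  shows "FT (-\<sigma>) (\<lambda>y. complex_of_real (exp (- a * (norm y)\<^sup>2 / 2)) * FT \<sigma> f y) x
     = (LINT z|lborel. complex_of_real (heat a (x - z)) * f z)"
proof -
  have [measurable]: "f \<in> borel_measurable borel" using f by auto
  define K where "K y z = complex_of_real (exp (- a * (norm y)\<^sup>2 / 2)) * cis (y \<bullet> (\<sigma> *\<^sub>R (z - x))) * f z" for y z :: "real^2"
  have Kn: "cmod (K y z) = exp (- a * (norm y)\<^sup>2 / 2) * cmod (f z)" for y z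
    by (simp add: K_def norm_mult)
  have int: "integrable (lborel \<Otimes>\<^sub>M lborel) (case_prod K)"
  proof (rule lborel_pair.Fubini_integrable)
    show "case_prod K \<in> borel_measurable (lborel \<Otimes>\<^sub>M lborel)" unfolding K_def by measurable
    show "integrable lborel (\<lambda>y. LINT z|lborel. norm (case (y, z) of (y, z) \<Rightarrow> K y z))"
      using integrable_gauss[OF a] by (simp add: Kn)
    show "AE y in lborel. integrable lborel (\<lambda>z. case (y, z) of (y, z) \<Rightarrow> K y z)"
    proof (rule AE_I2)
      fix y
      have "integrable lborel (\<lambda>z. complex_of_real (exp (- a * (norm y)\<^sup>2 / 2)) * (cis (y \<bullet> (\<sigma> *\<^sub>R (z - x))) * f z))"
        by (intro integrable_mult_right integrable_cis_mult f) auto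
      then show "integrable lborel (\<lambda>z. case (y, z) of (y, z) \<Rightarrow> K y z)" by (simp add: K_def mult.assoc)
    qed
  qed
  have "FT (-\<sigma>) (\<lambda>y. complex_of_real (exp (- a * (norm y)\<^sup>2 / 2)) * FT \<sigma> f y) x = (LINT y|lborel. LINT z|lborel. K y z)"
    unfolding FT_def[of "-\<sigma>"]
  proof (rule Bochner_Integration.integral_cong[OF refl])
    fix y :: "real^2"
    have "(LINT z|lborel. K y z) = (LINT z|lborel. (cis (- \<sigma> * (x \<bullet> y)) * complex_of_real (exp (- a * (norm y)\<^sup>2 / 2))) * (cis (\<sigma> * (y \<bullet> z)) * f z))"
    proof (rule Bochner_Integration.integral_cong[OF refl])
      fix z
      have "cis (y \<bullet> (\<sigma> *\<^sub>R (z - x))) = cis (- \<sigma> * (x \<bullet> y)) * cis (\<sigma> * (y \<bullet> z))"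
        by (simp add: cis_mult inner_diff_right inner_commute algebra_simps)
      then show "K y z = (cis (- \<sigma> * (x \<bullet> y)) * complex_of_real (exp (- a * (norm y)\<^sup>2 / 2))) * (cis (\<sigma> * (y \<bullet> z)) * f z)"
        by (simp add: K_def)
    qed
    also have "\<dots> = cis (- \<sigma> * (x \<bullet> y)) * complex_of_real (exp (- a * (norm y)\<^sup>2 / 2)) * FT \<sigma> f y"
      unfolding FT_def by simp
    finally show "cis (- \<sigma> * (x \<bullet> y)) * (complex_of_real (exp (- a * (norm y)\<^sup>2 / 2)) * FT \<sigma> f y) = (LINT z|lborel. K y z)"
      by simp
  qed
  also have "\<dots> = (LINT z|lborel. LINT y|lborel. K y z)"
    using lborel_pair.Fubini_integral[OF int] by simp
  also have "\<dots> = (LINT z|lborel. complex_of_real (heat a (x - z)) * f z)"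
  proof (rule Bochner_Integration.integral_cong[OF refl])
    fix z
    have "(LINT y|lborel. K y z) = (LINT y|lborel. complex_of_real (exp (- a * (norm y)\<^sup>2 / 2)) * cis (y \<bullet> (\<sigma> *\<^sub>R (z - x)))) * f z"
      unfolding K_def by simp
    also have "(LINT y|lborel. complex_of_real (exp (- a * (norm y)\<^sup>2 / 2)) * cis (y \<bullet> (\<sigma> *\<^sub>R (z - x)))) = complex_of_real (heat a (x - z))"
      unfolding integral_gauss_real2[OF a] heat_def using \<sigma> by (simp add: norm_minus_commute)
    finally show "(LINT y|lborel. K y z) = complex_of_real (heat a (x - z)) * f z" .
  qed
  finally show ?thesis .
qed

lemma ennreal_norm_integral_le: "ennreal (norm (integral\<^sup>L M f)) \<le> (\<integral>\<^sup>+x. ennreal (norm (f x)) \<partial>M)"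
  by (cases "integrable M f") (auto intro: integral_norm_bound_ennreal simp: not_integrable_integral_eq)

text \<open>
  Schur's test: split the product of the two values of \<open>f\<close> by the inequality between arithmetic and
  geometric mean; in each half one variable is integrated out against the kernel.
\<close>

lemma heat_form_le:
  assumes a: "a > 0" and [measurable]: "f \<in> borel_measurable borel"
  shows "(\<integral>\<^sup>+x. (\<integral>\<^sup>+z. ennreal (heat a (x - z) * (cmod (f x) * cmod (f z))) \<partial>lborel) \<partial>lborel) \<le> ennreal ((2 * pi)\<^sup>2) * sqnorm lborel f"
proof -
  define q where "q x = ennreal ((cmod (f x))\<^sup>2 / 2)" for x
  have [measurable]: "q \<in> borel_measurable borel" unfolding q_def by measurable
  have qq: "q x + q x = ennreal ((cmod (f x))\<^sup>2)" for x unfolding q_def by (subst ennreal_plus[symmetric]) auto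
  have "(\<integral>\<^sup>+x. (\<integral>\<^sup>+z. ennreal (heat a (x - z) * (cmod (f x) * cmod (f z))) \<partial>lborel) \<partial>lborel)
    \<le> (\<integral>\<^sup>+x. (\<integral>\<^sup>+z. ennreal (heat a (z - x)) * q x + ennreal (heat a (z - x)) * q z \<partial>lborel) \<partial>lborel)"
  proof (intro nn_integral_mono)
    fix x z
    have "cmod (f x) * cmod (f z) \<le> (cmod (f x))\<^sup>2 / 2 + (cmod (f z))\<^sup>2 / 2"
      using zero_le_power2[of "cmod (f x) - cmod (f z)"] by (simp add: power2_diff)
    then have "heat a (x - z) * (cmod (f x) * cmod (f z)) \<le> heat a (z - x) * ((cmod (f x))\<^sup>2 / 2 + (cmod (f z))\<^sup>2 / 2)"
      unfolding heat_commute[of a x z] by (intro mult_left_mono heat_nonneg a)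
    then have "ennreal (heat a (x - z) * (cmod (f x) * cmod (f z))) \<le> ennreal (heat a (z - x) * ((cmod (f x))\<^sup>2 / 2 + (cmod (f z))\<^sup>2 / 2))"
      by (rule ennreal_leI)
    also have "\<dots> = ennreal (heat a (z - x)) * q x + ennreal (heat a (z - x)) * q z"
      unfolding q_def distrib_left using heat_nonneg[OF a] by (subst ennreal_plus) (auto simp: ennreal_mult simp del: times_divide_eq_right)
    finally show "ennreal (heat a (x - z) * (cmod (f x) * cmod (f z))) \<le> ennreal (heat a (z - x)) * q x + ennreal (heat a (z - x)) * q z" .
  qed
  also have "\<dots> = (\<integral>\<^sup>+x. (\<integral>\<^sup>+z. ennreal (heat a (z - x)) * q x \<partial>lborel) \<partial>lborel) + (\<integral>\<^sup>+x. (\<integral>\<^sup>+z. ennreal (heat a (z - x)) * q z \<partial>lborel) \<partial>lborel)"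
    by (simp add: nn_integral_add)
  also have "(\<integral>\<^sup>+x. (\<integral>\<^sup>+z. ennreal (heat a (z - x)) * q z \<partial>lborel) \<partial>lborel) = (\<integral>\<^sup>+z. (\<integral>\<^sup>+x. ennreal (heat a (z - x)) * q z \<partial>lborel) \<partial>lborel)"
    by (rule lborel_pair.Fubini') measurable
  also have "\<dots> = (\<integral>\<^sup>+z. (\<integral>\<^sup>+x. ennreal (heat a (x - z)) * q z \<partial>lborel) \<partial>lborel)"
    by (simp add: heat_commute)
  also have "(\<integral>\<^sup>+x. (\<integral>\<^sup>+z. ennreal (heat a (z - x)) * q x \<partial>lborel) \<partial>lborel) = ennreal ((2 * pi)\<^sup>2) * (\<integral>\<^sup>+x. q x \<partial>lborel)"
    by (simp add: nn_integral_multc nn_integral_heat[OF a] nn_integral_cmult)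
  also have "ennreal ((2 * pi)\<^sup>2) * (\<integral>\<^sup>+x. q x \<partial>lborel) + ennreal ((2 * pi)\<^sup>2) * (\<integral>\<^sup>+x. q x \<partial>lborel) = ennreal ((2 * pi)\<^sup>2) * (\<integral>\<^sup>+x. q x + q x \<partial>lborel)"
    by (simp add: nn_integral_add distrib_left)
  also have "\<dots> = ennreal ((2 * pi)\<^sup>2) * sqnorm lborel f" unfolding qq sqnorm_def ..
  finally show ?thesis .
qed

lemma borel_measurable_cnj [measurable (raw)]:
  "f \<in> borel_measurable M \<Longrightarrow> (\<lambda>x. cnj (f x)) \<in> borel_measurable M"
  by (rule measurable_compose[of f M borel]) (auto intro!: borel_measurable_continuous_onI continuous_intros)

text \<open>
  One of the two factors \<open>F\<close> in \<open>|F|\<^sup>2\<close> is written as an integral of \<open>cnj f\<close>. Integrating first in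
  the frequency variable leaves the Gaussian-damped inverse transform of \<open>F\<close>, which is a heat
  convolution by \<open>FT_gauss_FT\<close>, tested against \<open>f\<close>.
\<close>

lemma FT_gauss_energy:
  assumes a: "a > 0" and \<sigma>: "\<bar>\<sigma>\<bar> = 1" and f: "integrable lborel f"
  shows "(\<integral>\<^sup>+y. ennreal (exp (- a * (norm y)\<^sup>2 / 2) * (cmod (FT \<sigma> f y))\<^sup>2) \<partial>lborel) \<le> ennreal ((2 * pi)\<^sup>2) * sqnorm lborel f"
proof -
  have [measurable]: "f \<in> borel_measurable borel" using f by auto
  define F where "F = FT \<sigma> f"
  define B where "B = (LINT z|lborel. cmod (f z))"
  have [measurable]: "F \<in> borel_measurable borel" unfolding F_def by measurable
  have FB: "cmod (F y) \<le> B" for y unfolding F_def B_def by (rule norm_FT_le[OF f])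
  define g where "g y = complex_of_real (exp (- a * (norm y)\<^sup>2 / 2))" for y :: "real^2"
  have [measurable]: "g \<in> borel_measurable borel" unfolding g_def by measurable
  define H where "H = FT (-\<sigma>) (\<lambda>y. g y * F y)"
  have gF: "integrable lborel (\<lambda>y. g y * F y)"
    unfolding g_def by (rule integrable_gauss_mult[OF a _ FB]) measurable
  define L where "L y x = g y * F y * (cis (-\<sigma> * (y \<bullet> x)) * cnj (f x))" for y x
  have Ln: "cmod (L y x) = cmod (g y * F y) * cmod (f x)" for y x
    by (simp add: L_def norm_mult)
  have int: "integrable (lborel \<Otimes>\<^sub>M lborel) (case_prod L)"
  proof (rule lborel_pair.Fubini_integrable)
    show "case_prod L \<in> borel_measurable (lborel \<Otimes>\<^sub>M lborel)" unfolding L_def by measurable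
    show "integrable lborel (\<lambda>y. LINT z|lborel. norm (case (y, z) of (y, z) \<Rightarrow> L y z))"
      using integrable_norm[OF gF] by (simp add: Ln)
    show "AE y in lborel. integrable lborel (\<lambda>z. case (y, z) of (y, z) \<Rightarrow> L y z)"
      unfolding L_def using f by (intro AE_I2) (auto intro!: integrable_mult_right integrable_cis_mult)
  qed
  have cnjF: "cnj (F y) = (LINT x|lborel. cis (-\<sigma> * (y \<bullet> x)) * cnj (f x))" for y
    unfolding F_def FT_def by (subst Bochner_Integration.integral_cnj[symmetric]) (simp add: cis_cnj)
  have pos: "complex_of_real (exp (- a * (norm y)\<^sup>2 / 2) * (cmod (F y))\<^sup>2) = g y * F y * cnj (F y)" for y
    unfolding g_def of_real_mult complex_norm_square by (simp add: mult.assoc)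
  have i: "integrable lborel (\<lambda>y. exp (- a * (norm y)\<^sup>2 / 2) * (cmod (F y))\<^sup>2)"
  proof -
    have "integrable lborel (\<lambda>y. g y * (F y * cnj (F y)))"
      unfolding g_def
    proof (rule integrable_gauss_mult[OF a])
      show "cmod (F y * cnj (F y)) \<le> B * B" for y
        using FB[of y] by (auto simp: norm_mult intro!: mult_mono order_trans[OF _ FB])
    qed measurable
    then have "integrable lborel (\<lambda>y. complex_of_real (exp (- a * (norm y)\<^sup>2 / 2) * (cmod (F y))\<^sup>2))"
      unfolding pos by (simp add: mult.assoc)
    then show ?thesis by (simp only: complex_of_real_integrable_eq)
  qed
  define I where "I = (LINT y|lborel. exp (- a * (norm y)\<^sup>2 / 2) * (cmod (F y))\<^sup>2)"
  have I0: "I \<ge> 0" unfolding I_def by (rule Bochner_Integration.integral_nonneg) auto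
  have "complex_of_real I = (LINT y|lborel. g y * F y * cnj (F y))"
    unfolding I_def integral_complex_of_real[symmetric] pos ..
  also have "\<dots> = (LINT y|lborel. LINT x|lborel. L y x)"
    unfolding cnjF L_def by simp
  also have "\<dots> = (LINT x|lborel. LINT y|lborel. L y x)"
    using lborel_pair.Fubini_integral[OF int] by simp
  also have "\<dots> = (LINT x|lborel. H x * cnj (f x))"
  proof (rule Bochner_Integration.integral_cong[OF refl])
    fix x
    have "(LINT y|lborel. L y x) = (LINT y|lborel. (cis (- \<sigma> * (x \<bullet> y)) * (g y * F y)) * cnj (f x))"
      unfolding L_def by (simp add: mult_ac inner_commute)
    also have "\<dots> = H x * cnj (f x)" unfolding H_def FT_def by simp
    finally show "(LINT y|lborel. L y x) = H x * cnj (f x)" .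
  qed
  finally have Ieq: "complex_of_real I = (LINT x|lborel. H x * cnj (f x))" .
  have "ennreal I = ennreal (cmod (complex_of_real I))" using I0 by simp
  also have "\<dots> \<le> (\<integral>\<^sup>+x. ennreal (cmod (H x * cnj (f x))) \<partial>lborel)"
    unfolding Ieq by (rule ennreal_norm_integral_le)
  also have "\<dots> \<le> (\<integral>\<^sup>+x. (\<integral>\<^sup>+z. ennreal (heat a (x - z) * (cmod (f x) * cmod (f z))) \<partial>lborel) \<partial>lborel)"
  proof (rule nn_integral_mono)
    fix x
    have "H x = (LINT z|lborel. complex_of_real (heat a (x - z)) * f z)"
      unfolding H_def g_def F_def by (rule FT_gauss_FT[OF a \<sigma> f])
    then have "ennreal (cmod (H x)) \<le> (\<integral>\<^sup>+z. ennreal (norm (complex_of_real (heat a (x - z)) * f z)) \<partial>lborel)"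
      using ennreal_norm_integral_le by metis
    then have "ennreal (cmod (H x * cnj (f x))) \<le> (\<integral>\<^sup>+z. ennreal (norm (complex_of_real (heat a (x - z)) * f z)) \<partial>lborel) * ennreal (cmod (f x))"
      by (simp add: norm_mult ennreal_mult mult_right_mono)
    also have "\<dots> = (\<integral>\<^sup>+z. ennreal (norm (complex_of_real (heat a (x - z)) * f z)) * ennreal (cmod (f x)) \<partial>lborel)"
      by (rule nn_integral_multc[symmetric]) measurable
    also have "\<dots> = (\<integral>\<^sup>+z. ennreal (heat a (x - z) * (cmod (f x) * cmod (f z))) \<partial>lborel)"
      using heat_nonneg[OF a] by (intro nn_integral_cong) (simp add: norm_mult ennreal_mult mult_ac)
    finally show "ennreal (cmod (H x * cnj (f x))) \<le> (\<integral>\<^sup>+z. ennreal (heat a (x - z) * (cmod (f x) * cmod (f z))) \<partial>lborel)" .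
  qed
  also have "\<dots> \<le> ennreal ((2 * pi)\<^sup>2) * sqnorm lborel f"
    by (rule heat_form_le[OF a]) measurable
  finally show ?thesis
    unfolding I_def F_def by (subst nn_integral_eq_integral) (use i F_def in auto)
qed

text \<open>
  Let the damping in \<open>FT_gauss_energy\<close> tend to zero and apply Fatou's lemma.
\<close>

lemma FT_Bessel:
  assumes \<sigma>: "\<bar>\<sigma>\<bar> = 1" and f: "integrable lborel f"
  shows "sqnorm lborel (FT \<sigma> f) \<le> ennreal ((2 * pi)\<^sup>2) * sqnorm lborel f"
proof -
  have [measurable]: "f \<in> borel_measurable borel" using f by auto
  define u where "u n y = ennreal (exp (- (1 / Suc n) * (norm y)\<^sup>2 / 2) * (cmod (FT \<sigma> f y))\<^sup>2)" for n and y :: "real^2"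
  have [measurable]: "u n \<in> borel_measurable borel" for n unfolding u_def by measurable
  have lim: "(\<lambda>n. u n y) \<longlonglongrightarrow> ennreal ((cmod (FT \<sigma> f y))\<^sup>2)" for y
  proof -
    have "(\<lambda>n. exp (- (1 / Suc n) * (norm y)\<^sup>2 / 2) * (cmod (FT \<sigma> f y))\<^sup>2) \<longlonglongrightarrow> exp (- 0 * (norm y)\<^sup>2 / 2) * (cmod (FT \<sigma> f y))\<^sup>2"
      by (intro tendsto_intros LIMSEQ_Suc[OF lim_1_over_n]) simp
    then show ?thesis unfolding u_def by (intro tendsto_ennrealI) simp
  qed
  have "sqnorm lborel (FT \<sigma> f) = (\<integral>\<^sup>+y. liminf (\<lambda>n. u n y) \<partial>lborel)"
    unfolding sqnorm_def using lim_imp_Liminf[OF _ lim] by simp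
  also have "\<dots> \<le> liminf (\<lambda>n. \<integral>\<^sup>+y. u n y \<partial>lborel)"
    by (rule nn_integral_liminf) measurable
  also have "\<dots> \<le> liminf (\<lambda>n. ennreal ((2 * pi)\<^sup>2) * sqnorm lborel f)"
  proof (rule Liminf_mono, rule always_eventually, rule allI)
    fix n show "(\<integral>\<^sup>+y. u n y \<partial>lborel) \<le> ennreal ((2 * pi)\<^sup>2) * sqnorm lborel f"
      unfolding u_def by (rule FT_gauss_energy[OF _ \<sigma> f]) simp
  qed
  also have "\<dots> = ennreal ((2 * pi)\<^sup>2) * sqnorm lborel f"
    by (simp add: Liminf_const)
  finally show ?thesis .
qed

lemma ennreal_tendsto_0I:
  fixes f :: "'a \<Rightarrow> ennreal"
  assumes "\<And>e::real. e > 0 \<Longrightarrow> \<forall>\<^sub>F x in F. f x \<le> ennreal e"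
  shows "(f \<longlongrightarrow> 0) F"
proof (rule order_tendstoI)
  fix a :: ennreal assume a: "0 < a"
  obtain e where e: "e > 0" "ennreal e < a"
  proof (cases a)
    case (real r)
    then have "r > 0" using a by simp
    then have "ennreal (r / 2) < a" "r / 2 > 0" using real by (auto simp: ennreal_less_iff)
    then show thesis using that by blast
  next
    case top then show thesis using that[of 1] by simp
  qed
  from assms[OF e(1)] show "\<forall>\<^sub>F x in F. f x < a"
    by eventually_elim (use e in auto)
qed simp

lemma ennreal_tendsto_0D:
  fixes f :: "'a \<Rightarrow> ennreal"
  assumes "(f \<longlongrightarrow> 0) F" "e > 0"
  shows "\<forall>\<^sub>F x in F. f x \<le> ennreal e"
proof -
  have "\<forall>\<^sub>F x in F. f x < ennreal e" using assms by (intro order_tendstoD) auto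
  then show ?thesis by eventually_elim auto
qed

text \<open>
  Along radii \<open>r k\<close> at which the oscillation has fallen below \<open>(1/4) ^ k\<close>, the family has
  increments to which \<open>Riesz_Fischer\<close> applies.
\<close>

lemma L2_complete_at_top:
  fixes A :: "real \<Rightarrow> 'a \<Rightarrow> complex"
  assumes [measurable]: "\<And>R. A R \<in> borel_measurable M"
    and cauchy: "\<And>e::real. e > 0 \<Longrightarrow> \<exists>R0. \<forall>R\<ge>R0. \<forall>R'\<ge>R0. sqnorm M (\<lambda>x. A R x - A R' x) \<le> ennreal e"
  obtains g where "g \<in> borel_measurable M" "((\<lambda>R. sqnorm M (\<lambda>x. A R x - g x)) \<longlongrightarrow> 0) at_top"
proof -
  have "\<forall>k::nat. \<exists>R0. \<forall>R\<ge>R0. \<forall>R'\<ge>R0. sqnorm M (\<lambda>x. A R x - A R' x) \<le> ennreal ((1/4)^k)"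
    by (intro allI cauchy) simp
  then obtain \<rho> where \<rho>: "\<And>k R R'. R \<ge> \<rho> k \<Longrightarrow> R' \<ge> \<rho> k \<Longrightarrow> sqnorm M (\<lambda>x. A R x - A R' x) \<le> ennreal ((1/4)^k)"
    by metis
  \<comment> \<open>Partial sums make the radii increasing.\<close>
  define r where "r k = (\<Sum>i\<le>k. \<bar>\<rho> i\<bar>)" for k
  have r1: "r k \<ge> \<rho> k" for k
    unfolding r_def by (rule order_trans[OF abs_ge_self]) (intro member_le_sum, auto)
  have r2: "r (Suc k) \<ge> r k" for k unfolding r_def by simp
  define d where "d k x = A (r (Suc k)) x - A (r k) x" for k x
  have [measurable]: "d k \<in> borel_measurable M" for k unfolding d_def by measurable
  have dk: "sqnorm M (d k) \<le> ennreal ((1/4)^k)" for k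
    unfolding d_def by (rule \<rho>) (use r1 r2 order_trans in blast)+
  define S where "S = (\<Sum>k. ennreal (2 ^ k) * sqnorm M (d k))"
  have "S \<le> (\<Sum>k. ennreal ((1/2)^k))"
    unfolding S_def
  proof (intro suminf_le)
    fix k
    have "ennreal (2 ^ k) * sqnorm M (d k) \<le> ennreal (2^k) * ennreal ((1/4)^k)"
      by (intro mult_left_mono dk) auto
    also have "\<dots> = ennreal ((1/2)^k)"
      by (subst ennreal_mult[symmetric]) (auto simp: power_mult_distrib[symmetric])
    finally show "ennreal (2 ^ k) * sqnorm M (d k) \<le> ennreal ((1/2)^k)" .
  qed auto
  also have "\<dots> = ennreal (\<Sum>k. (1/2)^k)"
    by (rule suminf_ennreal2) (auto intro: summable_geometric)
  finally have S: "S < \<infinity>" using le_less_trans by fastforce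
  obtain g0 where [measurable]: "g0 \<in> borel_measurable M" and
    g0: "\<And>K. sqnorm M (\<lambda>x. g0 x - (\<Sum>k<K. d k x)) \<le> ennreal (2 * (1/2)^K) * S"
    using Riesz_Fischer[of d M] S unfolding S_def by auto
  define g where "g x = A (r 0) x + g0 x" for x
  have [measurable]: "g \<in> borel_measurable M" unfolding g_def by measurable
  have tele: "(\<Sum>k<K. d k x) = A (r K) x - A (r 0) x" for K x
    unfolding d_def by (induction K) auto
  have gK: "sqnorm M (\<lambda>x. A (r K) x - g x) \<le> ennreal (2 * (1/2)^K) * S" for K
    using g0[of K] unfolding tele g_def by (subst sqnorm_minus_commute) (simp add: algebra_simps)
  define s where "s = enn2real S"
  have s: "S = ennreal s" "s \<ge> 0" using S by (auto simp: s_def)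
  define b where "b K = 2 * (1/4)^K + 4 * s * (1/2)^K" for K :: nat
  have bnd: "sqnorm M (\<lambda>x. A R x - g x) \<le> ennreal (b K)" if R: "R \<ge> r K" for R K
  proof -
    have "sqnorm M (\<lambda>x. A R x - g x) \<le> 2 * sqnorm M (\<lambda>x. A R x - A (r K) x) + 2 * sqnorm M (\<lambda>x. A (r K) x - g x)"
      by (rule sqnorm_diff_triangle) measurable
    also have "\<dots> \<le> 2 * ennreal ((1/4)^K) + 2 * (ennreal (2 * (1/2)^K) * S)"
      using R r1[of K] by (intro add_mono mult_left_mono gK \<rho>) auto
    also have "\<dots> = ennreal (b K)"
      unfolding b_def s(1) using s(2)
      by (simp add: ennreal_mult[symmetric] ennreal_plus[symmetric] numeral_mult_ennreal mult_ac del: ennreal_plus)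
    finally show ?thesis .
  qed
  have b0: "b \<longlonglongrightarrow> 0"
  proof -
    have "b \<longlonglongrightarrow> 2 * 0 + 4 * s * 0" unfolding b_def
      by (intro tendsto_intros LIMSEQ_realpow_zero) auto
    then show ?thesis by simp
  qed
  have "((\<lambda>R. sqnorm M (\<lambda>x. A R x - g x)) \<longlongrightarrow> 0) at_top"
  proof (rule ennreal_tendsto_0I)
    fix e :: real assume "e > 0"
    then have "\<forall>\<^sub>F K in sequentially. b K < e" by (intro order_tendstoD(2)[OF b0])
    then obtain K where "b K < e" by (auto simp: eventually_sequentially)
    then have "\<forall>R\<ge>r K. sqnorm M (\<lambda>x. A R x - g x) \<le> ennreal e"
      using bnd by (meson ennreal_leI less_imp_le order_trans)
    then show "\<forall>\<^sub>F R in at_top. sqnorm M (\<lambda>x. A R x - g x) \<le> ennreal e"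
      unfolding eventually_at_top_linorder by blast
  qed
  then show thesis using that[of g] by simp
qed

lemma sqnorm_dominated:
  assumes [measurable]: "\<And>n::nat. u n \<in> borel_measurable M" "w \<in> borel_measurable M"
    and le: "\<And>n x. x \<in> space M \<Longrightarrow> cmod (u n x) \<le> cmod (w x)" and w: "sqnorm M w < \<infinity>"
    and lim: "\<And>x. x \<in> space M \<Longrightarrow> (\<lambda>n. u n x) \<longlonglongrightarrow> 0"
  shows "(\<lambda>n. sqnorm M (u n)) \<longlonglongrightarrow> 0"
proof -
  have "(\<lambda>n. \<integral>\<^sup>+x. ennreal ((cmod (u n x))\<^sup>2) \<partial>M) \<longlonglongrightarrow> (\<integral>\<^sup>+x. 0 \<partial>M)"
  proof (rule nn_integral_dominated_convergence[where w = "\<lambda>x. ennreal ((cmod (w x))\<^sup>2)"])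
    show "AE x in M. (\<lambda>n. ennreal ((cmod (u n x))\<^sup>2)) \<longlonglongrightarrow> 0"
    proof (rule AE_I2)
      fix x assume "x \<in> space M"
      from lim[OF this] have "(\<lambda>n. (cmod (u n x))\<^sup>2) \<longlonglongrightarrow> (cmod 0)\<^sup>2" by (intro tendsto_intros)
      then show "(\<lambda>n. ennreal ((cmod (u n x))\<^sup>2)) \<longlonglongrightarrow> 0"
        using tendsto_ennrealI by fastforce
    qed
    show "AE x in M. ennreal ((cmod (u j x))\<^sup>2) \<le> ennreal ((cmod (w x))\<^sup>2)" for j
      using le by (intro AE_I2 ennreal_leI power_mono) auto
    show "(\<integral>\<^sup>+ x. ennreal ((cmod (w x))\<^sup>2) \<partial>M) < \<infinity>" using w unfolding sqnorm_def .
  qed measurable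
  then show ?thesis unfolding sqnorm_def by simp
qed

abbreviation cut :: "real \<Rightarrow> (real^2 \<Rightarrow> complex) \<Rightarrow> real^2 \<Rightarrow> complex" where
  "cut R G \<equiv> (\<lambda>z. indicator (ball 0 R) z *\<^sub>R G z)"

section \<open>The Fourier transform on L2\<close>

lemma ennreal_tendsto_0_mono:
  fixes u v :: "'a \<Rightarrow> ennreal"
  assumes "(v \<longlongrightarrow> 0) F" "\<And>x. u x \<le> v x"
  shows "(u \<longlongrightarrow> 0) F"
  by (rule tendsto_sandwich[OF _ _ tendsto_const assms(1)]) (auto intro!: always_eventually assms(2))

lemma ball_borel [measurable]: "ball (c::'a::metric_space) R \<in> sets borel"
  by simp

text \<open>
  The relation says that \<open>g\<close> represents the \<open>L2\<close> transform of \<open>G\<close>. A relation is used instead of an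
  operator because transforms are determined almost everywhere only.
\<close>

definition is_FT :: "real \<Rightarrow> (real^2 \<Rightarrow> complex) \<Rightarrow> (real^2 \<Rightarrow> complex) \<Rightarrow> bool" where
  "is_FT \<sigma> G g \<longleftrightarrow> G \<in> borel_measurable borel \<and> sqnorm lborel G < \<infinity> \<and> g \<in> borel_measurable borel \<and>
     ((\<lambda>R. sqnorm lborel (\<lambda>y. FT \<sigma> (cut R G) y - g y)) \<longlongrightarrow> 0) at_top"

lemma is_FT_D:
  assumes "is_FT \<sigma> G g"
  shows "G \<in> borel_measurable borel" "sqnorm lborel G < \<infinity>" "g \<in> borel_measurable borel"
    "((\<lambda>R. sqnorm lborel (\<lambda>y. FT \<sigma> (cut R G) y - g y)) \<longlongrightarrow> 0) at_top"
  using assms unfolding is_FT_def by auto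

text \<open>
  On a ball, which has finite measure, \<open>L2\<close> is contained in \<open>L1\<close>.
\<close>

lemma integrable_cut:
  assumes [measurable]: "G \<in> borel_measurable borel" and fin: "sqnorm lborel G < \<infinity>"
  shows "integrable lborel (cut R G)"
proof (rule Bochner_Integration.integrable_bound)
  have "integrable lborel (\<lambda>z. (cmod (G z))\<^sup>2)" using fin sqnorm_finite_iff[of G lborel] by simp
  moreover have "integrable lborel (indicator (ball (0::real^2) R) :: _ \<Rightarrow> real)"
    using emeasure_lborel_ball_finite[of "0::real^2" R] by (intro integrable_real_indicator) auto
  ultimately show "integrable lborel (\<lambda>z. indicator (ball (0::real^2) R) z + (cmod (G z))\<^sup>2 :: real)"
    by simp
  show "AE z in lborel. norm (cut R G z) \<le> norm (indicator (ball (0::real^2) R) z + (cmod (G z))\<^sup>2 :: real)"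
  proof (rule AE_I2)
    fix z :: "real^2"
    have "2 * cmod (G z) \<le> 1 + (cmod (G z))\<^sup>2"
      using zero_le_power2[of "cmod (G z) - 1"] by (simp add: power2_diff)
    then have "cmod (G z) \<le> 1 + (cmod (G z))\<^sup>2"
      using norm_ge_zero[of "G z"] by linarith
    then show "norm (cut R G z) \<le> norm (indicator (ball (0::real^2) R) z + (cmod (G z))\<^sup>2 :: real)"
      by (auto simp: indicator_def)
  qed
qed measurable

lemma sqnorm_cut_le: "sqnorm M (\<lambda>z. indicator A z *\<^sub>R G z) \<le> sqnorm M G"
  by (rule sqnorm_mono) (auto simp: indicator_def)

lemma sqnorm_cut_tendsto:
  assumes [measurable]: "G \<in> borel_measurable borel" and fin: "sqnorm lborel G < \<infinity>"
  shows "((\<lambda>R. sqnorm lborel (\<lambda>z. cut R G z - G z)) \<longlongrightarrow> 0) at_top"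
proof (rule tendsto_at_topI_sequentially)
  fix X :: "nat \<Rightarrow> real" assume X: "filterlim X at_top sequentially"
  show "(\<lambda>n. sqnorm lborel (\<lambda>z. cut (X n) G z - G z)) \<longlonglongrightarrow> 0"
  proof (rule sqnorm_dominated[where w = G])
    show "cmod (cut (X n) G z - G z) \<le> cmod (G z)" for n z by (auto simp: indicator_def)
    fix z :: "real^2"
    have "\<forall>\<^sub>F n in sequentially. X n > norm z" using X by (simp add: filterlim_at_top_dense)
    then have "\<forall>\<^sub>F n in sequentially. cut (X n) G z - G z = 0"
      by eventually_elim (auto simp: indicator_def)
    then show "(\<lambda>n. cut (X n) G z - G z) \<longlonglongrightarrow> 0" by (simp add: tendsto_eventually)
  qed (use fin in auto)
qed

lemma FT_cut_diff_le:
  assumes \<sigma>: "\<bar>\<sigma>\<bar> = 1" and [measurable]: "G \<in> borel_measurable borel" and fin: "sqnorm lborel G < \<infinity>"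
  shows "sqnorm lborel (\<lambda>y. FT \<sigma> (cut R G) y - FT \<sigma> (cut R' G) y)
    \<le> ennreal ((2*pi)\<^sup>2) * (2 * sqnorm lborel (\<lambda>z. cut R G z - G z) + 2 * sqnorm lborel (\<lambda>z. cut R' G z - G z))"
proof -
  have "(\<lambda>y. FT \<sigma> (cut R G) y - FT \<sigma> (cut R' G) y) = FT \<sigma> (\<lambda>z. cut R G z - cut R' G z)"
    by (intro ext FT_diff[symmetric] integrable_cut fin) auto
  then have "sqnorm lborel (\<lambda>y. FT \<sigma> (cut R G) y - FT \<sigma> (cut R' G) y) = sqnorm lborel (FT \<sigma> (\<lambda>z. cut R G z - cut R' G z))"
    by simp
  also have "\<dots> \<le> ennreal ((2*pi)\<^sup>2) * sqnorm lborel (\<lambda>z. cut R G z - cut R' G z)"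
    by (intro FT_Bessel[OF \<sigma>] Bochner_Integration.integrable_diff integrable_cut fin) auto
  also have "sqnorm lborel (\<lambda>z. cut R G z - cut R' G z) \<le> 2 * sqnorm lborel (\<lambda>z. cut R G z - G z) + 2 * sqnorm lborel (\<lambda>z. G z - cut R' G z)"
    by (rule sqnorm_diff_triangle) measurable
  also have "sqnorm lborel (\<lambda>z. G z - cut R' G z) = sqnorm lborel (\<lambda>z. cut R' G z - G z)"
    by (rule sqnorm_minus_commute)
  finally show ?thesis by (simp add: mult_left_mono)
qed

lemma is_FT_exists:
  assumes \<sigma>: "\<bar>\<sigma>\<bar> = 1" and [measurable]: "G \<in> borel_measurable borel" and fin: "sqnorm lborel G < \<infinity>"
  shows "\<exists>g. is_FT \<sigma> G g"
proof -
  obtain g where "g \<in> borel_measurable lborel"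
    "((\<lambda>R. sqnorm lborel (\<lambda>x. FT \<sigma> (cut R G) x - g x)) \<longlongrightarrow> 0) at_top"
  proof (rule L2_complete_at_top[of "\<lambda>R. FT \<sigma> (cut R G)" lborel])
    fix e :: real assume e: "e > 0"
    define Q where "Q = (2 * pi)\<^sup>2"
    have Q: "Q > 0" by (simp add: Q_def)
    define e' where "e' = e / (Q * 4)"
    have e': "e' > 0" using e Q by (simp add: e'_def)
    obtain R0 where R0: "\<And>R. R \<ge> R0 \<Longrightarrow> sqnorm lborel (\<lambda>z. cut R G z - G z) \<le> ennreal e'"
      using ennreal_tendsto_0D[OF sqnorm_cut_tendsto[OF assms(2) fin] e'] unfolding eventually_at_top_linorder by auto
    have "sqnorm lborel (\<lambda>x. FT \<sigma> (cut R G) x - FT \<sigma> (cut R' G) x) \<le> ennreal e" if "R \<ge> R0" "R' \<ge> R0" for R R'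
    proof -
      have "sqnorm lborel (\<lambda>y. FT \<sigma> (cut R G) y - FT \<sigma> (cut R' G) y)
        \<le> ennreal (Q) * (2 * sqnorm lborel (\<lambda>z. cut R G z - G z) + 2 * sqnorm lborel (\<lambda>z. cut R' G z - G z))"
        by (rule FT_cut_diff_le[folded Q_def, OF \<sigma> _ fin]) simp
      also have "\<dots> \<le> ennreal (Q) * (2 * ennreal e' + 2 * ennreal e')"
        by (intro mult_left_mono add_mono R0 that) auto
      also have "\<dots> = ennreal (Q * (2 * e' + 2 * e'))"
        using e' Q by (simp add: ennreal_mult[symmetric] ennreal_plus[symmetric] numeral_mult_ennreal del: ennreal_plus)
      also have "\<dots> = ennreal e" using Q by (simp add: e'_def)
      finally show ?thesis .
    qed
    then show "\<exists>R0. \<forall>R\<ge>R0. \<forall>R'\<ge>R0. sqnorm lborel (\<lambda>x. FT \<sigma> (cut R G) x - FT \<sigma> (cut R' G) x) \<le> ennreal e" by blast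
  qed auto
  then show ?thesis unfolding is_FT_def using fin by auto
qed

lemma le_of_tendsto_0:
  fixes u :: "real \<Rightarrow> ennreal"
  assumes "(u \<longlongrightarrow> 0) at_top" "\<And>R. x \<le> c + d * u R" "d < \<infinity>"
  shows "x \<le> c"
proof -
  have "((\<lambda>R. c + d * u R) \<longlongrightarrow> c + d * 0) at_top"
    by (intro tendsto_add tendsto_const ennreal_tendsto_cmult assms(1)) (use assms(3) in simp)
  then show ?thesis using assms(2) tendsto_lowerbound[of "\<lambda>R. c + d * u R" c at_top x] by simp
qed

text \<open>
  The sharp constant is half of this one. The factor \<open>2\<close> is the price of the triangle inequality for
  squares, and is harmless in all that follows.
\<close>

lemma is_FT_bound:
  assumes \<sigma>: "\<bar>\<sigma>\<bar> = 1" and g: "is_FT \<sigma> G g"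
  shows "sqnorm lborel g \<le> ennreal (2 * (2*pi)\<^sup>2) * sqnorm lborel G"
proof (rule le_of_tendsto_0)
  note [measurable] = is_FT_D(1,3)[OF g]
  show "((\<lambda>R. sqnorm lborel (\<lambda>y. FT \<sigma> (cut R G) y - g y)) \<longlongrightarrow> 0) at_top"
    using g unfolding is_FT_def by auto
  fix R
  have "sqnorm lborel (\<lambda>y. g y - 0) \<le> 2 * sqnorm lborel (\<lambda>y. g y - FT \<sigma> (cut R G) y) + 2 * sqnorm lborel (\<lambda>y. FT \<sigma> (cut R G) y - 0)"
    by (rule sqnorm_diff_triangle) measurable
  then have "sqnorm lborel g \<le> 2 * sqnorm lborel (FT \<sigma> (cut R G)) + 2 * sqnorm lborel (\<lambda>y. FT \<sigma> (cut R G) y - g y)"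
    using sqnorm_minus_commute[of lborel g "FT \<sigma> (cut R G)"] by (simp add: add.commute)
  also have "sqnorm lborel (FT \<sigma> (cut R G)) \<le> ennreal ((2*pi)\<^sup>2) * sqnorm lborel (cut R G)"
    by (rule FT_Bessel[OF \<sigma> integrable_cut[OF is_FT_D(1,2)[OF g]]])
  also have "sqnorm lborel (cut R G) \<le> sqnorm lborel G" by (rule sqnorm_cut_le)
  also have "2 * (ennreal ((2*pi)\<^sup>2) * sqnorm lborel G) = ennreal (2 * (2*pi)\<^sup>2) * sqnorm lborel G"
    by (simp add: ennreal_mult mult.assoc)
  finally show "sqnorm lborel g \<le> ennreal (2 * (2*pi)\<^sup>2) * sqnorm lborel G + 2 * sqnorm lborel (\<lambda>y. FT \<sigma> (cut R G) y - g y)"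
    by (simp add: mult_left_mono add_right_mono)
qed simp

lemma is_FT_lincomb:
  assumes g: "is_FT \<sigma> G g" and h: "is_FT \<sigma> H h"
  shows "is_FT \<sigma> (\<lambda>z. G z + c * H z) (\<lambda>y. g y + c * h y)"
proof -
  note [measurable] = is_FT_D(1,3)[OF g] is_FT_D(1,3)[OF h]
  have fin: "sqnorm lborel (\<lambda>z. G z + c * H z) < \<infinity>"
  proof -
    have "sqnorm lborel (\<lambda>z. G z + c * H z) \<le> 2 * sqnorm lborel G + 2 * sqnorm lborel (\<lambda>z. c * H z)"
      by (rule sqnorm_add_le) measurable
    also have "\<dots> < \<infinity>" using is_FT_D(2)[OF g] is_FT_D(2)[OF h]
      by (simp add: sqnorm_cmult ennreal_mult_less_top)
    finally show ?thesis .
  qed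
  have eq: "FT \<sigma> (cut R (\<lambda>z. G z + c * H z)) y = FT \<sigma> (cut R G) y + c * FT \<sigma> (cut R H) y" for R y
  proof -
    have "FT \<sigma> (cut R (\<lambda>z. G z + c * H z)) y = FT \<sigma> (\<lambda>z. cut R G z + c * cut R H z) y"
      by (simp add: scaleR_add_right)
    also have "\<dots> = FT \<sigma> (cut R G) y + FT \<sigma> (\<lambda>z. c * cut R H z) y"
      by (intro FT_add integrable_mult_right integrable_cut is_FT_D(1,2)[OF g] is_FT_D(1,2)[OF h])
    finally show ?thesis by (simp only: FT_cmult)
  qed
  have le: "sqnorm lborel (\<lambda>y. FT \<sigma> (cut R (\<lambda>z. G z + c * H z)) y - (g y + c * h y))
    \<le> 2 * sqnorm lborel (\<lambda>y. FT \<sigma> (cut R G) y - g y) + 2 * (ennreal ((cmod c)\<^sup>2) * sqnorm lborel (\<lambda>y. FT \<sigma> (cut R H) y - h y))" for R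
  proof -
    have "sqnorm lborel (\<lambda>y. FT \<sigma> (cut R (\<lambda>z. G z + c * H z)) y - (g y + c * h y)) = 
       sqnorm lborel (\<lambda>y. (FT \<sigma> (cut R G) y - g y) + c * (FT \<sigma> (cut R H) y - h y))"
      unfolding eq by (simp add: algebra_simps)
    also have "\<dots> \<le> 2 * sqnorm lborel (\<lambda>y. FT \<sigma> (cut R G) y - g y) + 2 * sqnorm lborel (\<lambda>y. c * (FT \<sigma> (cut R H) y - h y))"
      by (rule sqnorm_add_le) measurable
    finally show ?thesis by (simp add: sqnorm_cmult)
  qed
  have "((\<lambda>R. 2 * sqnorm lborel (\<lambda>y. FT \<sigma> (cut R G) y - g y) + 2 * (ennreal ((cmod c)\<^sup>2) * sqnorm lborel (\<lambda>y. FT \<sigma> (cut R H) y - h y))) \<longlongrightarrow> 2 * 0 + 2 * (ennreal ((cmod c)\<^sup>2) * 0)) at_top"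
    by (intro tendsto_add ennreal_tendsto_cmult is_FT_D(4)[OF g] is_FT_D(4)[OF h]) (simp_all only: ennreal_less_top ennreal_numeral[symmetric])
  then have "((\<lambda>R. sqnorm lborel (\<lambda>y. FT \<sigma> (cut R (\<lambda>z. G z + c * H z)) y - (g y + c * h y))) \<longlongrightarrow> 0) at_top"
    by (intro ennreal_tendsto_0_mono[OF _ le]) simp
  then show ?thesis unfolding is_FT_def using fin by auto
qed

lemma is_FT_zero: "is_FT \<sigma> (\<lambda>_. 0) (\<lambda>_. 0)"
  unfolding is_FT_def FT_def sqnorm_def by simp

lemma is_FT_diff:
  assumes "is_FT \<sigma> G g" "is_FT \<sigma> H h"
  shows "is_FT \<sigma> (\<lambda>z. G z - H z) (\<lambda>y. g y - h y)"
  using is_FT_lincomb[OF assms, of "-1"] by simp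

lemma is_FT_cmult:
  assumes "is_FT \<sigma> G g"
  shows "is_FT \<sigma> (\<lambda>z. c * G z) (\<lambda>y. c * g y)"
  using is_FT_lincomb[OF is_FT_zero assms, of c] by simp

lemma is_FT_unique:
  assumes \<sigma>: "\<bar>\<sigma>\<bar> = 1" and g: "is_FT \<sigma> G g" and h: "is_FT \<sigma> G h"
  shows "AE y in lborel. g y = h y"
proof -
  note [measurable] = is_FT_D(1,3)[OF g] is_FT_D(1,3)[OF h]
  have "sqnorm lborel (\<lambda>y. g y - h y) \<le> ennreal (2 * (2*pi)\<^sup>2) * sqnorm lborel (\<lambda>z. G z - G z)"
    by (rule is_FT_bound[OF \<sigma> is_FT_diff[OF g h]])
  then have "sqnorm lborel (\<lambda>y. g y - h y) = 0" by (simp add: sqnorm_def)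
  then show ?thesis using sqnorm_eq_0_iff[of "\<lambda>y. g y - h y" lborel] by simp
qed

lemma is_FT_cong_AE:
  assumes g: "is_FT \<sigma> G g" and [measurable]: "G' \<in> borel_measurable borel" "g' \<in> borel_measurable borel"
    and eq: "AE z in lborel. G z = G' z" "AE y in lborel. g y = g' y"
  shows "is_FT \<sigma> G' g'"
proof -
  note [measurable] = is_FT_D(1,3)[OF g]
  have "sqnorm lborel G' = sqnorm lborel G" by (rule sqnorm_cong_AE) (use eq in auto)
  moreover have "FT \<sigma> (cut R G') y = FT \<sigma> (cut R G) y" for R y
    unfolding FT_def using eq(1) by (intro integral_cong_AE) auto
  moreover have "sqnorm lborel (\<lambda>y. FT \<sigma> (cut R G) y - g' y) = sqnorm lborel (\<lambda>y. FT \<sigma> (cut R G) y - g y)" for R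
    by (rule sqnorm_cong_AE) (use eq(2) in auto)
  ultimately show ?thesis using g unfolding is_FT_def by auto
qed

text \<open>
  Consistency: on integrable functions in \<open>L2\<close> the limit of the truncated integrals is the Fourier
  integral itself, because \<open>FT_Bessel\<close> applies to the part that the truncation removes.
\<close>

lemma is_FT_integrable:
  assumes \<sigma>: "\<bar>\<sigma>\<bar> = 1" and G: "integrable lborel G" and fin: "sqnorm lborel G < \<infinity>"
  shows "is_FT \<sigma> G (FT \<sigma> G)"
proof -
  have [measurable]: "G \<in> borel_measurable borel" using G by auto
  have le: "sqnorm lborel (\<lambda>y. FT \<sigma> (cut R G) y - FT \<sigma> G y) \<le> ennreal ((2*pi)\<^sup>2) * sqnorm lborel (\<lambda>z. cut R G z - G z)" for R
  proof -
    have "(\<lambda>y. FT \<sigma> (cut R G) y - FT \<sigma> G y) = FT \<sigma> (\<lambda>z. cut R G z - G z)"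
      by (intro ext FT_diff[symmetric] integrable_cut fin G) auto
    then have "sqnorm lborel (\<lambda>y. FT \<sigma> (cut R G) y - FT \<sigma> G y) = sqnorm lborel (FT \<sigma> (\<lambda>z. cut R G z - G z))"
      by simp
    also have "\<dots> \<le> ennreal ((2*pi)\<^sup>2) * sqnorm lborel (\<lambda>z. cut R G z - G z)"
      by (intro FT_Bessel[OF \<sigma>] Bochner_Integration.integrable_diff integrable_cut fin G) auto
    finally show ?thesis .
  qed
  have "((\<lambda>R. ennreal ((2*pi)\<^sup>2) * sqnorm lborel (\<lambda>z. cut R G z - G z)) \<longlongrightarrow> ennreal ((2*pi)\<^sup>2) * 0) at_top"
    by (intro ennreal_tendsto_cmult sqnorm_cut_tendsto fin) auto
  then have "((\<lambda>R. sqnorm lborel (\<lambda>y. FT \<sigma> (cut R G) y - FT \<sigma> G y)) \<longlongrightarrow> 0) at_top"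
    by (intro ennreal_tendsto_0_mono[OF _ le]) simp
  then show ?thesis unfolding is_FT_def using fin by auto
qed

section \<open>Fourier inversion on L2\<close>

text \<open>
  The positive and the negative part of \<open>w\<close> are densities of two measures that agree on boxes, hence
  on all Borel sets.
\<close>

lemma AE_zero_of_box_integrals:
  fixes w :: "real^2 \<Rightarrow> real"
  assumes [measurable]: "w \<in> borel_measurable borel"
    and int: "\<And>l u. integrable lborel (\<lambda>x. indicator (box l u) x * w x)"
    and zero: "\<And>l u. (LINT x|lborel. indicator (box l u) x * w x) = 0"
  shows "AE x in lborel. w x = 0"
proof -
  have fin: "(\<integral>\<^sup>+x. ennreal (w x) * indicator (box l u) x \<partial>lborel) < \<infinity>"
    "(\<integral>\<^sup>+x. ennreal (w x) * indicator (box l u) x \<partial>lborel) = (\<integral>\<^sup>+x. ennreal (- w x) * indicator (box l u) x \<partial>lborel)" for l u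
  proof -
    have p: "(\<integral>\<^sup>+x. ennreal (w x) * indicator (box l u) x \<partial>lborel) = (\<integral>\<^sup>+x. ennreal (indicator (box l u) x * w x) \<partial>lborel)"
      by (intro nn_integral_cong) (auto simp: indicator_def)
    have n: "(\<integral>\<^sup>+x. ennreal (- w x) * indicator (box l u) x \<partial>lborel) = (\<integral>\<^sup>+x. ennreal (- (indicator (box l u) x * w x)) \<partial>lborel)"
      by (intro nn_integral_cong) (auto simp: indicator_def)
    have fp: "(\<integral>\<^sup>+x. ennreal (indicator (box l u) x * w x) \<partial>lborel) \<noteq> \<infinity>"
      and fn: "(\<integral>\<^sup>+x. ennreal (- (indicator (box l u) x * w x)) \<partial>lborel) \<noteq> \<infinity>"
      using int[of l u] unfolding real_integrable_def by auto
    show "(\<integral>\<^sup>+x. ennreal (w x) * indicator (box l u) x \<partial>lborel) < \<infinity>" using fp unfolding p by (simp add: less_top)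
    have "enn2real (\<integral>\<^sup>+x. ennreal (indicator (box l u) x * w x) \<partial>lborel) = enn2real (\<integral>\<^sup>+x. ennreal (- (indicator (box l u) x * w x)) \<partial>lborel)"
      using real_lebesgue_integral_def[OF int[of l u]] zero[of l u] by simp
    then show "(\<integral>\<^sup>+x. ennreal (w x) * indicator (box l u) x \<partial>lborel) = (\<integral>\<^sup>+x. ennreal (- w x) * indicator (box l u) x \<partial>lborel)"
      unfolding p n using fp fn
      by (cases "\<integral>\<^sup>+x. ennreal (indicator (box l u) x * w x) \<partial>lborel" rule: ennreal_cases;
          cases "\<integral>\<^sup>+x. ennreal (- (indicator (box l u) x * w x)) \<partial>lborel" rule: ennreal_cases) simp_all
  qed
  have "density lborel (\<lambda>x. ennreal (w x)) = density lborel (\<lambda>x. ennreal (- w x))"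
  proof (rule measure_eqI_generator_eq)
    let ?E = "range (\<lambda>(a, b). box a b::(real^2) set)"
    show "Int_stable ?E" by (auto simp: Int_stable_def box_Int_box)
    show "?E \<subseteq> Pow UNIV" "sets (density lborel (\<lambda>x. ennreal (w x))) = sigma_sets UNIV ?E"
      "sets (density lborel (\<lambda>x. ennreal (- w x))) = sigma_sets UNIV ?E"
      by (simp_all add: borel_eq_box)
    let ?A = "\<lambda>n::nat. box (- (real n *\<^sub>R One)) (real n *\<^sub>R One) :: (real^2) set"
    show "range ?A \<subseteq> ?E" "(\<Union>i. ?A i) = UNIV"
      unfolding UN_box_eq_UNIV by auto
    show "emeasure (density lborel (\<lambda>x. ennreal (w x))) (?A i) \<noteq> \<infinity>" for i
      using fin(1) by (subst emeasure_density) (auto simp: less_top[symmetric])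
    fix X assume "X \<in> ?E"
    then obtain l u where X: "X = box l u" by auto
    show "emeasure (density lborel (\<lambda>x. ennreal (w x))) X = emeasure (density lborel (\<lambda>x. ennreal (- w x))) X"
      unfolding X using fin(2) by (simp add: emeasure_density)
  qed
  then have "AE x in lborel. ennreal (w x) = ennreal (- w x)"
    by (intro sigma_finite_measure.density_unique[OF lborel.sigma_finite_measure_axioms]) auto
  then show ?thesis
  proof eventually_elim
    case (elim x)
    show ?case
    proof (cases "w x \<ge> 0")
      case True
      then have "ennreal (- w x) = 0" by (simp add: ennreal_neg)
      then show ?thesis using elim True by simp
    next
      case False
      then have "ennreal (w x) = 0" by (simp add: ennreal_neg)
      then have "ennreal (- w x) = 0" using elim by simp
      then show ?thesis using False by (simp add: ennreal_eq_0_iff)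
    qed
  qed
qed

lemma AE_eq_of_box_integrals:
  fixes v w :: "real^2 \<Rightarrow> complex"
  assumes [measurable]: "v \<in> borel_measurable borel" "w \<in> borel_measurable borel"
    and v: "\<And>l u. integrable lborel (\<lambda>x. indicator (box l u) x *\<^sub>R v x)"
    and w: "\<And>l u. integrable lborel (\<lambda>x. indicator (box l u) x *\<^sub>R w x)"
    and eq: "\<And>l u. (LINT x|lborel. indicator (box l u) x *\<^sub>R v x) = (LINT x|lborel. indicator (box l u) x *\<^sub>R w x)"
  shows "AE x in lborel. v x = w x"
proof -
  have i: "integrable lborel (\<lambda>x. indicator (box l u) x *\<^sub>R (v x - w x))"
    and z: "(LINT x|lborel. indicator (box l u) x *\<^sub>R (v x - w x)) = 0" for l u
    using v[of l u] w[of l u] eq[of l u] by (simp_all add: scaleR_diff_right)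
  have "AE x in lborel. Re (v x - w x) = 0"
  proof (rule AE_zero_of_box_integrals)
    fix l u :: "real^2"
    show "integrable lborel (\<lambda>x. indicator (box l u) x * Re (v x - w x))"
      using integrable_Re[OF i[of l u]] by simp
    show "(LINT x|lborel. indicator (box l u) x * Re (v x - w x)) = 0"
      using integral_Re[OF i[of l u]] z[of l u] by simp
  qed measurable
  moreover have "AE x in lborel. Im (v x - w x) = 0"
  proof (rule AE_zero_of_box_integrals)
    fix l u :: "real^2"
    show "integrable lborel (\<lambda>x. indicator (box l u) x * Im (v x - w x))"
      using integrable_Im[OF i[of l u]] by simp
    show "(LINT x|lborel. indicator (box l u) x * Im (v x - w x)) = 0"
      using integral_Im[OF i[of l u]] z[of l u] by simp
  qed measurable
  ultimately show ?thesis by eventually_elim (simp add: complex_eq_iff)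
qed

lemma integral_on_set_L2:
  assumes [measurable]: "w \<in> borel_measurable M" "D \<in> sets M"
  shows "(\<integral>\<^sup>+x. ennreal (cmod (indicator D x *\<^sub>R w x)) \<partial>M)\<^sup>2 \<le> emeasure M D * sqnorm M w"
proof -
  have "(\<integral>\<^sup>+x. ennreal (cmod (indicator D x *\<^sub>R w x)) \<partial>M) = (\<integral>\<^sup>+x. indicator D x * ennreal (cmod (w x)) \<partial>M)"
    by (intro nn_integral_cong) (auto simp: indicator_def)
  also have "(\<dots>)\<^sup>2 \<le> (\<integral>\<^sup>+x. (indicator D x)\<^sup>2 \<partial>M) * (\<integral>\<^sup>+x. (ennreal (cmod (w x)))\<^sup>2 \<partial>M)"
    by (rule Cauchy_Schwarz_nn_integral) measurable
  also have "(\<integral>\<^sup>+x. (indicator D x :: ennreal)\<^sup>2 \<partial>M) = (\<integral>\<^sup>+x. indicator D x \<partial>M)"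
    by (intro nn_integral_cong) (auto simp: indicator_def)
  also have "\<dots> = emeasure M D" by simp
  also have "(\<integral>\<^sup>+x. (ennreal (cmod (w x)))\<^sup>2 \<partial>M) = sqnorm M w"
    unfolding sqnorm_def by (simp add: ennreal_power)
  finally show ?thesis .
qed

lemma integrable_on_box_L2:
  fixes w :: "real^2 \<Rightarrow> complex"
  assumes [measurable]: "w \<in> borel_measurable borel" and fin: "sqnorm lborel w < \<infinity>"
  shows "integrable lborel (\<lambda>x. indicator (box l u) x *\<^sub>R w x)"
  unfolding integrable_iff_bounded
proof
  have "(\<integral>\<^sup>+x. ennreal (cmod (indicator (box l u) x *\<^sub>R w x)) \<partial>lborel)\<^sup>2 \<le> emeasure lborel (box l u) * sqnorm lborel w"
    by (rule integral_on_set_L2) auto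
  also have "\<dots> < \<infinity>" using fin emeasure_lborel_box_finite[of l u] by (simp add: ennreal_mult_less_top)
  finally show "(\<integral>\<^sup>+x. ennreal (cmod (indicator (box l u) x *\<^sub>R w x)) \<partial>lborel) < \<infinity>"
    by (cases "(\<integral>\<^sup>+x. ennreal (cmod (indicator (box l u) x *\<^sub>R w x)) \<partial>lborel)") (auto simp: power2_eq_square ennreal_top_mult)
qed measurable

lemma box_integral_tendsto_of_L2:
  fixes w :: "real^2 \<Rightarrow> complex"
  assumes [measurable]: "w \<in> borel_measurable borel" "\<And>n. v n \<in> borel_measurable borel"
    and fin: "sqnorm lborel w < \<infinity>" "\<And>n::nat. sqnorm lborel (v n) < \<infinity>"
    and lim: "(\<lambda>n. sqnorm lborel (\<lambda>x. w x - v n x)) \<longlonglongrightarrow> 0"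
  shows "(\<lambda>n. LINT x|lborel. indicator (box l u) x *\<^sub>R v n x) \<longlonglongrightarrow> (LINT x|lborel. indicator (box l u) x *\<^sub>R w x)"
proof -
  define I where "I n = (LINT x|lborel. indicator (box l u) x *\<^sub>R w x) - (LINT x|lborel. indicator (box l u) x *\<^sub>R v n x)" for n
  have le: "ennreal ((cmod (I n))\<^sup>2) \<le> emeasure lborel (box l u) * sqnorm lborel (\<lambda>x. w x - v n x)" for n
  proof -
    have "I n = (LINT x|lborel. indicator (box l u) x *\<^sub>R (w x - v n x))"
      unfolding I_def using integrable_on_box_L2[of w l u] integrable_on_box_L2[of "v n" l u] fin
      by (simp add: scaleR_diff_right)
    then have "ennreal (cmod (I n)) \<le> (\<integral>\<^sup>+x. ennreal (cmod (indicator (box l u) x *\<^sub>R (w x - v n x))) \<partial>lborel)"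
      using ennreal_norm_integral_le by metis
    then have "(ennreal (cmod (I n)))\<^sup>2 \<le> (\<integral>\<^sup>+x. ennreal (cmod (indicator (box l u) x *\<^sub>R (w x - v n x))) \<partial>lborel)\<^sup>2"
      by (intro power_mono) auto
    also have "\<dots> \<le> emeasure lborel (box l u) * sqnorm lborel (\<lambda>x. w x - v n x)"
      by (rule integral_on_set_L2) auto
    finally show ?thesis by (simp add: ennreal_power)
  qed
  have "(\<lambda>n. emeasure lborel (box l u) * sqnorm lborel (\<lambda>x. w x - v n x)) \<longlonglongrightarrow> emeasure lborel (box l u) * 0"
    using emeasure_lborel_box_finite[of l u] by (intro ennreal_tendsto_cmult lim) auto
  then have "(\<lambda>n. ennreal ((cmod (I n))\<^sup>2)) \<longlonglongrightarrow> 0"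
    by (intro ennreal_tendsto_0_mono[OF _ le]) simp
  then have "(\<lambda>n. (cmod (I n))\<^sup>2) \<longlonglongrightarrow> 0"
    using tendsto_ennreal_iff[of "\<lambda>n. (cmod (I n))\<^sup>2" sequentially 0] by simp
  then have "(\<lambda>n. sqrt ((cmod (I n))\<^sup>2)) \<longlonglongrightarrow> sqrt 0" by (intro tendsto_intros)
  then have "I \<longlonglongrightarrow> 0" by (simp add: tendsto_norm_zero_iff)
  then have "(\<lambda>n. (LINT x|lborel. indicator (box l u) x *\<^sub>R w x) - I n) \<longlonglongrightarrow> (LINT x|lborel. indicator (box l u) x *\<^sub>R w x) - 0"
    by (intro tendsto_intros)
  then show ?thesis unfolding I_def by simp
qed

lemma integral_real2_affine:
  fixes g :: "real^2 \<Rightarrow> real"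
  assumes [measurable]: "g \<in> borel_measurable borel" and c: "c \<noteq> 0"
  shows "(LINT x|lborel. g x) = c\<^sup>2 * (LINT v|lborel. g (t + c *\<^sub>R v))"
  by (subst lborel_affine[OF c, of t])
    (auto simp: integral_density integral_distr)

text \<open>
  Boxes serve as test sets because their boundaries are null sets and away from the boundary the
  heat average of the indicator function converges by dominated convergence, after rescaling to
  the kernel at a fixed time.
\<close>

lemma heat_box_tendsto:
  fixes z :: "real^2"
  assumes a: "\<And>n. a n > 0" "a \<longlonglongrightarrow> 0" and z: "z \<notin> cbox l u - box l u"
  shows "(\<lambda>n. LINT x|lborel. indicator (box l u) x * heat (a n) (x - z)) \<longlonglongrightarrow> (2*pi)\<^sup>2 * indicator (box l u) z"
proof -
  have eq: "(LINT x|lborel. indicator (box l u) x * heat (a n) (x - z)) = (LINT v|lborel. indicator (box l u) (z + sqrt (a n) *\<^sub>R v) * heat 1 v)" for n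
  proof -
    have s: "sqrt (a n) \<noteq> 0" "(sqrt (a n))\<^sup>2 = a n" using a(1)[of n] by auto
    have h: "heat (a n) (sqrt (a n) *\<^sub>R v) = heat 1 v / a n" for v
      unfolding heat_def using a(1)[of n] by (simp add: power_mult_distrib)
    have "(LINT x|lborel. indicator (box l u) x * heat (a n) (x - z)) = a n * (LINT v|lborel. indicator (box l u) (z + sqrt (a n) *\<^sub>R v) * heat (a n) (z + sqrt (a n) *\<^sub>R v - z))"
      by (subst integral_real2_affine[OF _ s(1), of _ z]) (auto simp: s)
    then show ?thesis using a(1)[of n] by (simp add: h)
  qed
  have "(\<lambda>n. LINT v|lborel. indicator (box l u) (z + sqrt (a n) *\<^sub>R v) * heat 1 v) \<longlonglongrightarrow> (LINT v|lborel. indicator (box l u) z * heat 1 v)"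
  proof (rule integral_dominated_convergence[where w = "heat 1"])
    show "AE v in lborel. (\<lambda>n. indicator (box l u) (z + sqrt (a n) *\<^sub>R v) * heat 1 v) \<longlonglongrightarrow> indicator (box l u) z * heat 1 v"
    proof (rule AE_I2)
      fix v :: "real^2"
      have "(\<lambda>n. z + sqrt (a n) *\<^sub>R v) \<longlonglongrightarrow> z + sqrt 0 *\<^sub>R v" by (intro tendsto_intros a)
      then have l: "(\<lambda>n. z + sqrt (a n) *\<^sub>R v) \<longlonglongrightarrow> z" by simp
      have "\<forall>\<^sub>F n in sequentially. indicator (box l u) (z + sqrt (a n) *\<^sub>R v) = (indicator (box l u) z :: real)"
      proof (cases "z \<in> box l u")
        case True
        from topological_tendstoD[OF l open_box True] show ?thesis
          by eventually_elim (use True in auto)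
      next
        case False
        then have "z \<in> - cbox l u" using z by auto
        from topological_tendstoD[OF l open_Compl[OF closed_cbox] this] show ?thesis
          by eventually_elim (use False box_subset_cbox[of l u] in \<open>auto simp: indicator_def\<close>)
      qed
      then have "(\<lambda>n. indicator (box l u) (z + sqrt (a n) *\<^sub>R v)) \<longlonglongrightarrow> (indicator (box l u) z :: real)"
        by (rule tendsto_eventually)
      then show "(\<lambda>n. indicator (box l u) (z + sqrt (a n) *\<^sub>R v) * heat 1 v) \<longlonglongrightarrow> indicator (box l u) z * heat 1 v"
        by (rule tendsto_mult_right)
    qed
    show "AE v in lborel. norm (indicator (box l u) (z + sqrt (a n) *\<^sub>R v) * heat 1 v) \<le> heat 1 v" for n
      by (auto simp: indicator_def heat_nonneg)
  qed (auto intro: integrable_heat)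
  then show ?thesis unfolding eq by (simp add: integral_heat mult.commute)
qed

text \<open>
  The Gaussian-damped inverse transforms \<open>H n\<close> converge to \<open>h\<close> in \<open>L2\<close> by \<open>is_FT_bound\<close>, hence in the
  mean over every box. On the other hand \<open>H n\<close> is a heat convolution of \<open>G\<close>; moving the convolution
  to the indicator function of the box shows that its mean converges to that of
  \<open>(2 * pi)\<^sup>2 * G\<close>.
\<close>

lemma inversion_integrable:
  assumes \<sigma>: "\<bar>\<sigma>\<bar> = 1" and G: "integrable lborel G" and fin: "sqnorm lborel G < \<infinity>"
    and h: "is_FT (-\<sigma>) (FT \<sigma> G) h"
  shows "AE x in lborel. h x = complex_of_real ((2 * pi)\<^sup>2) * G x"
proof -
  have [measurable]: "G \<in> borel_measurable borel" using G by auto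
  have \<sigma>': "\<bar>- \<sigma>\<bar> = 1" using \<sigma> by simp
  define F where "F = FT \<sigma> G"
  define a where "a n = 1 / real (Suc n)" for n
  have a: "a n > 0" for n by (simp add: a_def)
  have a0: "a \<longlonglongrightarrow> 0" unfolding a_def by (rule LIMSEQ_Suc[OF lim_1_over_n])
  define Fa where "Fa n y = complex_of_real (exp (- a n * (norm y)\<^sup>2 / 2)) * F y" for n and y :: "real^2"
  define H where "H n x = (LINT z|lborel. complex_of_real (heat (a n) (x - z)) * G z)" for n x
  note hD = is_FT_D[OF h]
  note [measurable] = hD(1,3)
  have [measurable]: "F \<in> borel_measurable borel" "Fa n \<in> borel_measurable borel" for n
    unfolding F_def Fa_def by measurable
  have Ffin: "sqnorm lborel F < \<infinity>" using hD unfolding F_def by simp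
  have FaF: "cmod (Fa n y) \<le> cmod (F y)" for n y
    using a[of n] by (auto simp: Fa_def norm_mult intro!: mult_left_le_one_le)
  have Fafin: "sqnorm lborel (Fa n) < \<infinity>" for n
    using sqnorm_mono[of lborel "Fa n" F] FaF Ffin by (meson le_less_trans)
  have HFT: "FT (-\<sigma>) (Fa n) = H n" for n
    unfolding Fa_def H_def F_def using FT_gauss_FT[OF a \<sigma> G] by auto
  have Faint: "integrable lborel (Fa n)" for n
    unfolding Fa_def[abs_def] F_def by (rule integrable_gauss_mult[OF a _ norm_FT_le[OF G]]) measurable
  have isH: "is_FT (-\<sigma>) (Fa n) (H n)" for n
    using is_FT_integrable[OF \<sigma>' Faint Fafin] unfolding HFT .
  note [measurable] = is_FT_D(3)[OF isH]
  have Hfin: "sqnorm lborel (H n) < \<infinity>" for n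
    using is_FT_bound[OF \<sigma>' isH[of n]] Fafin[of n] by (auto simp: ennreal_mult_less_top elim!: le_less_trans)
  have hfin: "sqnorm lborel h < \<infinity>"
    using is_FT_bound[OF \<sigma>' h] hD(2) by (auto simp: ennreal_mult_less_top elim!: le_less_trans)
  have limF: "(\<lambda>n. sqnorm lborel (\<lambda>y. F y - Fa n y)) \<longlonglongrightarrow> 0"
  proof (rule sqnorm_dominated[where w = F])
    fix y :: "real^2"
    have "(\<lambda>n. Fa n y) \<longlonglongrightarrow> complex_of_real (exp (- 0 * (norm y)\<^sup>2 / 2)) * F y"
      unfolding Fa_def by (intro tendsto_intros a0) simp
    then show "(\<lambda>n. F y - Fa n y) \<longlonglongrightarrow> 0"
      using tendsto_diff[OF tendsto_const[of "F y"]] by fastforce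
    have "F y - Fa n y = complex_of_real (1 - exp (- a n * (norm y)\<^sup>2 / 2)) * F y" for n
      by (simp add: Fa_def algebra_simps)
    moreover have "\<bar>1 - exp (- a n * (norm y)\<^sup>2 / 2)\<bar> \<le> 1" for n using a[of n] by simp
    ultimately show "cmod (F y - Fa n y) \<le> cmod (F y)" for n
      by (simp add: norm_mult mult_left_le_one_le del: of_real_diff)
  qed (use Ffin in auto)
  have limH: "(\<lambda>n. sqnorm lborel (\<lambda>x. h x - H n x)) \<longlonglongrightarrow> 0"
  proof -
    have "sqnorm lborel (\<lambda>x. h x - H n x) \<le> ennreal (2 * (2*pi)\<^sup>2) * sqnorm lborel (\<lambda>y. F y - Fa n y)" for n
      using is_FT_bound[OF \<sigma>' is_FT_diff[OF h isH[of n]]] unfolding F_def .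
    moreover have "(\<lambda>n. ennreal (2 * (2*pi)\<^sup>2) * sqnorm lborel (\<lambda>y. F y - Fa n y)) \<longlonglongrightarrow> ennreal (2 * (2*pi)\<^sup>2) * 0"
      by (intro ennreal_tendsto_cmult limF) simp
    ultimately show ?thesis
      by (auto intro: ennreal_tendsto_0_mono)
  qed
  have box: "(LINT x|lborel. indicator (box l u) x *\<^sub>R h x) = (LINT x|lborel. indicator (box l u) x *\<^sub>R (complex_of_real ((2 * pi)\<^sup>2) * G x))" for l u
  proof (rule LIMSEQ_unique)
    show "(\<lambda>n. LINT x|lborel. indicator (box l u) x *\<^sub>R H n x) \<longlonglongrightarrow> (LINT x|lborel. indicator (box l u) x *\<^sub>R h x)"
      by (rule box_integral_tendsto_of_L2[OF _ _ hfin Hfin limH]) auto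
    define \<phi> where "\<phi> n z = (LINT x|lborel. indicator (box l u) x * heat (a n) (x - z))" for n z
    have [measurable]: "\<phi> n \<in> borel_measurable borel" for n unfolding \<phi>_def by measurable
    have hz: "integrable lborel (\<lambda>x. heat (a n) (x - z))" "(LINT x|lborel. heat (a n) (x - z)) = (2*pi)\<^sup>2" for n z
    proof -
      have "(\<integral>\<^sup>+x. ennreal (heat (a n) (x - z)) \<partial>lborel) = ennreal ((2 * pi)\<^sup>2)" by (rule nn_integral_heat[OF a])
      then have "has_bochner_integral lborel (\<lambda>x. heat (a n) (x - z)) ((2*pi)\<^sup>2)"
        by (intro has_bochner_integral_nn_integral) (auto intro!: heat_nonneg a)
      then show "integrable lborel (\<lambda>x. heat (a n) (x - z))" "(LINT x|lborel. heat (a n) (x - z)) = (2*pi)\<^sup>2"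
        by (auto simp: has_bochner_integral_iff)
    qed
    have ihz: "integrable lborel (\<lambda>x. indicator (box l u) x * heat (a n) (x - z))" for n z
      using integrable_mult_indicator[OF _ hz(1), of "box l u"] by simp
    have \<phi>0: "0 \<le> \<phi> n z" "\<phi> n z \<le> (2*pi)\<^sup>2" for n z
    proof -
      show "0 \<le> \<phi> n z" unfolding \<phi>_def by (rule Bochner_Integration.integral_nonneg) (auto intro!: mult_nonneg_nonneg heat_nonneg a)
      have "\<phi> n z \<le> (LINT x|lborel. heat (a n) (x - z))" unfolding \<phi>_def
        by (rule Bochner_Integration.integral_mono[OF ihz hz(1)]) (simp add: indicator_def heat_nonneg[OF a])
      then show "\<phi> n z \<le> (2*pi)\<^sup>2" by (simp add: hz)
    qed
    have eq: "(LINT x|lborel. indicator (box l u) x *\<^sub>R H n x) = (LINT z|lborel. complex_of_real (\<phi> n z) * G z)" for n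
    proof -
      define K where "K z x = complex_of_real (indicator (box l u) x * heat (a n) (x - z)) * G z" for z x
      have Kn: "norm (K z x) = (indicator (box l u) x * heat (a n) (x - z)) * cmod (G z)" for z x
        using heat_nonneg[OF a] by (simp add: K_def norm_mult)
      have int: "integrable (lborel \<Otimes>\<^sub>M lborel) (case_prod K)"
      proof (rule lborel_pair.Fubini_integrable)
        show "case_prod K \<in> borel_measurable (lborel \<Otimes>\<^sub>M lborel)" unfolding K_def by measurable
        have "integrable lborel (\<lambda>z. \<phi> n z * cmod (G z))"
        proof (rule Bochner_Integration.integrable_bound)
          show "integrable lborel (\<lambda>z. (2*pi)\<^sup>2 * cmod (G z))" using G by simp
          show "AE z in lborel. norm (\<phi> n z * cmod (G z)) \<le> norm ((2*pi)\<^sup>2 * cmod (G z))"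
            using \<phi>0 by (auto simp: abs_mult intro!: mult_right_mono)
        qed measurable
        then show "integrable lborel (\<lambda>z. LINT x|lborel. norm (case (z, x) of (z, x) \<Rightarrow> K z x))"
          by (simp add: Kn \<phi>_def)
        show "AE z in lborel. integrable lborel (\<lambda>x. case (z, x) of (z, x) \<Rightarrow> K z x)"
          unfolding K_def using ihz by (intro AE_I2) (simp add: complex_of_real_integrable_eq del: of_real_mult)
      qed
      have "(LINT x|lborel. indicator (box l u) x *\<^sub>R H n x) = (LINT x|lborel. LINT z|lborel. K z x)"
        unfolding H_def K_def
        by (rule Bochner_Integration.integral_cong[OF refl]) (auto simp: indicator_def)
      also have "\<dots> = (LINT z|lborel. LINT x|lborel. K z x)"
        by (rule lborel_pair.Fubini_integral[OF int])
      also have "\<dots> = (LINT z|lborel. complex_of_real (\<phi> n z) * G z)"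
        unfolding K_def \<phi>_def by (simp del: of_real_mult)
      finally show ?thesis .
    qed
    have "(\<lambda>n. LINT z|lborel. complex_of_real (\<phi> n z) * G z) \<longlonglongrightarrow> (LINT z|lborel. indicator (box l u) z *\<^sub>R (complex_of_real ((2 * pi)\<^sup>2) * G z))"
    proof (rule integral_dominated_convergence[where w = "\<lambda>z. (2*pi)\<^sup>2 * cmod (G z)"])
      show "integrable lborel (\<lambda>z. (2*pi)\<^sup>2 * cmod (G z))" using G by simp
      show "AE z in lborel. norm (complex_of_real (\<phi> n z) * G z) \<le> (2*pi)\<^sup>2 * cmod (G z)" for n
        using \<phi>0 by (auto simp: norm_mult intro!: mult_right_mono)
      have "AE z in lborel. z \<notin> cbox l u - box l u"
        using null_sets_cbox_Diff_box by (rule AE_not_in)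
      then show "AE z in lborel. (\<lambda>n. complex_of_real (\<phi> n z) * G z) \<longlonglongrightarrow> indicator (box l u) z *\<^sub>R (complex_of_real ((2 * pi)\<^sup>2) * G z)"
      proof eventually_elim
        case (elim z)
        have "(\<lambda>n. complex_of_real (\<phi> n z) * G z) \<longlonglongrightarrow> complex_of_real ((2*pi)\<^sup>2 * indicator (box l u) z) * G z"
          unfolding \<phi>_def by (intro tendsto_intros heat_box_tendsto a a0 elim)
        then show ?case by (simp add: scaleR_conv_of_real mult_ac)
      qed
    qed measurable
    then show "(\<lambda>n. LINT x|lborel. indicator (box l u) x *\<^sub>R H n x) \<longlonglongrightarrow> (LINT x|lborel. indicator (box l u) x *\<^sub>R (complex_of_real ((2 * pi)\<^sup>2) * G x))"
      unfolding eq .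
  qed
  show ?thesis
  proof (rule AE_eq_of_box_integrals[OF hD(3) _ _ _ box])
    show "(\<lambda>x. complex_of_real ((2 * pi)\<^sup>2) * G x) \<in> borel_measurable borel" by measurable
    show "integrable lborel (\<lambda>x. indicator (box l u) x *\<^sub>R h x)" for l u
      by (rule integrable_on_box_L2[OF _ hfin]) simp
    show "integrable lborel (\<lambda>x. indicator (box l u) x *\<^sub>R (complex_of_real ((2 * pi)\<^sup>2) * G x))" for l u
      using G by (intro integrable_mult_indicator) auto
  qed
qed

text \<open>
  Both sides depend continuously on \<open>G\<close> in \<open>L2\<close>, and truncations of \<open>G\<close> are integrable, so that
  \<open>inversion_integrable\<close> applies to them.
\<close>

lemma is_FT_inversion:
  assumes \<sigma>: "\<bar>\<sigma>\<bar> = 1" and g: "is_FT \<sigma> G g" and h: "is_FT (-\<sigma>) g h"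
  shows "AE x in lborel. h x = complex_of_real ((2 * pi)\<^sup>2) * G x"
proof -
  have \<sigma>': "\<bar>- \<sigma>\<bar> = 1" using \<sigma> by simp
  note gD = is_FT_D[OF g] and hD = is_FT_D[OF h]
  note [measurable] = gD(1,3) hD(1,3)
  define p where "p = (2 * pi)\<^sup>2"
  define c where "c = (cmod (of_real p))\<^sup>2"
  have "sqnorm lborel (\<lambda>x. h x - of_real p * G x) \<le> 0"
  proof (rule le_of_tendsto_0)
    let ?u = "\<lambda>R. sqnorm lborel (\<lambda>y. FT \<sigma> (cut R G) y - g y) + sqnorm lborel (\<lambda>z. cut R G z - G z)"
    let ?d = "ennreal (2 * (2 * p) + 2 * c)"
    have "((\<lambda>R. sqnorm lborel (\<lambda>y. FT \<sigma> (cut R G) y - g y)) \<longlongrightarrow> 0) at_top" using g unfolding is_FT_def by auto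
    then have "(?u \<longlongrightarrow> 0 + 0) at_top" by (intro tendsto_add sqnorm_cut_tendsto gD(1,2))
    then show "(?u \<longlongrightarrow> 0) at_top" by simp
    show "?d < \<infinity>" by simp
    fix R
    have Gi: "integrable lborel (cut R G)" by (rule integrable_cut[OF gD(1,2)])
    have Gf: "sqnorm lborel (cut R G) < \<infinity>" using sqnorm_cut_le gD(2) by (rule le_less_trans)
    have gR: "is_FT \<sigma> (cut R G) (FT \<sigma> (cut R G))" by (rule is_FT_integrable[OF \<sigma> Gi Gf])
    have "sqnorm lborel (FT \<sigma> (cut R G)) < \<infinity>"
      using is_FT_bound[OF \<sigma> gR] Gf by (auto simp: ennreal_mult_less_top elim!: le_less_trans)
    then obtain hR where hR: "is_FT (-\<sigma>) (FT \<sigma> (cut R G)) hR"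
      using is_FT_exists[OF \<sigma>', of "FT \<sigma> (cut R G)"] by auto
    note [measurable] = is_FT_D(1,3)[OF hR]
    have eq: "AE x in lborel. hR x = of_real p * cut R G x"
      using inversion_integrable[OF \<sigma> Gi Gf hR] unfolding p_def .
    have "sqnorm lborel (\<lambda>x. h x - of_real p * G x) \<le> 2 * sqnorm lborel (\<lambda>x. h x - hR x) + 2 * sqnorm lborel (\<lambda>x. hR x - of_real p * G x)"
      by (rule sqnorm_diff_triangle) measurable
    also have "sqnorm lborel (\<lambda>x. hR x - of_real p * G x) = sqnorm lborel (\<lambda>x. of_real p * (cut R G x - G x))"
      by (rule sqnorm_cong_AE) (use eq in eventually_elim, simp add: right_diff_distrib)
    also have "\<dots> = ennreal c * sqnorm lborel (\<lambda>z. cut R G z - G z)"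
      unfolding c_def by (rule sqnorm_cmult) measurable
    also have "sqnorm lborel (\<lambda>x. h x - hR x) \<le> ennreal (2 * p) * sqnorm lborel (\<lambda>y. g y - FT \<sigma> (cut R G) y)"
      unfolding p_def by (rule is_FT_bound[OF \<sigma>' is_FT_diff[OF h hR]])
    also have "sqnorm lborel (\<lambda>y. g y - FT \<sigma> (cut R G) y) = sqnorm lborel (\<lambda>y. FT \<sigma> (cut R G) y - g y)"
      by (rule sqnorm_minus_commute)
    finally have "sqnorm lborel (\<lambda>x. h x - of_real p * G x) \<le> 2 * (ennreal (2 * p) * sqnorm lborel (\<lambda>y. FT \<sigma> (cut R G) y - g y)) + 2 * (ennreal c * sqnorm lborel (\<lambda>z. cut R G z - G z))"
      by (simp add: add_right_mono mult_left_mono)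
    also have "\<dots> = ennreal (2 * (2 * p)) * sqnorm lborel (\<lambda>y. FT \<sigma> (cut R G) y - g y) + ennreal (2 * c) * sqnorm lborel (\<lambda>z. cut R G z - G z)"
      by (simp add: ennreal_mult mult.assoc p_def c_def)
    also have "\<dots> \<le> ?d * sqnorm lborel (\<lambda>y. FT \<sigma> (cut R G) y - g y) + ?d * sqnorm lborel (\<lambda>z. cut R G z - G z)"
      by (intro add_mono mult_right_mono ennreal_leI) (auto simp: p_def c_def)
    finally show "sqnorm lborel (\<lambda>x. h x - of_real p * G x) \<le> 0 + ?d * ?u R" by (simp add: distrib_left)
  qed
  then have "AE x in lborel. h x - of_real p * G x = 0"
    using sqnorm_eq_0_iff[of "\<lambda>x. h x - of_real p * G x" lborel] by simp
  then show ?thesis by eventually_elim (simp add: p_def)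
qed

section \<open>The propagator on the Fourier side\<close>

definition modulate :: "real \<Rightarrow> (real^2 \<Rightarrow> complex) \<Rightarrow> real^2 \<Rightarrow> complex" where
  "modulate t G \<xi> = cis (t * (\<xi> $ 1) * (\<xi> $ 2)) * G \<xi>"

lemma modulate_measurable [measurable]:
  "G \<in> borel_measurable borel \<Longrightarrow> modulate t G \<in> borel_measurable borel"
  unfolding modulate_def[abs_def] by measurable

lemma norm_modulate [simp]: "cmod (modulate t G \<xi>) = cmod (G \<xi>)"
  by (simp add: modulate_def norm_mult)

lemma sqnorm_modulate [simp]: "sqnorm M (modulate t G) = sqnorm M G"
  by (simp add: sqnorm_def)

lemma modulate_0 [simp]: "modulate 0 G = G"
  by (rule ext) (simp add: modulate_def)

lemma borel_measurable_lebesgue_AE_eq_borel: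
  fixes f :: "real^2 \<Rightarrow> complex"
  assumes "f \<in> borel_measurable lebesgue"
  obtains f' where "f' \<in> borel_measurable borel" "AE x in lborel. f x = f' x"
proof -
  have "(\<lambda>x. Re (f x)) \<in> borel_measurable lebesgue" "(\<lambda>x. Im (f x)) \<in> borel_measurable lebesgue"
    using assms by measurable
  note ri = this
  obtain u where u: "u \<in> borel_measurable lborel" "AE x in lborel. Re (f x) = u x"
    using completion_ex_borel_measurable_real[OF ri(1)] by auto
  obtain v where v: "v \<in> borel_measurable lborel" "AE x in lborel. Im (f x) = v x"
    using completion_ex_borel_measurable_real[OF ri(2)] by auto
  have [measurable]: "u \<in> borel_measurable borel" "v \<in> borel_measurable borel" using u v by simp_all
  show thesis
  proof (rule that[of "\<lambda>x. Complex (u x) (v x)"])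
    have "(\<lambda>x. complex_of_real (u x) + \<i> * complex_of_real (v x)) \<in> borel_measurable borel"
      by measurable
    then show "(\<lambda>x. Complex (u x) (v x)) \<in> borel_measurable borel"
      by (simp add: Complex_eq)
    show "AE x in lborel. f x = Complex (u x) (v x)"
      using u(2) v(2) by eventually_elim (simp add: complex_eq_iff)
  qed
qed

lemma set_integral_cis_eq_FT:
  assumes f: "f \<in> borel_measurable lebesgue" and [measurable]: "f' \<in> borel_measurable borel"
    and eq: "AE x in lborel. f x = f' x"
  shows "(LINT z:ball 0 R|lebesgue. cis (\<sigma> * (y \<bullet> z)) * f z) = FT \<sigma> (cut R f') y"
proof -
  have c: "(\<lambda>z::real^2. cis (\<sigma> * (y \<bullet> z))) \<in> borel_measurable borel"
    "(\<lambda>z. indicator (ball 0 R) z *\<^sub>R (cis (\<sigma> * (y \<bullet> z)) * f' z)) \<in> borel_measurable borel" by measurable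
  have cl: "(\<lambda>z::real^2. cis (\<sigma> * (y \<bullet> z))) \<in> borel_measurable lebesgue"
    by (rule measurable_completion) (use c(1) in simp)
  have f'l: "f' \<in> borel_measurable lebesgue" by (rule measurable_completion) simp
  have "(LINT z:ball 0 R|lebesgue. cis (\<sigma> * (y \<bullet> z)) * f z) = (LINT z|lebesgue. indicator (ball 0 R) z *\<^sub>R (cis (\<sigma> * (y \<bullet> z)) * f' z))"
    unfolding set_lebesgue_integral_def
  proof (rule integral_cong_AE)
    have B: "ball (0::real^2) R \<in> sets lebesgue" by (rule fmeasurableD[OF lmeasurable_ball])
    show "(\<lambda>x. indicat_real (ball 0 R) x *\<^sub>R (cis (\<sigma> * (y \<bullet> x)) * f x)) \<in> borel_measurable lebesgue"
      by (intro borel_measurable_scaleR borel_measurable_indicator borel_measurable_times B cl f)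
    show "(\<lambda>x. indicat_real (ball 0 R) x *\<^sub>R (cis (\<sigma> * (y \<bullet> x)) * f' x)) \<in> borel_measurable lebesgue"
      by (intro borel_measurable_scaleR borel_measurable_indicator borel_measurable_times B cl f'l)
  qed (use AE_completion[OF eq] in auto)
  also have "\<dots> = (LINT z|lborel. indicator (ball 0 R) z *\<^sub>R (cis (\<sigma> * (y \<bullet> z)) * f' z))"
    by (rule integral_completion) (use c(2) in simp)
  also have "\<dots> = FT \<sigma> (cut R f') y"
    unfolding FT_def by (simp add: scaleR_conv_of_real mult_ac)
  finally show ?thesis .
qed

lemma square_integrable_borel_iff:
  assumes "f \<in> borel_measurable lebesgue" "f' \<in> borel_measurable borel" "AE x in lborel. f x = f' x"
  shows "square_integrable f \<longleftrightarrow> sqnorm lborel f' < \<infinity>"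
proof -
  have "sqnorm lborel f' = (\<integral>\<^sup>+x. ennreal ((cmod (f x))\<^sup>2) \<partial>lborel)"
    unfolding sqnorm_def by (rule nn_integral_cong_AE) (use assms(3) in auto)
  also have "\<dots> = (\<integral>\<^sup>+x. ennreal ((cmod (f x))\<^sup>2) \<partial>lebesgue)"
    by (simp add: nn_integral_completion)
  finally show ?thesis
    using assms(1) unfolding square_integrable_def integrable_iff_bounded by simp
qed

text \<open>
  The existence of a limit guarantees that the choice in \<open>L2_integral\<close> is a limit; it may be
  non-Borel, and is replaced by a Borel function equal to it almost everywhere.
\<close>

lemma L2_integral_is_FT:
  assumes \<sigma>: "\<bar>\<sigma>\<bar> = 1" and [measurable]: "f \<in> borel_measurable borel" and fin: "sqnorm lborel f < \<infinity>"
    and F: "\<And>R y. (LINT z:ball 0 R|lebesgue. F y z) = FT \<sigma> (cut R f) y"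
  obtains g where "is_FT \<sigma> f g" "AE y in lborel. L2_integral F y = g y" "L2_integral F \<in> borel_measurable lebesgue"
proof -
  obtain g0 where g0: "is_FT \<sigma> f g0" using is_FT_exists[OF \<sigma> _ fin] by auto
  have [measurable]: "g0 \<in> borel_measurable borel" by (rule is_FT_D[OF g0])
  have g0l: "g0 \<in> borel_measurable lebesgue" by (rule measurable_completion) simp
  have "sqnorm lborel g0 < \<infinity>" using is_FT_bound[OF \<sigma> g0] fin
    by (auto simp: ennreal_mult_less_top elim!: le_less_trans)
  then have "square_integrable g0"
    using square_integrable_borel_iff[OF g0l, of g0] by simp
  then have "is_L2_integral F g0"
    unfolding is_L2_integral_def F nn_integral_completion using is_FT_D(4)[OF g0] unfolding sqnorm_def by simp
  then have g: "is_L2_integral F (L2_integral F)"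
    unfolding L2_integral_def by (rule someI[where P = "is_L2_integral F"])
  then have gl: "L2_integral F \<in> borel_measurable lebesgue"
    unfolding is_L2_integral_def square_integrable_def by simp
  then obtain g' where [measurable]: "g' \<in> borel_measurable borel" and eq: "AE y in lborel. L2_integral F y = g' y"
    by (rule borel_measurable_lebesgue_AE_eq_borel)
  have "sqnorm lborel (\<lambda>y. FT \<sigma> (cut R f) y - g' y) = sqnorm lborel (\<lambda>y. FT \<sigma> (cut R f) y - L2_integral F y)" for R
    by (rule sqnorm_cong_AE) (use eq in auto)
  then have "is_FT \<sigma> f g'"
    using g fin unfolding is_L2_integral_def F nn_integral_completion is_FT_def by (simp add: sqnorm_def)
  then show thesis using that eq gl by blast
qed

text \<open>
  Every square integrable \<open>f\<close> has a Borel measurable transform \<open>G\<close>, and all values of the propagator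
  are represented by Borel functions \<open>P t\<close> whose transforms are the modulated \<open>G\<close>. That \<open>f\<close> itself
  corresponds to \<open>G\<close> is the inversion theorem.
\<close>

lemma propagator_Fourier_representation:
  assumes f: "square_integrable f"
  shows "\<exists>G f' P. G \<in> borel_measurable borel \<and> (AE \<xi> in lborel. fourier f \<xi> = G \<xi>) \<and>
    fourier f \<in> borel_measurable lebesgue \<and> is_FT 1 G f' \<and> (AE x in lborel. f x = f' x) \<and>
    (\<forall>t. is_FT 1 (modulate t G) (P t) \<and> (AE x in lborel. nonelliptic_propagator t f x = P t x))"
proof -
  have fl: "f \<in> borel_measurable lebesgue" using f unfolding square_integrable_def by simp
  then obtain f' where [measurable]: "f' \<in> borel_measurable borel" and ff': "AE x in lborel. f x = f' x"
    by (rule borel_measurable_lebesgue_AE_eq_borel)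
  have fin: "sqnorm lborel f' < \<infinity>" using f square_integrable_borel_iff[OF fl _ ff'] by simp
  have m1: "\<bar>-1 :: real\<bar> = 1" "\<bar>1 :: real\<bar> = 1" by simp_all
  define c where "c = complex_of_real (1 / (2 * pi)\<^sup>2)"
  obtain g where g: "is_FT (-1) f' g" "AE y in lborel. L2_integral (\<lambda>\<xi> x. cis (- (x \<bullet> \<xi>)) * f x) y = g y"
    "L2_integral (\<lambda>\<xi> x. cis (- (x \<bullet> \<xi>)) * f x) \<in> borel_measurable lebesgue"
  proof (rule L2_integral_is_FT[OF m1(1) _ fin])
    show "(LINT z:ball 0 R|lebesgue. cis (- (z \<bullet> y)) * f z) = FT (-1) (cut R f') y" for R y
      using set_integral_cis_eq_FT[OF fl _ ff', of R "-1" y] by (simp add: inner_commute)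
  qed auto
  define G where "G \<xi> = c * g \<xi>" for \<xi>
  have [measurable]: "g \<in> borel_measurable borel" by (rule is_FT_D[OF g(1)])
  have [measurable]: "G \<in> borel_measurable borel" unfolding G_def by measurable
  have fG: "AE \<xi> in lborel. fourier f \<xi> = G \<xi>"
    using g(2) by eventually_elim (simp add: fourier_def G_def c_def)
  have flG: "fourier f \<in> borel_measurable lebesgue"
    unfolding fourier_def[abs_def] using g(3) by measurable
  have gfin: "sqnorm lborel g < \<infinity>"
    using is_FT_bound[OF m1(1) g(1)] fin by (auto simp: ennreal_mult_less_top elim!: le_less_trans)
  obtain h where h: "is_FT 1 g h" using is_FT_exists[OF m1(2) _ gfin] by auto
  have hf: "AE x in lborel. h x = complex_of_real ((2 * pi)\<^sup>2) * f' x"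
    using is_FT_inversion[OF m1(1) g(1), of h] h by simp
  have "is_FT 1 (\<lambda>\<xi>. c * g \<xi>) (\<lambda>x. c * h x)" by (rule is_FT_cmult[OF h])
  then have Gf: "is_FT 1 G f'"
  proof (rule is_FT_cong_AE)
    show "AE x in lborel. c * h x = f' x"
      using hf by eventually_elim (simp add: c_def)
  qed (auto simp: G_def)
  have Gfin: "sqnorm lborel G < \<infinity>" by (rule is_FT_D[OF Gf])
  have "\<exists>P. is_FT 1 (modulate t G) P \<and> (AE x in lborel. nonelliptic_propagator t f x = P x)" for t
  proof -
    have ml: "(\<lambda>\<xi>. cis (t * (\<xi> $ 1) * (\<xi> $ 2)) * fourier f \<xi>) \<in> borel_measurable lebesgue"
    proof (rule borel_measurable_times[OF _ flG])
      show "(\<lambda>\<xi>::real^2. cis (t * (\<xi> $ 1) * (\<xi> $ 2))) \<in> borel_measurable lebesgue"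
        by (rule measurable_completion) simp
    qed
    obtain P where "is_FT 1 (modulate t G) P"
      "AE y in lborel. L2_integral (\<lambda>x \<xi>. cis (x \<bullet> \<xi> + t * (\<xi> $ 1) * (\<xi> $ 2)) * fourier f \<xi>) y = P y"
    proof (rule L2_integral_is_FT[OF m1(2), of "modulate t G"])
      show "(LINT z:ball 0 R|lebesgue. cis (y \<bullet> z + t * (z $ 1) * (z $ 2)) * fourier f z) = FT 1 (cut R (modulate t G)) y" for R y
      proof -
        have "cis (y \<bullet> z + t * (z $ 1) * (z $ 2)) * fourier f z = cis (1 * (y \<bullet> z)) * (cis (t * (z $ 1) * (z $ 2)) * fourier f z)" for z
          by (simp add: cis_mult[symmetric] mult.assoc)
        then have "(LINT z:ball 0 R|lebesgue. cis (y \<bullet> z + t * (z $ 1) * (z $ 2)) * fourier f z)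
          = (LINT z:ball 0 R|lebesgue. cis (1 * (y \<bullet> z)) * (cis (t * (z $ 1) * (z $ 2)) * fourier f z))"
          by (simp only:)
        also have "\<dots> = FT 1 (cut R (modulate t G)) y"
        proof (rule set_integral_cis_eq_FT[OF ml])
          show "AE \<xi> in lborel. cis (t * (\<xi> $ 1) * (\<xi> $ 2)) * fourier f \<xi> = modulate t G \<xi>"
            using fG by eventually_elim (simp add: modulate_def)
        qed simp
        finally show ?thesis .
      qed
    qed (use Gfin in auto)
    then show ?thesis unfolding nonelliptic_propagator_def by blast
  qed
  then obtain P where P: "\<And>t. is_FT 1 (modulate t G) (P t) \<and> (AE x in lborel. nonelliptic_propagator t f x = P t x)"
    by metis
  show ?thesis
    by (intro exI[of _ G] exI[of _ f'] exI[of _ P] conjI allI fG flG Gf ff' P[THEN conjunct1] P[THEN conjunct2]) measurable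
qed

text \<open>
  The converse of \<open>propagator_Fourier_representation\<close>: data may be prescribed by their transforms.
  Injectivity of the transform, a consequence of the inversion theorem, identifies \<open>fourier f\<close>
  with \<open>G\<close>.
\<close>

lemma propagator_of_Fourier_data:
  assumes Gf: "is_FT 1 G f"
  shows "square_integrable f" "AE \<xi> in lborel. fourier f \<xi> = G \<xi>" "fourier f \<in> borel_measurable lebesgue"
    "\<And>t P. is_FT 1 (modulate t G) P \<Longrightarrow> AE x in lborel. nonelliptic_propagator t f x = P x"
proof -
  have m1: "\<bar>1 :: real\<bar> = 1" by simp
  note Gm [measurable] = is_FT_D(1)[OF Gf]
  note fm [measurable] = is_FT_D(3)[OF Gf]
  have fl: "f \<in> borel_measurable lebesgue" by (rule measurable_completion) simp
  have "sqnorm lborel f < \<infinity>"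
    using is_FT_bound[OF m1 Gf] is_FT_D(2)[OF Gf] by (auto simp: ennreal_mult_less_top elim!: le_less_trans)
  then show sf: "square_integrable f" using square_integrable_borel_iff[OF fl fm] by simp
  from propagator_Fourier_representation[OF sf]
  obtain G' f' P' where rep: "G' \<in> borel_measurable borel \<and> (AE \<xi> in lborel. fourier f \<xi> = G' \<xi>) \<and>
    fourier f \<in> borel_measurable lebesgue \<and> is_FT 1 G' f' \<and> (AE x in lborel. f x = f' x) \<and>
    (\<forall>t. is_FT 1 (modulate t G') (P' t) \<and> (AE x in lborel. nonelliptic_propagator t f x = P' t x))"
    by (elim exE) (rule that)
  have *: "G' \<in> borel_measurable borel" "AE \<xi> in lborel. fourier f \<xi> = G' \<xi>"
    "fourier f \<in> borel_measurable lebesgue" "is_FT 1 G' f'" "AE x in lborel. f x = f' x"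
    "is_FT 1 (modulate t G') (P' t)" "AE x in lborel. nonelliptic_propagator t f x = P' t x" for t
    using rep by (elim conjE; simp)+
  note [measurable] = *(1)
  show "fourier f \<in> borel_measurable lebesgue" by fact
  have "is_FT 1 (\<lambda>\<xi>. G \<xi> - G' \<xi>) (\<lambda>x. f x - f' x)" by (rule is_FT_diff[OF Gf *(4)])
  then have "is_FT 1 (\<lambda>\<xi>. G \<xi> - G' \<xi>) (\<lambda>x. 0)"
    by (rule is_FT_cong_AE) (use *(5) in auto)
  then have "AE \<xi> in lborel. (\<lambda>x. 0) \<xi> = complex_of_real ((2 * pi)\<^sup>2) * (G \<xi> - G' \<xi>)"
    by (rule is_FT_inversion[OF m1 _ is_FT_zero])
  then have GG': "AE \<xi> in lborel. G \<xi> = G' \<xi>" by eventually_elim simp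
  show "AE \<xi> in lborel. fourier f \<xi> = G \<xi>" using *(2) GG' by eventually_elim simp
  fix t P assume P: "is_FT 1 (modulate t G) P"
  have "is_FT 1 (modulate t G') P"
    by (rule is_FT_cong_AE[OF P]) (use GG' is_FT_D(3)[OF P] in \<open>auto simp: modulate_def\<close>)
  from is_FT_unique[OF m1 this *(6)] have "AE x in lborel. P x = P' t x" .
  with *(7)[of t] show "AE x in lborel. nonelliptic_propagator t f x = P x" by eventually_elim simp
qed

text \<open>
  The Sobolev norm is an \<open>L2\<close> norm for this measure, so that completeness comes from
  \<open>Riesz_Fischer\<close>.
\<close>

definition bessel_weight :: "real \<Rightarrow> (real^2) measure" where
  "bessel_weight s = density lborel (\<lambda>\<xi>. ennreal ((1 + (norm \<xi>)\<^sup>2) powr s))"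

lemma sets_bessel_weight [simp, measurable_cong]: "sets (bessel_weight s) = sets borel"
  by (simp add: bessel_weight_def)

lemma sqnorm_bessel_weight:
  assumes [measurable]: "G \<in> borel_measurable borel"
  shows "sqnorm (bessel_weight s) G = (\<integral>\<^sup>+\<xi>. ennreal ((1 + (norm \<xi>)\<^sup>2) powr s * (cmod (G \<xi>))\<^sup>2) \<partial>lborel)"
  unfolding sqnorm_def bessel_weight_def by (subst nn_integral_density) (auto simp: ennreal_mult)

lemma sqnorm_le_bessel_weight:
  assumes [measurable]: "G \<in> borel_measurable borel" and "s \<ge> 0"
  shows "sqnorm lborel G \<le> sqnorm (bessel_weight s) G"
  unfolding sqnorm_bessel_weight[OF assms(1)] unfolding sqnorm_def
proof (intro nn_integral_mono ennreal_leI)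
  fix \<xi> :: "real^2"
  have "1 \<le> (1 + (norm \<xi>)\<^sup>2) powr s" using assms(2) by (intro ge_one_powr_ge_zero) auto
  then show "(cmod (G \<xi>))\<^sup>2 \<le> (1 + (norm \<xi>)\<^sup>2) powr s * (cmod (G \<xi>))\<^sup>2"
    using mult_right_mono[of 1 "(1 + (norm \<xi>)\<^sup>2) powr s" "(cmod (G \<xi>))\<^sup>2"] by simp
qed

lemma sobolev_iff_bessel_weight:
  assumes sf: "square_integrable f" and fl: "fourier f \<in> borel_measurable lebesgue"
    and [measurable]: "G \<in> borel_measurable borel" and eq: "AE \<xi> in lborel. fourier f \<xi> = G \<xi>"
  shows "f \<in> sobolev s \<longleftrightarrow> sqnorm (bessel_weight s) G < \<infinity>"
proof -
  have w: "(\<lambda>\<xi>::real^2. (1 + (norm \<xi>)\<^sup>2) powr s) \<in> borel_measurable lebesgue"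
    by (rule measurable_completion) simp
  have "(\<lambda>\<xi>. (1 + (norm \<xi>)\<^sup>2) powr s * (cmod (fourier f \<xi>))\<^sup>2) \<in> borel_measurable lebesgue"
    using w fl by measurable
  moreover have "(\<integral>\<^sup>+\<xi>. ennreal (norm ((1 + (norm \<xi>)\<^sup>2) powr s * (cmod (fourier f \<xi>))\<^sup>2)) \<partial>lebesgue) = sqnorm (bessel_weight s) G"
    unfolding sqnorm_bessel_weight[OF assms(3)] nn_integral_completion
    by (rule nn_integral_cong_AE) (use eq in auto)
  ultimately show ?thesis using sf unfolding sobolev_def integrable_iff_bounded by simp
qed

section \<open>Energies of dyadic steps\<close>

lemma sum_powr_tail_le:
  fixes q y :: real
  assumes q: "0 < q" "q < 1" and S: "finite S" "\<And>l. l \<in> S \<Longrightarrow> y \<le> real l"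
  shows "(\<Sum>l\<in>S. q powr real l) \<le> q powr y / (1 - q)"
proof (cases "S = {}")
  case True then show ?thesis using q by simp
next
  case False
  define m where "m = Min S"
  have m: "m \<in> S" "\<And>l. l \<in> S \<Longrightarrow> m \<le> l" using S False by (auto simp: m_def)
  define M where "M = Suc (Max S)"
  have sub: "S \<subseteq> {m..<M}" using S m by (auto simp: M_def less_Suc_eq_le)
  have mM: "m \<le> M" using sub m by auto
  have "(\<Sum>l\<in>S. q powr real l) \<le> (\<Sum>l=m..<M. q powr real l)"
    using sub by (intro sum_mono2) auto
  also have "\<dots> = (\<Sum>l=m..<M. q ^ l)" using q by (simp add: powr_realpow)
  also have "\<dots> = (q ^ m - q ^ M) / (1 - q)"
  proof -
    have "(\<Sum>l=m..<M. q ^ l) * (1 - q) = q ^ m - q ^ M"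
      using mM
    proof (induction M rule: dec_induct)
      case (step n)
      have "(\<Sum>l=m..<Suc n. q ^ l) * (1 - q) = (\<Sum>l=m..<n. q ^ l) * (1 - q) + q ^ n * (1 - q)"
        using step.hyps by (simp add: distrib_right)
      then show ?case unfolding step.IH by (simp add: algebra_simps)
    qed simp
    then show ?thesis using q by (simp add: eq_divide_eq)
  qed
  also have "\<dots> \<le> q ^ m / (1 - q)" using q by (intro divide_right_mono) auto
  also have "\<dots> = q powr real m / (1 - q)" using q by (simp add: powr_realpow)
  also have "\<dots> \<le> q powr y / (1 - q)"
    using q S(2)[OF m(1)] by (intro divide_right_mono powr_mono') auto
  finally show ?thesis .
qed

lemma sum_powr_head_le:
  fixes b y :: real
  assumes b: "1 < b" and y: "0 \<le> y" and S: "finite S" "\<And>l. l \<in> S \<Longrightarrow> real l \<le> y"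
  shows "(\<Sum>l\<in>S. b powr real l) \<le> b powr y * (b / (b - 1))"
proof -
  define m where "m = nat \<lfloor>y\<rfloor>"
  have my: "real m \<le> y" using y by (simp add: m_def)
  have sub: "S \<subseteq> {..m}" using S by (auto simp: m_def le_nat_floor)
  have "(\<Sum>l\<in>S. b powr real l) \<le> (\<Sum>l\<le>m. b powr real l)"
    using sub by (intro sum_mono2) auto
  also have "\<dots> = (\<Sum>l\<le>m. b ^ l)" using b by (simp add: powr_realpow)
  also have "\<dots> = (b ^ Suc m - 1) / (b - 1)"
    using b by (induction m) (auto simp: field_simps)
  also have "\<dots> \<le> b ^ Suc m / (b - 1)" using b by (intro divide_right_mono) auto
  also have "\<dots> = b powr real m * (b / (b - 1))" using b by (simp add: powr_realpow)
  also have "\<dots> \<le> b powr y * (b / (b - 1))"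
    using b my by (intro mult_right_mono powr_mono) auto
  finally show ?thesis .
qed

text \<open>
  A bound for \<open>|cis (t * \<xi>\<^sub>1 * \<xi>\<^sub>2) - cis (t' * \<xi>\<^sub>1 * \<xi>\<^sub>2)|\<^sup>2\<close> when \<open>\<bar>t - t'\<bar> \<le> \<delta>\<close> and \<open>|\<xi>|\<^sup>2 = X\<close>.
\<close>

definition osc :: "real \<Rightarrow> real \<Rightarrow> real" where
  "osc \<delta> X = min 4 ((\<delta> * X)\<^sup>2)"

lemma osc_nonneg: "osc \<delta> X \<ge> 0" by (simp add: osc_def)

lemma osc_mono: "0 \<le> \<delta> \<Longrightarrow> \<delta> \<le> \<delta>' \<Longrightarrow> 0 \<le> X \<Longrightarrow> osc \<delta> X \<le> osc \<delta>' X"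
  unfolding osc_def by (intro min.mono power_mono mult_right_mono) auto

text \<open>
  The terms increase geometrically while \<open>\<beta> ^ l \<le> 1 + X\<close>, where \<open>osc\<close> is bounded by \<open>4\<close>, and decrease
  geometrically afterwards, where it is quadratic, as \<open>0 < s < 2\<close>. The sum is therefore
  comparable to its term at \<open>\<beta> ^ l = 1 + X\<close>.
\<close>

lemma osc_geometric_sum:
  fixes \<beta> s :: real
  assumes \<beta>: "\<beta> > 1" and s: "0 < s" "s < 1"
  obtains C where "C \<ge> 0" "\<And>X L. X \<ge> 0 \<Longrightarrow> (\<Sum>l<L. \<beta> powr (s * real l) * osc (\<beta> powr (- real l)) X) \<le> C * (1 + X) powr s"
proof -
  define b where "b = \<beta> powr s"
  define q where "q = \<beta> powr (s - 2)"
  have b: "b > 1" unfolding b_def using \<beta> s by simp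
  have q: "0 < q" "q < 1" unfolding q_def using \<beta> s by (auto simp: powr_less_one)
  define C where "C = 4 * (b / (b - 1)) + 1 / (1 - q)"
  have C: "C \<ge> 0" unfolding C_def using b q by simp
  have "(\<Sum>l<L. \<beta> powr (s * real l) * osc (\<beta> powr (- real l)) X) \<le> C * (1 + X) powr s" if X: "X \<ge> 0" for X L
  proof -
    define Y where "Y = 1 + X"
    have Y: "Y \<ge> 1" "X \<le> Y" using X by (auto simp: Y_def)
    define y where "y = log \<beta> Y"
    have y: "y \<ge> 0" unfolding y_def using \<beta> Y by simp
    have by': "\<beta> powr y = Y" unfolding y_def using \<beta> Y by simp
    define S1 where "S1 = {l. l < L \<and> real l \<le> y}"
    define S2 where "S2 = {l. l < L \<and> y < real l}"
    have fin: "finite S1" "finite S2" unfolding S1_def S2_def by auto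
    let ?f = "\<lambda>l::nat. \<beta> powr (s * real l) * osc (\<beta> powr (- real l)) X"
    have "(\<Sum>l<L. ?f l) = (\<Sum>l\<in>S1 \<union> S2. ?f l)"
      by (rule sum.cong) (auto simp: S1_def S2_def)
    also have "\<dots> = (\<Sum>l\<in>S1. ?f l) + (\<Sum>l\<in>S2. ?f l)"
      by (rule sum.union_disjoint[OF fin]) (auto simp: S1_def S2_def)
    finally have split: "(\<Sum>l<L. ?f l) = (\<Sum>l\<in>S1. ?f l) + (\<Sum>l\<in>S2. ?f l)" .
    have "(\<Sum>l\<in>S1. ?f l) \<le> (\<Sum>l\<in>S1. 4 * b powr real l)"
    proof (rule sum_mono)
      fix l
      have "?f l \<le> \<beta> powr (s * real l) * 4" by (intro mult_left_mono) (auto simp: osc_def)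
      also have "\<dots> = 4 * b powr real l" unfolding b_def using \<beta> by (simp add: powr_powr)
      finally show "?f l \<le> 4 * b powr real l" .
    qed
    also have "\<dots> = 4 * (\<Sum>l\<in>S1. b powr real l)" by (simp add: sum_distrib_left)
    also have "\<dots> \<le> 4 * (b powr y * (b / (b - 1)))"
      by (intro mult_left_mono sum_powr_head_le[OF b y fin(1)]) (auto simp: S1_def)
    also have "b powr y = Y powr s" unfolding b_def by'[symmetric] using \<beta> by (simp add: powr_powr mult.commute)
    finally have le1: "(\<Sum>l\<in>S1. ?f l) \<le> 4 * (Y powr s * (b / (b - 1)))" .
    have "(\<Sum>l\<in>S2. ?f l) \<le> (\<Sum>l\<in>S2. Y\<^sup>2 * q powr real l)"
    proof (rule sum_mono)
      fix l
      have "?f l \<le> \<beta> powr (s * real l) * (\<beta> powr (- real l) * Y)\<^sup>2"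
      proof (intro mult_left_mono)
        have "osc (\<beta> powr (- real l)) X \<le> (\<beta> powr (- real l) * X)\<^sup>2" by (simp add: osc_def)
        also have "\<dots> \<le> (\<beta> powr (- real l) * Y)\<^sup>2"
          using X Y by (intro power_mono mult_left_mono) auto
        finally show "osc (\<beta> powr (- real l)) X \<le> (\<beta> powr (- real l) * Y)\<^sup>2" .
      qed simp
      also have "\<dots> = Y\<^sup>2 * (\<beta> powr (s * real l) * (\<beta> powr (- real l) * \<beta> powr (- real l)))"
        by (simp add: power2_eq_square mult_ac)
      also have "\<beta> powr (s * real l) * (\<beta> powr (- real l) * \<beta> powr (- real l)) = q powr real l"
        unfolding q_def by (simp add: powr_add[symmetric] powr_powr algebra_simps)
      finally show "?f l \<le> Y\<^sup>2 * q powr real l" .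
    qed
    also have "\<dots> = Y\<^sup>2 * (\<Sum>l\<in>S2. q powr real l)" by (simp add: sum_distrib_left)
    also have "\<dots> \<le> Y\<^sup>2 * (q powr y / (1 - q))"
      by (intro mult_left_mono sum_powr_tail_le[OF q fin(2)]) (auto simp: S2_def)
    also have "q powr y = Y powr (s - 2)" unfolding q_def by'[symmetric] using \<beta> by (simp add: powr_powr mult.commute)
    also have "Y\<^sup>2 * (Y powr (s - 2) / (1 - q)) = Y powr s * (1 / (1 - q))"
    proof -
      have "Y\<^sup>2 * Y powr (s - 2) = Y powr 2 * Y powr (s - 2)" using Y by (simp add: powr_numeral)
      also have "\<dots> = Y powr s" by (simp add: powr_add[symmetric])
      finally show ?thesis by simp
    qed
    finally have le2: "(\<Sum>l\<in>S2. ?f l) \<le> Y powr s * (1 / (1 - q))" .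
    have "4 * (Y powr s * (b / (b - 1))) + Y powr s * (1 / (1 - q)) = C * Y powr s"
    proof -
      have "4 * (Z * a) + Z * c = (4 * a + c) * Z" for Z a c :: real by (simp add: algebra_simps)
      then show ?thesis unfolding C_def .
    qed
    then show ?thesis using split le1 le2 unfolding Y_def by linarith
  qed
  then show thesis using that C by blast
qed

lemma cmod_cis_diff_le: "cmod (cis a - cis b) \<le> \<bar>a - b\<bar>"
proof -
  have "cis a - cis b = cis b * (iexp (a - b) - 1)"
    by (simp add: cis_conv_exp[symmetric] right_diff_distrib cis_mult flip: of_real_diff)
  then have "cmod (cis a - cis b) = cmod (iexp (a - b) - 1)" by (simp add: norm_mult)
  also have "\<dots> \<le> \<bar>a - b\<bar>" using iexp_approx1[of "a - b" 0] by simp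
  finally show ?thesis .
qed

lemma cmod_modulate_diff_sq_le:
  "(cmod (modulate t G \<xi> - modulate t' G \<xi>))\<^sup>2 \<le> osc \<bar>t - t'\<bar> ((norm \<xi>)\<^sup>2) * (cmod (G \<xi>))\<^sup>2"
proof -
  define u where "u = cmod (cis (t * (\<xi> $ 1) * (\<xi> $ 2)) - cis (t' * (\<xi> $ 1) * (\<xi> $ 2)))"
  have "\<bar>\<xi> $ 1 * \<xi> $ 2\<bar> \<le> (norm \<xi>)\<^sup>2"
  proof -
    have "2 * (\<bar>\<xi> $ 1\<bar> * \<bar>\<xi> $ 2\<bar>) \<le> (norm \<xi>)\<^sup>2"
      unfolding real2_norm_sq using zero_le_power2[of "\<bar>\<xi> $ 1\<bar> - \<bar>\<xi> $ 2\<bar>"] by (simp add: power2_diff)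
    moreover have "0 \<le> \<bar>\<xi> $ 1\<bar> * \<bar>\<xi> $ 2\<bar>" by simp
    ultimately show ?thesis unfolding abs_mult by linarith
  qed
  then have "\<bar>t - t'\<bar> * \<bar>\<xi> $ 1 * \<xi> $ 2\<bar> \<le> \<bar>t - t'\<bar> * (norm \<xi>)\<^sup>2" by (intro mult_left_mono) auto
  moreover have "u \<le> \<bar>t * (\<xi> $ 1) * (\<xi> $ 2) - t' * (\<xi> $ 1) * (\<xi> $ 2)\<bar>"
    unfolding u_def by (rule cmod_cis_diff_le)
  moreover have "t * (\<xi> $ 1) * (\<xi> $ 2) - t' * (\<xi> $ 1) * (\<xi> $ 2) = (t - t') * (\<xi> $ 1 * \<xi> $ 2)"
    by (simp add: algebra_simps)
  ultimately have "u \<le> \<bar>t - t'\<bar> * (norm \<xi>)\<^sup>2" by (simp add: abs_mult)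
  moreover have u0: "0 \<le> u" unfolding u_def by simp
  ultimately have 1: "u\<^sup>2 \<le> (\<bar>t - t'\<bar> * (norm \<xi>)\<^sup>2)\<^sup>2" by (intro power_mono)
  have "u \<le> 2" unfolding u_def using norm_triangle_ineq4[of "cis (t * (\<xi> $ 1) * (\<xi> $ 2))"] by (metis norm_cis one_add_one)
  then have "u\<^sup>2 \<le> 2\<^sup>2" using u0 by (intro power_mono)
  with 1 have "u\<^sup>2 \<le> osc \<bar>t - t'\<bar> ((norm \<xi>)\<^sup>2)" unfolding osc_def by simp
  moreover have "cmod (modulate t G \<xi> - modulate t' G \<xi>) = u * cmod (G \<xi>)"
    unfolding u_def modulate_def by (simp add: norm_mult[symmetric] left_diff_distrib)
  ultimately show ?thesis by (simp add: power_mult_distrib mult_right_mono)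
qed

text \<open>
  Up to a constant, a bound for the energy of a change of time by at most \<open>\<delta>\<close>.
\<close>

definition osc_energy :: "(real^2 \<Rightarrow> complex) \<Rightarrow> real \<Rightarrow> ennreal" where
  "osc_energy G \<delta> = (\<integral>\<^sup>+\<xi>. ennreal (osc \<delta> ((norm \<xi>)\<^sup>2) * (cmod (G \<xi>))\<^sup>2) \<partial>lborel)"

lemma osc_measurable [measurable]: "(\<lambda>\<xi>::real^2. osc \<delta> ((norm \<xi>)\<^sup>2)) \<in> borel_measurable borel"
  unfolding osc_def by measurable

lemma propagator_diff_energy:
  assumes P: "is_FT 1 (modulate t G) p" "is_FT 1 (modulate t' G) p'" and \<delta>: "\<bar>t - t'\<bar> \<le> \<delta>"
  shows "sqnorm lborel (\<lambda>x. p x - p' x) \<le> ennreal (2 * (2*pi)\<^sup>2) * osc_energy G \<delta>"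
proof -
  have "sqnorm lborel (\<lambda>x. p x - p' x) \<le> ennreal (2 * (2*pi)\<^sup>2) * sqnorm lborel (\<lambda>\<xi>. modulate t G \<xi> - modulate t' G \<xi>)"
    by (rule is_FT_bound[OF _ is_FT_diff[OF P]]) simp
  also have "sqnorm lborel (\<lambda>\<xi>. modulate t G \<xi> - modulate t' G \<xi>) \<le> osc_energy G \<delta>"
    unfolding sqnorm_def osc_energy_def
  proof (intro nn_integral_mono ennreal_leI)
    fix \<xi> :: "real^2"
    have "(cmod (modulate t G \<xi> - modulate t' G \<xi>))\<^sup>2 \<le> osc \<bar>t - t'\<bar> ((norm \<xi>)\<^sup>2) * (cmod (G \<xi>))\<^sup>2"
      by (rule cmod_modulate_diff_sq_le)
    also have "\<dots> \<le> osc \<delta> ((norm \<xi>)\<^sup>2) * (cmod (G \<xi>))\<^sup>2"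
      using \<delta> by (intro mult_right_mono osc_mono) auto
    finally show "(cmod (modulate t G \<xi> - modulate t' G \<xi>))\<^sup>2 \<le> osc \<delta> ((norm \<xi>)\<^sup>2) * (cmod (G \<xi>))\<^sup>2" .
  qed
  finally show ?thesis by (simp add: mult_left_mono)
qed

section \<open>Convergence along sequences in the weak space\<close>

definition dyadic_block :: "(nat \<Rightarrow> real) \<Rightarrow> nat \<Rightarrow> nat set" where
  "dyadic_block t l = {n. (1/2) ^ Suc l \<le> t n \<and> t n < (1/2) ^ l}"

lemma ex_dyadic_block:
  assumes "0 < t n" "t n < 1"
  shows "\<exists>l. n \<in> dyadic_block t l"
proof -
  obtain k0 where "(1/2) ^ k0 < t n" using real_arch_pow_inv[of "t n" "1/2"] assms by auto
  then have ex: "\<exists>k. (1/2) ^ k \<le> t n" by (auto intro: less_imp_le)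
  define k where "k = (LEAST k. (1/2) ^ k \<le> t n)"
  have k: "(1/2) ^ k \<le> t n" unfolding k_def by (rule LeastI_ex[OF ex])
  have "k \<noteq> 0" using k assms by (intro notI) auto
  then obtain l where l: "k = Suc l" by (cases k) auto
  have "\<not> (1/2) ^ l \<le> t n" using not_less_Least[of l "\<lambda>k. (1/2) ^ k \<le> t n"] l unfolding k_def by simp
  then show ?thesis using k l unfolding dyadic_block_def by auto
qed

lemma card_dyadic_block_le:
  assumes t: "t \<in> weak_lspace r"
  obtains A where "A \<ge> 0" "\<And>l. finite (dyadic_block t l)" "\<And>l. real (card (dyadic_block t l)) \<le> A * 2 powr (r * real l)"
proof -
  define M where "M = (SUP b\<in>{0<..}. ennreal (b powr r) * emeasure (count_space UNIV) {n. t n > b})"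
  have "M < \<infinity>" using t unfolding weak_lspace_def M_def by simp
  then obtain m where m: "M = ennreal m" "m \<ge> 0" by (cases M) auto
  have key: "finite (dyadic_block t l) \<and> real (card (dyadic_block t l)) \<le> m * 2 powr (2 * r) * 2 powr (r * real l)" for l
  proof -
    define b :: real where "b = (1/2) ^ (l + 2)"
    have b: "b > 0" by (simp add: b_def)
    have sub: "dyadic_block t l \<subseteq> {n. t n > b}"
    proof
      fix n assume "n \<in> dyadic_block t l"
      then have "(1/2) ^ Suc l \<le> t n" by (simp add: dyadic_block_def)
      moreover have "b < (1/2) ^ Suc l" by (simp add: b_def)
      ultimately show "n \<in> {n. t n > b}" by simp
    qed
    have le: "ennreal (b powr r) * emeasure (count_space UNIV) {n. t n > b} \<le> ennreal m"
      unfolding m(1)[symmetric] M_def using b by (intro SUP_upper) auto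
    have bp: "b powr r > 0" using b by simp
    have fin: "finite {n. t n > b}"
    proof (rule ccontr)
      assume "infinite {n. t n > b}"
      then have "emeasure (count_space UNIV) {n. t n > b} = \<infinity>" by simp
      then show False using le bp by (simp add: ennreal_mult_top top_unique)
    qed
    have "ennreal (b powr r * real (card {n. t n > b})) \<le> ennreal m"
      using le fin by (simp add: emeasure_count_space_finite ennreal_mult ennreal_of_nat_eq_real_of_nat)
    then have le2: "b powr r * real (card {n. t n > b}) \<le> m" using m by simp
    have "real (card (dyadic_block t l)) \<le> real (card {n. t n > b})"
      using card_mono[OF fin sub] by simp
    also have "\<dots> \<le> m / b powr r" using le2 bp by (simp add: field_simps)
    also have "b = 2 powr (- (real l + 2))"
    proof -
      have "2 powr (- real (l + 2)) = (1/2 :: real) ^ (l + 2)"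
        by (subst powr_minus, subst powr_realpow) (simp_all add: power_one_over inverse_eq_divide)
      moreover have "- real (l + 2) = - (real l + 2)" by simp
      ultimately show ?thesis unfolding b_def by metis
    qed
    also have "m / (2 powr (- (real l + 2))) powr r = m * 2 powr (2 * r) * 2 powr (r * real l)"
    proof -
      have "(2 powr (- (real l + 2))) powr r = inverse (2 powr (2 * r) * 2 powr (r * real l))"
        by (simp add: powr_powr powr_minus[symmetric] powr_add[symmetric] algebra_simps)
      then show ?thesis by (simp add: divide_inverse mult.assoc)
    qed
    finally show ?thesis using finite_subset[OF sub fin] by simp
  qed
  show thesis by (rule that[of "m * 2 powr (2 * r)"]) (use key m in auto)
qed

text \<open>
  The total weight of the dyadic steps at frequencies with \<open>|\<xi>|\<^sup>2 = X\<close>. For a fixed level \<open>j\<close> the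
  sum over \<open>l\<close> is geometric with ratio \<open>2 powr (- \<kappa>)\<close> and starts at \<open>l\<close> about \<open>(1 - s) * j\<close>, which makes
  it \<open>O(2 powr (s * j))\<close>; the sum over \<open>j\<close> is then \<open>osc_geometric_sum\<close>. The weights \<open>sqrt 2 ^ (J l - j)\<close>
  grow slowly enough for \<open>\<kappa>\<close> to be positive, which is where \<open>s < 1/2\<close> enters.
\<close>

lemma block_sum_le:
  fixes s :: real
  assumes s: "0 < s" "s < 1/2"
  defines "J \<equiv> \<lambda>l::nat. nat \<lceil>real l / (1 - s)\<rceil>"
  obtains C where "C \<ge> 0" "\<And>X L. X \<ge> 0 \<Longrightarrow>
    (\<Sum>l<L. \<Sum>j\<in>{l<..J l}. sqrt 2 ^ (J l - j) * (2 ^ (j - l) * osc ((1/2) ^ j) X)) \<le> C * (1 + X) powr s"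
proof -
  obtain C0 where C0: "C0 \<ge> 0" "\<And>X L. X \<ge> 0 \<Longrightarrow> (\<Sum>l<L. 2 powr (s * real l) * osc (2 powr (- real l)) X) \<le> C0 * (1 + X) powr s"
    using osc_geometric_sum[of 2 s] s by auto
  define \<rho> where "\<rho> = 1 / (1 - s)"
  have \<rho>: "1 < \<rho>" "\<rho> < 2" using s by (auto simp: \<rho>_def field_simps)
  \<comment> \<open>A step of block \<open>l\<close> at level \<open>j\<close> has the weight \<open>2 powr ((J l - j) / 2 + j - l)\<close>, which by \<open>J l \<le> \<rho> * l + 1\<close>
      is at most \<open>2 powr (1/2 + j/2 - \<kappa> * l)\<close>.\<close>
  define \<kappa> where "\<kappa> = 1 - \<rho> / 2"
  have \<kappa>: "\<kappa> > 0" using \<rho> by (simp add: \<kappa>_def)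
  define q where "q = 2 powr (- \<kappa>)"
  have q: "0 < q" "q < 1" unfolding q_def using \<kappa> by (auto simp: powr_less_one)
  define K where "K = 2 powr (1 - s) / (1 - q)"
  have K: "K \<ge> 0" unfolding K_def using q by simp
  have Jle: "real (J l) \<le> \<rho> * real l + 1" for l
  proof -
    have "0 \<le> real l / (1 - s)" using s by simp
    then show ?thesis unfolding J_def \<rho>_def using ceiling_correct[of "real l / (1 - s)"] by (simp add: of_nat_nat)
  qed
  have inner: "(\<Sum>l\<in>{l. l < L \<and> l < j \<and> j \<le> J l}. sqrt 2 ^ (J l - j) * 2 ^ (j - l)) \<le> K * 2 powr (s * real j)" for L j
  proof -
    define S where "S = {l. l < L \<and> l < j \<and> j \<le> J l}"
    have S: "finite S" unfolding S_def by simp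
    have "(\<Sum>l\<in>S. sqrt 2 ^ (J l - j) * 2 ^ (j - l)) \<le> (\<Sum>l\<in>S. 2 powr (1/2 + real j / 2) * q powr real l)"
    proof (rule sum_mono)
      fix l assume l: "l \<in> S"
      then have l': "l < j" "j \<le> J l" by (auto simp: S_def)
      have "sqrt 2 ^ (J l - j) = 2 powr ((real (J l) - real j) / 2)"
        using l' by (simp add: powr_half_sqrt[symmetric] powr_realpow[symmetric] powr_powr of_nat_diff)
      moreover have "(2::real) ^ (j - l) = 2 powr (real j - real l)"
        using l' by (simp add: powr_realpow[symmetric] of_nat_diff)
      ultimately have "sqrt 2 ^ (J l - j) * 2 ^ (j - l) = 2 powr ((real (J l) - real j) / 2 + (real j - real l))"
        by (simp add: powr_add)
      also have "\<dots> \<le> 2 powr ((1/2 + real j / 2) + (- \<kappa>) * real l)"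
        using Jle[of l] by (intro powr_mono) (auto simp: \<kappa>_def field_simps)
      also have "\<dots> = 2 powr (1/2 + real j / 2) * q powr real l"
        unfolding q_def by (simp add: powr_add[symmetric] powr_powr)
      finally show "sqrt 2 ^ (J l - j) * 2 ^ (j - l) \<le> 2 powr (1/2 + real j / 2) * q powr real l" .
    qed
    also have "\<dots> = 2 powr (1/2 + real j / 2) * (\<Sum>l\<in>S. q powr real l)" by (simp add: sum_distrib_left)
    also have "\<dots> \<le> 2 powr (1/2 + real j / 2) * (q powr ((real j - 1) * (1 - s)) / (1 - q))"
    proof (intro mult_left_mono sum_powr_tail_le[OF q S])
      fix l assume "l \<in> S"
      then have "real j \<le> \<rho> * real l + 1" using Jle[of l] by (auto simp: S_def intro: order_trans[of _ "real (J l)"])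
      then have "(real j - 1) * (1 - s) \<le> \<rho> * real l * (1 - s)" using s by (intro mult_right_mono) auto
      also have "\<dots> = real l" using s by (simp add: \<rho>_def)
      finally show "(real j - 1) * (1 - s) \<le> real l" .
    qed simp
    also have "\<dots> = (2 powr (1/2 + real j / 2) * 2 powr (- \<kappa> * ((real j - 1) * (1 - s)))) / (1 - q)"
      unfolding q_def by (simp add: powr_powr)
    also have "2 powr (1/2 + real j / 2) * 2 powr (- \<kappa> * ((real j - 1) * (1 - s))) = 2 powr ((1 - s) + s * real j)"
    proof -
      have "\<kappa> * (1 - s) = 1/2 - s" using s by (simp add: \<kappa>_def \<rho>_def field_simps)
      then have h: "- \<kappa> * ((real j - 1) * (1 - s)) = - ((real j - 1) * (1/2 - s))" by (metis mult.assoc mult.commute mult_minus_left)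
      have "1/2 + real j / 2 + - ((real j - 1) * (1/2 - s)) = (1 - s) + s * real j" by (simp add: field_simps)
      then show ?thesis unfolding powr_add[symmetric] h by simp
    qed
    also have "2 powr ((1 - s) + s * real j) / (1 - q) = K * 2 powr (s * real j)"
      unfolding K_def powr_add by simp
    finally show ?thesis unfolding S_def .
  qed
  have "(\<Sum>l<L. \<Sum>j\<in>{l<..J l}. sqrt 2 ^ (J l - j) * (2 ^ (j - l) * osc ((1/2) ^ j) X)) \<le> (K * C0) * (1 + X) powr s" if X: "X \<ge> 0" for X L
  proof -
    define M where "M = Suc (\<Sum>l<L. J l)"
    have M: "J l < M" if "l < L" for l
      unfolding M_def less_Suc_eq_le using that by (intro member_le_sum) auto
    have "(\<Sum>l<L. \<Sum>j\<in>{l<..J l}. sqrt 2 ^ (J l - j) * (2 ^ (j - l) * osc ((1/2) ^ j) X))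
      = (\<Sum>l<L. \<Sum>j | j < M \<and> (l < j \<and> j \<le> J l). sqrt 2 ^ (J l - j) * (2 ^ (j - l) * osc ((1/2) ^ j) X))"
      using M by (intro sum.cong refl) (auto intro: le_less_trans)
    also have "\<dots> = (\<Sum>j<M. \<Sum>l | l < L \<and> (l < j \<and> j \<le> J l). sqrt 2 ^ (J l - j) * (2 ^ (j - l) * osc ((1/2) ^ j) X))"
      using sum.swap_restrict[of "{..<L}" "{..<M}" "\<lambda>l j. sqrt 2 ^ (J l - j) * (2 ^ (j - l) * osc ((1/2) ^ j) X)" "\<lambda>l j. l < j \<and> j \<le> J l"]
      by simp
    also have "\<dots> = (\<Sum>j<M. (\<Sum>l | l < L \<and> l < j \<and> j \<le> J l. sqrt 2 ^ (J l - j) * 2 ^ (j - l)) * osc ((1/2) ^ j) X)"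
      by (simp add: sum_distrib_right mult.assoc)
    also have "\<dots> \<le> (\<Sum>j<M. (K * 2 powr (s * real j)) * osc ((1/2) ^ j) X)"
      by (intro sum_mono mult_right_mono inner osc_nonneg)
    also have "\<dots> = K * (\<Sum>j<M. 2 powr (s * real j) * osc (2 powr (- real j)) X)"
      by (simp add: sum_distrib_left mult.assoc powr_minus powr_realpow power_one_over inverse_eq_divide)
    also have "\<dots> \<le> K * (C0 * (1 + X) powr s)"
      by (intro mult_left_mono C0 K X)
    finally show ?thesis by (simp add: mult.assoc)
  qed
  then show thesis using that[of "K * C0"] K C0 by auto
qed


definition dyadic_index :: "nat \<Rightarrow> real \<Rightarrow> nat" where
  "dyadic_index j u = nat \<lfloor>2 ^ j * u\<rfloor>"

lemma dyadic_index_approx: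
  assumes "u \<ge> 0"
  shows "\<bar>u - real (dyadic_index j u) / 2 ^ j\<bar> \<le> (1/2) ^ j"
proof -
  have "0 \<le> 2 ^ j * u" using assms by simp
  then have "real (dyadic_index j u) \<le> 2 ^ j * u" "2 ^ j * u < real (dyadic_index j u) + 1"
    unfolding dyadic_index_def by linarith+
  then have "real (dyadic_index j u) / 2 ^ j \<le> u" "u \<le> real (dyadic_index j u) / 2 ^ j + 1 / 2 ^ j"
    by (simp_all add: field_simps)
  then show ?thesis by (simp add: power_one_over)
qed

text \<open>
  The approximation of level \<open>j\<close> is determined by that of level \<open>Suc j\<close>, so that the number of
  different steps between the two levels is at most the number of points of the finer one.
\<close>

lemma dyadic_index_Suc_div: "dyadic_index (Suc j) u div 2 = dyadic_index j u"
proof -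
  have "\<lfloor>2 ^ Suc j * u / real_of_int 2\<rfloor> = \<lfloor>2 ^ Suc j * u\<rfloor> div 2"
    by (rule floor_divide_real_eq_div) simp
  then have "\<lfloor>2 ^ j * u\<rfloor> = \<lfloor>2 ^ Suc j * u\<rfloor> div 2" by simp
  then show ?thesis unfolding dyadic_index_def by (simp add: nat_div_distrib')
qed

lemma dyadic_index_less:
  assumes "0 \<le> u" "u < (1/2) ^ l" "l \<le> j"
  shows "dyadic_index j u < 2 ^ (j - l)"
proof -
  have "2 ^ j * u < 2 ^ j * (1/2) ^ l" using assms by simp
  also have "\<dots> = 2 ^ (j - l)" using assms(3) by (simp add: power_one_over power_diff)
  finally have "\<lfloor>2 ^ j * u\<rfloor> < 2 ^ (j - l)" by (simp add: floor_less_iff)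
  then show ?thesis unfolding dyadic_index_def by (simp add: nat_less_iff)
qed

lemma sum_inv_sqrt2_le: "(\<Sum>j\<in>{l<..J}. 1 / sqrt 2 ^ (J - j)) \<le> (4::real)"
proof (induction J)
  case (Suc J)
  show ?case
  proof (cases "l \<le> J")
    case True
    have set: "{l<..Suc J} = insert (Suc J) {l<..J}" using True by auto
    have "(\<Sum>j\<in>{l<..Suc J}. 1 / sqrt 2 ^ (Suc J - j)) = 1 + (\<Sum>j\<in>{l<..J}. 1 / sqrt 2 ^ (Suc J - j))"
      unfolding set by (subst sum.insert) auto
    also have "(\<Sum>j\<in>{l<..J}. 1 / sqrt 2 ^ (Suc J - j)) = (\<Sum>j\<in>{l<..J}. (1 / sqrt 2) * (1 / sqrt 2 ^ (J - j)))"
      by (intro sum.cong refl) (auto simp: Suc_diff_le)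
    also have "\<dots> = (1 / sqrt 2) * (\<Sum>j\<in>{l<..J}. 1 / sqrt 2 ^ (J - j))" by (simp add: sum_distrib_left)
    also have "\<dots> \<le> (3/4) * 4"
    proof (intro mult_mono Suc.IH sum_nonneg)
      have "4/3 \<le> sqrt 2" by (rule real_le_rsqrt) (simp add: power2_eq_square)
      then show "1 / sqrt 2 \<le> 3/4" by (simp add: field_simps)
    qed auto
    finally show ?thesis by simp
  qed simp
qed simp

text \<open>
  \<open>S l\<close> collects the squares of all increments that occur in block \<open>l\<close>: the last ones, from the
  dyadic approximation of level \<open>J l\<close> to the time itself, and the weighted steps between dyadic
  levels. It dominates the square of the deviation at every time of the block, and the integrals
  of the functions \<open>S l\<close> have a finite sum, bounded by the Sobolev norm.
\<close>

lemma a_e_convergence_of_weak_lspace: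
  fixes s :: real and t :: "nat \<Rightarrow> real"
  assumes s: "0 < s" "s < 1/2" and t: "\<And>n. 0 < t n" "\<And>n. t n < 1" "t \<longlonglongrightarrow> 0"
    and weak: "t \<in> weak_lspace (s / (1 - s))"
    and [measurable]: "G \<in> borel_measurable borel" and fin: "sqnorm (bessel_weight s) G < \<infinity>"
    and P: "\<And>\<tau>. is_FT 1 (modulate \<tau> G) (P \<tau>)"
  shows "AE x in lborel. (\<lambda>n. P (t n) x) \<longlonglongrightarrow> P 0 x"
proof -
  define r where "r = s / (1 - s)"
  define J where "J l = nat \<lceil>real l / (1 - s)\<rceil>" for l :: nat
  define E where "E = dyadic_block t"
  define \<beta> where "\<beta> = 2 powr (1 / (1 - s))"
  have \<beta>: "\<beta> > 1" unfolding \<beta>_def using s by simp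
  note [measurable] = is_FT_D(3)[OF P]
  obtain A where A: "A \<ge> 0" "\<And>l. finite (E l)" "\<And>l. real (card (E l)) \<le> A * 2 powr (r * real l)"
    using card_dyadic_block_le[OF weak] unfolding E_def r_def by auto
  have lJ: "l \<le> J l" for l
  proof -
    have "real l \<le> real l / (1 - s)" using s by (simp add: field_simps)
    then show ?thesis unfolding J_def by linarith
  qed
  \<comment> \<open>The mesh at level \<open>J l\<close> is \<open>\<beta> powr (- l)\<close> at most, and \<open>\<beta> powr (s * l) = 2 powr (r * l)\<close> bounds the
      number of times, so that \<open>osc_geometric_sum\<close> covers the last increments too.\<close>
  have J\<beta>: "(1/2) ^ J l \<le> \<beta> powr (- real l)" for l
  proof -
    have "real l / (1 - s) \<le> real (J l)" unfolding J_def by linarith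
    then have "2 powr (- real (J l)) \<le> 2 powr (- (real l / (1 - s)))" by (intro powr_mono) auto
    moreover have "2 powr (- real (J l)) = (1/2) ^ J l"
      by (simp add: powr_minus powr_realpow power_one_over inverse_eq_divide)
    moreover have "2 powr (- (real l / (1 - s))) = \<beta> powr (- real l)"
      unfolding \<beta>_def by (simp add: powr_powr)
    ultimately show ?thesis by simp
  qed
  obtain C1 where C1: "C1 \<ge> 0" "\<And>X L. X \<ge> 0 \<Longrightarrow> (\<Sum>l<L. \<beta> powr (s * real l) * osc (\<beta> powr (- real l)) X) \<le> C1 * (1 + X) powr s"
    using osc_geometric_sum[OF \<beta>, of s] s by auto
  obtain C2 where C2: "C2 \<ge> 0" "\<And>X L. X \<ge> 0 \<Longrightarrow>
    (\<Sum>l<L. \<Sum>j\<in>{l<..J l}. sqrt 2 ^ (J l - j) * (2 ^ (j - l) * osc ((1/2) ^ j) X)) \<le> C2 * (1 + X) powr s"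
    using block_sum_le[OF s] unfolding J_def by auto
  \<comment> \<open>The total weight in block \<open>l\<close> of the frequencies with \<open>|\<xi>|\<^sup>2 = X\<close>.\<close>
  define T where "T l X = real (card (E l)) * osc ((1/2) ^ J l) X + (\<Sum>j\<in>{l<..J l}. sqrt 2 ^ (J l - j) * (2 ^ (j - l) * osc ((1/2) ^ j) X))" for l X
  define C where "C = A * C1 + C2"
  have T0: "T l X \<ge> 0" for l X
    unfolding T_def by (intro add_nonneg_nonneg sum_nonneg mult_nonneg_nonneg osc_nonneg) auto
  have sumT: "(\<Sum>l<L. T l X) \<le> C * (1 + X) powr s" if X: "X \<ge> 0" for X L
  proof -
    have "(\<Sum>l<L. real (card (E l)) * osc ((1/2) ^ J l) X) \<le> (\<Sum>l<L. A * (\<beta> powr (s * real l) * osc (\<beta> powr (- real l)) X))"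
    proof (rule sum_mono)
      fix l
      have "\<beta> powr (s * real l) = 2 powr (r * real l)"
        unfolding \<beta>_def r_def by (simp add: powr_powr)
      then have "real (card (E l)) * osc ((1/2) ^ J l) X \<le> (A * \<beta> powr (s * real l)) * osc (\<beta> powr (- real l)) X"
        using A(3)[of l] A(1) X by (intro mult_mono osc_mono J\<beta> osc_nonneg) auto
      then show "real (card (E l)) * osc ((1/2) ^ J l) X \<le> A * (\<beta> powr (s * real l) * osc (\<beta> powr (- real l)) X)"
        by (simp add: mult.assoc)
    qed
    also have "\<dots> = A * (\<Sum>l<L. \<beta> powr (s * real l) * osc (\<beta> powr (- real l)) X)" by (simp add: sum_distrib_left)
    also have "\<dots> \<le> A * (C1 * (1 + X) powr s)" by (intro mult_left_mono C1 X A)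
    finally have "(\<Sum>l<L. real (card (E l)) * osc ((1/2) ^ J l) X) \<le> A * (C1 * (1 + X) powr s)" .
    with C2(2)[OF X, of L] show ?thesis unfolding T_def C_def sum.distrib by (simp add: algebra_simps)
  qed
  define D where "D j i x = P (real i / 2 ^ j) x - P (real (i div 2) / 2 ^ (j - 1)) x" for j i x
  define A1 where "A1 l n x = P (t n) x - P (real (dyadic_index (J l) (t n)) / 2 ^ J l) x" for l n x
  define S where "S l x = (\<Sum>n\<in>E l. (cmod (A1 l n x))\<^sup>2) + (\<Sum>j\<in>{l<..J l}. sqrt 2 ^ (J l - j) * (\<Sum>i<2 ^ (j - l). (cmod (D j i x))\<^sup>2))" for l x
  have [measurable]: "A1 l n \<in> borel_measurable borel" "D j i \<in> borel_measurable borel" for l n i j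
    unfolding A1_def D_def by measurable
  have S0: "S l x \<ge> 0" for l x
    unfolding S_def by (intro add_nonneg_nonneg sum_nonneg mult_nonneg_nonneg) auto
  have [measurable]: "S l \<in> borel_measurable borel" for l unfolding S_def by measurable
  define K where "K = ennreal (2 * (2*pi)\<^sup>2)"
  have eA: "sqnorm lborel (A1 l n) \<le> K * osc_energy G ((1/2) ^ J l)" for l n
    unfolding A1_def K_def
    by (rule propagator_diff_energy[OF P P]) (rule dyadic_index_approx[OF less_imp_le[OF t(1)]])
  have eD: "sqnorm lborel (D j i) \<le> K * osc_energy G ((1/2) ^ j)" if j: "j > 0" for i j
    unfolding D_def K_def
  proof (rule propagator_diff_energy[OF P P])
    obtain k where k: "j = Suc k" using j by (cases j) auto
    have "real i = 2 * real (i div 2) + real (i mod 2)"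
      by (metis mult_div_mod_eq of_nat_add of_nat_mult of_nat_numeral)
    then have "real i / 2 ^ j - real (i div 2) / 2 ^ (j - 1) = real (i mod 2) / 2 ^ j"
      unfolding k by (simp add: field_simps)
    moreover have "real (i mod 2) / 2 ^ j \<le> 1 / 2 ^ j" by (intro divide_right_mono) (auto simp: mod_less_divisor less_Suc_eq_le[symmetric] numeral_2_eq_2)
    ultimately show "\<bar>real i / 2 ^ j - real (i div 2) / 2 ^ (j - 1)\<bar> \<le> (1/2) ^ j"
      by (simp add: power_one_over)
  qed
  have intS: "(\<integral>\<^sup>+x. ennreal (S l x) \<partial>lborel) \<le> K * (\<integral>\<^sup>+\<xi>. ennreal (T l ((norm \<xi>)\<^sup>2) * (cmod (G \<xi>))\<^sup>2) \<partial>lborel)" for l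
  proof -
    have "(\<integral>\<^sup>+x. ennreal (S l x) \<partial>lborel) = (\<integral>\<^sup>+x. (\<Sum>n\<in>E l. ennreal ((cmod (A1 l n x))\<^sup>2)) + (\<Sum>j\<in>{l<..J l}. ennreal (sqrt 2 ^ (J l - j)) * (\<Sum>i<2 ^ (j - l). ennreal ((cmod (D j i x))\<^sup>2))) \<partial>lborel)"
      unfolding S_def
      by (simp add: sum_ennreal ennreal_mult[symmetric] ennreal_plus[symmetric] sum_nonneg del: ennreal_plus)
    also have "\<dots> = (\<Sum>n\<in>E l. sqnorm lborel (A1 l n)) + (\<Sum>j\<in>{l<..J l}. ennreal (sqrt 2 ^ (J l - j)) * (\<Sum>i<2 ^ (j - l). sqnorm lborel (D j i)))"
      unfolding sqnorm_def by (simp add: nn_integral_add nn_integral_sum nn_integral_cmult del: sum_ennreal)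
    also have "\<dots> \<le> (\<Sum>n\<in>E l. K * osc_energy G ((1/2) ^ J l)) + (\<Sum>j\<in>{l<..J l}. ennreal (sqrt 2 ^ (J l - j)) * (\<Sum>i<(2::nat) ^ (j - l). K * osc_energy G ((1/2) ^ j)))"
      by (intro add_mono sum_mono mult_left_mono eA eD) auto
    also have "\<dots> = K * (ennreal (real (card (E l))) * osc_energy G ((1/2) ^ J l) + (\<Sum>j\<in>{l<..J l}. ennreal (sqrt 2 ^ (J l - j) * 2 ^ (j - l)) * osc_energy G ((1/2) ^ j)))"
      by (simp add: distrib_left sum_distrib_left ennreal_mult ennreal_of_nat_eq_real_of_nat mult_ac flip: ennreal_power)
    also have "ennreal (real (card (E l))) * osc_energy G ((1/2) ^ J l) + (\<Sum>j\<in>{l<..J l}. ennreal (sqrt 2 ^ (J l - j) * 2 ^ (j - l)) * osc_energy G ((1/2) ^ j))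
      = (\<integral>\<^sup>+\<xi>. ennreal (real (card (E l))) * ennreal (osc ((1/2) ^ J l) ((norm \<xi>)\<^sup>2) * (cmod (G \<xi>))\<^sup>2) + (\<Sum>j\<in>{l<..J l}. ennreal (sqrt 2 ^ (J l - j) * 2 ^ (j - l)) * ennreal (osc ((1/2) ^ j) ((norm \<xi>)\<^sup>2) * (cmod (G \<xi>))\<^sup>2)) \<partial>lborel)"
      unfolding osc_energy_def by (simp add: nn_integral_add nn_integral_sum nn_integral_cmult del: sum_ennreal)
    also have "\<dots> = (\<integral>\<^sup>+\<xi>. ennreal (T l ((norm \<xi>)\<^sup>2) * (cmod (G \<xi>))\<^sup>2) \<partial>lborel)"
    proof (rule nn_integral_cong)
      fix \<xi> :: "real^2"
      have "ennreal (real (card (E l))) * ennreal (osc ((1/2) ^ J l) ((norm \<xi>)\<^sup>2) * (cmod (G \<xi>))\<^sup>2) + (\<Sum>j\<in>{l<..J l}. ennreal (sqrt 2 ^ (J l - j) * 2 ^ (j - l)) * ennreal (osc ((1/2) ^ j) ((norm \<xi>)\<^sup>2) * (cmod (G \<xi>))\<^sup>2))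
        = ennreal (real (card (E l)) * (osc ((1/2) ^ J l) ((norm \<xi>)\<^sup>2) * (cmod (G \<xi>))\<^sup>2) + (\<Sum>j\<in>{l<..J l}. (sqrt 2 ^ (J l - j) * 2 ^ (j - l)) * (osc ((1/2) ^ j) ((norm \<xi>)\<^sup>2) * (cmod (G \<xi>))\<^sup>2)))"
        by (subst ennreal_plus) (auto simp: ennreal_mult[symmetric] sum_ennreal osc_nonneg sum_nonneg)
      also have "real (card (E l)) * (osc ((1/2) ^ J l) ((norm \<xi>)\<^sup>2) * (cmod (G \<xi>))\<^sup>2) + (\<Sum>j\<in>{l<..J l}. (sqrt 2 ^ (J l - j) * 2 ^ (j - l)) * (osc ((1/2) ^ j) ((norm \<xi>)\<^sup>2) * (cmod (G \<xi>))\<^sup>2)) = T l ((norm \<xi>)\<^sup>2) * (cmod (G \<xi>))\<^sup>2"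
        unfolding T_def by (simp add: distrib_right sum_distrib_right mult.assoc)
      finally show "ennreal (real (card (E l))) * ennreal (osc ((1/2) ^ J l) ((norm \<xi>)\<^sup>2) * (cmod (G \<xi>))\<^sup>2) + (\<Sum>j\<in>{l<..J l}. ennreal (sqrt 2 ^ (J l - j) * 2 ^ (j - l)) * ennreal (osc ((1/2) ^ j) ((norm \<xi>)\<^sup>2) * (cmod (G \<xi>))\<^sup>2)) = ennreal (T l ((norm \<xi>)\<^sup>2) * (cmod (G \<xi>))\<^sup>2)" .
    qed
    finally show ?thesis .
  qed
  have [measurable]: "(\<lambda>\<xi>::real^2. T l ((norm \<xi>)\<^sup>2)) \<in> borel_measurable borel" for l unfolding T_def by measurable
  have "(\<integral>\<^sup>+x. (\<Sum>l. ennreal (S l x)) \<partial>lborel) = (\<Sum>l. \<integral>\<^sup>+x. ennreal (S l x) \<partial>lborel)"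
    by (rule nn_integral_suminf) measurable
  also have "\<dots> \<le> (\<Sum>l. K * (\<integral>\<^sup>+\<xi>. ennreal (T l ((norm \<xi>)\<^sup>2) * (cmod (G \<xi>))\<^sup>2) \<partial>lborel))"
    by (intro suminf_le intS) auto
  also have "\<dots> = K * (\<Sum>l. \<integral>\<^sup>+\<xi>. ennreal (T l ((norm \<xi>)\<^sup>2) * (cmod (G \<xi>))\<^sup>2) \<partial>lborel)"
    by (rule ennreal_suminf_cmult)
  also have "(\<Sum>l. \<integral>\<^sup>+\<xi>. ennreal (T l ((norm \<xi>)\<^sup>2) * (cmod (G \<xi>))\<^sup>2) \<partial>lborel) = (\<integral>\<^sup>+\<xi>. (\<Sum>l. ennreal (T l ((norm \<xi>)\<^sup>2) * (cmod (G \<xi>))\<^sup>2)) \<partial>lborel)"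
    by (rule nn_integral_suminf[symmetric]) measurable
  also have "K * \<dots> \<le> K * (\<integral>\<^sup>+\<xi>. ennreal C * ennreal ((1 + (norm \<xi>)\<^sup>2) powr s * (cmod (G \<xi>))\<^sup>2) \<partial>lborel)"
  proof (intro mult_left_mono nn_integral_mono suminf_le_const)
    fix \<xi> :: "real^2" and L
    have "(\<Sum>l<L. ennreal (T l ((norm \<xi>)\<^sup>2) * (cmod (G \<xi>))\<^sup>2)) = ennreal ((\<Sum>l<L. T l ((norm \<xi>)\<^sup>2)) * (cmod (G \<xi>))\<^sup>2)"
      by (simp add: sum_ennreal T0 sum_distrib_right)
    also have "\<dots> \<le> ennreal ((C * (1 + (norm \<xi>)\<^sup>2) powr s) * (cmod (G \<xi>))\<^sup>2)"
      by (intro ennreal_leI mult_right_mono sumT) auto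
    also have "\<dots> = ennreal C * ennreal ((1 + (norm \<xi>)\<^sup>2) powr s * (cmod (G \<xi>))\<^sup>2)"
      using A(1) C1(1) C2(1) by (subst ennreal_mult[symmetric]) (auto simp: C_def mult.assoc)
    finally show "(\<Sum>l<L. ennreal (T l ((norm \<xi>)\<^sup>2) * (cmod (G \<xi>))\<^sup>2)) \<le> ennreal C * ennreal ((1 + (norm \<xi>)\<^sup>2) powr s * (cmod (G \<xi>))\<^sup>2)" .
  qed auto
  also have "\<dots> = K * (ennreal C * sqnorm (bessel_weight s) G)"
    by (subst nn_integral_cmult) (auto simp: sqnorm_bessel_weight)
  also have "\<dots> < \<infinity>" unfolding K_def using fin by (simp add: ennreal_mult_less_top)
  finally have "AE x in lborel. (\<Sum>l. ennreal (S l x)) \<noteq> \<infinity>"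
    by (intro nn_integral_PInf_AE) auto
  then show ?thesis
  proof eventually_elim
    case (elim x)
    have "summable (\<lambda>l. S l x)"
      by (rule summable_suminf_not_top) (use elim S0 in auto)
    then have Slim: "(\<lambda>l. S l x) \<longlonglongrightarrow> 0" by (rule summable_LIMSEQ_zero)
    have key: "(cmod (P (t n) x - P 0 x))\<^sup>2 \<le> 8 * S l x" if n: "n \<in> E l" for n l
    proof -
      have tn: "0 \<le> t n" "t n < (1/2) ^ l" using n t(1)[of n] by (auto simp: E_def dyadic_block_def)
      define I where "I j = dyadic_index j (t n)" for j
      have I0: "I l = 0" using dyadic_index_less[OF tn, of l] unfolding I_def by simp
      \<comment> \<open>The chain starts at time \<open>0\<close>, since all times of block \<open>l\<close> are below \<open>(1/2) ^ l\<close>.\<close>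
      have tele: "P (real (I m) / 2 ^ m) x - P 0 x = (\<Sum>j\<in>{l<..m}. D j (I j) x)" if "l \<le> m" for m
        using that
      proof (induction m rule: dec_induct)
        case base
        show ?case by (simp add: I0)
      next
        case (step m)
        have set: "{l<..Suc m} = insert (Suc m) {l<..m}" using step.hyps by auto
        have "D (Suc m) (I (Suc m)) x = P (real (I (Suc m)) / 2 ^ Suc m) x - P (real (I m) / 2 ^ m) x"
          unfolding D_def I_def dyadic_index_Suc_div by simp
        then show ?case unfolding set using step.IH by (simp add: algebra_simps)
      qed
      have "(cmod (P (real (I (J l)) / 2 ^ J l) x - P 0 x))\<^sup>2 \<le> (\<Sum>j\<in>{l<..J l}. 1 / sqrt 2 ^ (J l - j)) * (\<Sum>j\<in>{l<..J l}. sqrt 2 ^ (J l - j) * (cmod (D j (I j) x))\<^sup>2)"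
        unfolding tele[OF lJ] by (rule cmod_sum_sq_weighted_le) auto
      also have "\<dots> \<le> 4 * (\<Sum>j\<in>{l<..J l}. sqrt 2 ^ (J l - j) * (\<Sum>i<2 ^ (j - l). (cmod (D j i x))\<^sup>2))"
      proof (intro mult_mono sum_inv_sqrt2_le sum_mono mult_left_mono)
        fix j assume "j \<in> {l<..J l}"
        then have "I j < 2 ^ (j - l)" unfolding I_def by (intro dyadic_index_less tn) auto
        then show "(cmod (D j (I j) x))\<^sup>2 \<le> (\<Sum>i<2 ^ (j - l). (cmod (D j i x))\<^sup>2)"
          by (intro member_le_sum) auto
      qed (auto intro!: sum_nonneg mult_nonneg_nonneg)
      finally have 1: "(cmod (P (real (I (J l)) / 2 ^ J l) x - P 0 x))\<^sup>2 \<le> 4 * (\<Sum>j\<in>{l<..J l}. sqrt 2 ^ (J l - j) * (\<Sum>i<2 ^ (j - l). (cmod (D j i x))\<^sup>2))" .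
      have 2: "(cmod (A1 l n x))\<^sup>2 \<le> (\<Sum>n\<in>E l. (cmod (A1 l n x))\<^sup>2)"
        by (rule member_le_sum[of n]) (use n A(2) in auto)
      have "(cmod (P (t n) x - P 0 x))\<^sup>2 \<le> 2 * (cmod (A1 l n x))\<^sup>2 + 2 * (cmod (P (real (I (J l)) / 2 ^ J l) x - P 0 x))\<^sup>2"
        using cmod_add_sq_le[of "A1 l n x" "P (real (I (J l)) / 2 ^ J l) x - P 0 x"] unfolding A1_def I_def by simp
      moreover have "0 \<le> (\<Sum>n\<in>E l. (cmod (A1 l n x))\<^sup>2)" by (intro sum_nonneg) auto
      moreover have "a \<le> 8 * (u + v)" if "a \<le> 2 * b + 2 * c" "0 \<le> u" "c \<le> 4 * v" "b \<le> u" for a b c u v :: real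
      proof -
        have "2 * c \<le> 8 * v" "2 * b \<le> 8 * u" using that(2-4) by simp_all
        then show ?thesis using that(1) by (simp add: distrib_left)
      qed
      ultimately show ?thesis using 1 2 unfolding S_def by blast
    qed
    show ?case
    proof (rule LIMSEQ_I)
      fix e :: real assume e: "e > 0"
      then have "\<forall>\<^sub>F l in sequentially. S l x < e\<^sup>2 / 8" by (intro order_tendstoD(2)[OF Slim]) auto
      then obtain l0 where l0: "\<And>l. l \<ge> l0 \<Longrightarrow> S l x < e\<^sup>2 / 8" by (auto simp: eventually_sequentially)
      have "\<forall>\<^sub>F n in sequentially. t n < (1/2) ^ Suc l0" by (intro order_tendstoD(2)[OF t(3)]) simp
      then obtain N where N: "\<And>n. n \<ge> N \<Longrightarrow> t n < (1/2) ^ Suc l0" by (auto simp: eventually_sequentially)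
      have "cmod (P (t n) x - P 0 x) < e" if "n \<ge> N" for n
      proof -
        obtain l where l: "n \<in> E l" using ex_dyadic_block[of t n, OF t(1) t(2)] unfolding E_def by blast
        have "l \<ge> l0"
        proof (rule ccontr)
          assume "\<not> l \<ge> l0"
          then have "(1/2::real) ^ Suc l0 \<le> (1/2) ^ Suc l" by (intro power_decreasing) auto
          moreover have "(1/2) ^ Suc l \<le> t n" using l unfolding E_def dyadic_block_def by blast
          ultimately show False using N[OF that] by linarith
        qed
        then have "(cmod (P (t n) x - P 0 x))\<^sup>2 < e\<^sup>2" using key[OF l] l0[of l] by simp
        then show ?thesis using e by (intro power_less_imp_less_base[of _ 2 e]) auto
      qed
      then show "\<exists>N. \<forall>n\<ge>N. norm (P (t n) x - P 0 x) < e" by auto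
    qed
  qed
qed

section \<open>Small gaps outside the weak space\<close>

text \<open>
  The tangent of the convex function \<open>x powr (- r)\<close> at \<open>y\<close> lies below its graph.
\<close>

lemma powr_neg_gap:
  fixes x y r :: real
  assumes "0 < x" "x \<le> y" "0 < r"
  shows "r * y powr (- r - 1) * (y - x) \<le> x powr (- r) - y powr (- r)"
proof -
  have y: "y > 0" using assms by simp
  define z where "z = x / y"
  have z: "z > 0" using assms y by (simp add: z_def)
  have "1 + r * (1 - z) \<le> 1 + (- r) * ln z"
    using ln_le_minus_one[OF z] assms(3) mult_left_mono[of "ln z" "z - 1" r] by (simp add: algebra_simps)
  also have "\<dots> \<le> exp ((- r) * ln z)" by (rule exp_ge_add_one_self)
  also have "\<dots> = z powr (- r)" using z by (simp add: powr_def)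
  finally have "(1 + r * (1 - z)) * y powr (- r) \<le> z powr (- r) * y powr (- r)"
    by (rule mult_right_mono) simp
  also have "z powr (- r) * y powr (- r) = x powr (- r)"
    unfolding powr_mult[symmetric] z_def using y by simp
  finally have 1: "y powr (- r) + r * (1 - z) * y powr (- r) \<le> x powr (- r)" by (simp add: distrib_right)
  have "y powr (- r - 1) * (y - x) = (1 - z) * y powr (- r)"
  proof -
    have "y powr (- r) = y powr (- r - 1) * y" using y by (simp add: powr_mult_base mult.commute)
    moreover have "(1 - z) * y = y - x" unfolding z_def using y by (simp add: field_simps)
    ultimately show ?thesis by (metis mult.assoc mult.commute)
  qed
  then have "r * y powr (- r - 1) * (y - x) = r * (1 - z) * y powr (- r)" by (simp add: mult.assoc)
  then show ?thesis using 1 by linarith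
qed

text \<open>
  Otherwise \<open>t n powr (- r)\<close> grows by at least \<open>r * c\<close> in every step from \<open>N\<close> on, by
  \<open>powr_neg_gap\<close>, so that at most \<open>N + 1 + b powr (- r) / (r * c)\<close> times exceed \<open>b\<close>.
\<close>

lemma exists_small_gap:
  fixes t :: "nat \<Rightarrow> real"
  assumes t: "\<And>n. 0 < t n" "\<And>n. t n < 1" "decseq t" and r: "0 < r"
    and nw: "t \<notin> weak_lspace r" and c: "0 < c"
  shows "\<exists>n\<ge>N. t n - t (Suc n) < c * t n powr (1 + r)"
proof (rule ccontr)
  assume "\<not> ?thesis"
  then have gap: "c * t n powr (1 + r) \<le> t n - t (Suc n)" if "n \<ge> N" for n using that by (auto simp: not_less)
  define u where "u n = t n powr (- r)" for n
  have step: "u n + r * c \<le> u (Suc n)" if "n \<ge> N" for n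
  proof -
    have "r * c = r * t n powr (- r - 1) * (c * t n powr (1 + r))"
      using t(1)[of n] by (simp add: powr_add[symmetric] mult.left_commute)
    also have "\<dots> \<le> r * t n powr (- r - 1) * (t n - t (Suc n))"
      using r gap[OF that] by (intro mult_left_mono) auto
    also have "\<dots> \<le> u (Suc n) - u n"
      unfolding u_def using t(1)[of "Suc n"] decseqD[OF t(3), of n "Suc n"] r by (intro powr_neg_gap) auto
    finally show ?thesis by simp
  qed
  have ulow: "r * c * (real n - real N) \<le> u n" if "n \<ge> N" for n
    using that
  proof (induction n rule: dec_induct)
    case base show ?case by (simp add: u_def)
  next
    case (step n)
    then show ?case using \<open>\<And>n. n \<ge> N \<Longrightarrow> u n + r * c \<le> u (Suc n)\<close>[of n] by (simp add: algebra_simps)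
  qed
  define A where "A = real N + 1 + 1 / (r * c)"
  have rc: "r * c > 0" using r c by simp
  have "ennreal (b powr r) * emeasure (count_space UNIV) {n. t n > b} \<le> ennreal A" if b: "b > 0" for b
  proof (cases "b < 1")
    case False
    then have "{n. t n > b} = {}" using t(2) by (auto simp: not_less) (meson less_le_trans not_less order.asym)
    then show ?thesis by simp
  next
    case True
    define m where "m = nat \<lceil>real N + b powr (- r) / (r * c)\<rceil>"
    have sub: "{n. t n > b} \<subseteq> {..<m}"
    proof
      fix n assume "n \<in> {n. t n > b}"
      then have n: "b < t n" by simp
      show "n \<in> {..<m}"
      proof (cases "n \<ge> N")
        case True
        have "u n < b powr (- r)" unfolding u_def using n b r by (intro powr_less_mono2_neg) auto
        with ulow[OF True] have "real n - real N < b powr (- r) / (r * c)"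
          using rc by (simp add: pos_less_divide_eq mult.commute)
        then show ?thesis unfolding m_def by (simp) linarith
      next
        case False
        have "0 < b powr (- r) / (r * c)" using rc b by simp
        then have "real n < real N + b powr (- r) / (r * c)" using False by simp
        then show ?thesis unfolding m_def by (simp) linarith
      qed
    qed
    have mle: "real m \<le> real N + b powr (- r) / (r * c) + 1"
    proof -
      have "0 \<le> real N + b powr (- r) / (r * c)" using rc by simp
      then show ?thesis unfolding m_def by linarith
    qed
    have br: "b powr r \<le> 1" using b True r by (simp add: powr_le1)
    have "b powr r * real m \<le> b powr r * (real N + b powr (- r) / (r * c) + 1)"
      by (intro mult_left_mono mle) simp
    also have "\<dots> = b powr r * (real N + 1) + (b powr r * b powr (- r)) / (r * c)"
      by (simp add: distrib_left)
    also have "b powr r * b powr (- r) = 1" using b by (simp add: powr_add[symmetric])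
    also have "b powr r * (real N + 1) + 1 / (r * c) \<le> A"
      unfolding A_def using br by (intro add_right_mono mult_left_le_one_le) auto
    finally have le: "b powr r * real m \<le> A" .
    have "emeasure (count_space UNIV) {n. t n > b} \<le> emeasure (count_space UNIV) {..<m}"
      by (rule emeasure_mono[OF sub]) simp
    also have "\<dots> = ennreal (real m)" by (simp add: emeasure_count_space_finite ennreal_of_nat_eq_real_of_nat)
    finally have "ennreal (b powr r) * emeasure (count_space UNIV) {n. t n > b} \<le> ennreal (b powr r) * ennreal (real m)"
      by (rule mult_left_mono) simp
    also have "\<dots> \<le> ennreal A" using le by (subst ennreal_mult[symmetric]) (auto intro: ennreal_leI)
    finally show ?thesis .
  qed
  then have "(SUP b\<in>{0<..}. ennreal (b powr r) * emeasure (count_space UNIV) {n. t n > b}) \<le> ennreal A"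
    by (intro SUP_least) auto
  also have "\<dots> < \<infinity>" by simp
  finally show False using nw unfolding weak_lspace_def by simp
qed

section \<open>Travelling combs\<close>

lemma exp_half_le: "exp (- (1/2)) \<le> (2/3 :: real)"
proof -
  have "3/2 \<le> exp (1/2 :: real)" using exp_ge_add_one_self[of "1/2"] by simp
  then show ?thesis by (simp add: exp_minus field_simps)
qed

text \<open>
  Different teeth of a comb are almost orthogonal: the inner products decay like a Gaussian in
  the difference of their indices.
\<close>

lemma sum_gauss_le: "(\<Sum>j\<le>M. exp (- (real m - real j)\<^sup>2 / 2)) \<le> 6"
proof -
  define q where "q = exp (- (1/2) :: real)"
  have q: "0 < q" "q < 1" "q \<le> 2/3" using exp_half_le by (auto simp: q_def)
  have q3: "1 / (1 - q) \<le> 3" using q by (simp add: field_simps)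
  have pw: "exp (- x\<^sup>2 / 2) \<le> q powr x" if "x \<ge> 1 \<or> x = 0" for x :: real
  proof -
    have "x \<le> x\<^sup>2" using that self_le_power[of x 2] by auto
    then show ?thesis unfolding q_def by (simp add: powr_def)
  qed
  have up: "(\<Sum>j\<in>{m..M}. exp (- (real m - real j)\<^sup>2 / 2)) \<le> 3"
  proof -
    have "(\<Sum>j\<in>{m..M}. exp (- (real m - real j)\<^sup>2 / 2)) \<le> (\<Sum>j\<in>{m..M}. q powr (- real m) * q powr real j)"
    proof (rule sum_mono)
      fix j assume "j \<in> {m..M}"
      then have "exp (- (real j - real m)\<^sup>2 / 2) \<le> q powr (real j - real m)" by (intro pw) auto
      then show "exp (- (real m - real j)\<^sup>2 / 2) \<le> q powr (- real m) * q powr real j"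
        by (simp add: power2_commute powr_add[symmetric])
    qed
    also have "\<dots> = q powr (- real m) * (\<Sum>j\<in>{m..M}. q powr real j)" by (simp add: sum_distrib_left)
    also have "\<dots> \<le> q powr (- real m) * (q powr real m / (1 - q))"
      by (intro mult_left_mono sum_powr_tail_le q) auto
    also have "\<dots> = 1 / (1 - q)" using q by (simp add: powr_add[symmetric])
    finally show ?thesis using q3 by simp
  qed
  have down: "(\<Sum>j\<le>m. exp (- (real m - real j)\<^sup>2 / 2)) \<le> 3"
  proof -
    have "(\<Sum>j\<le>m. exp (- (real m - real j)\<^sup>2 / 2)) \<le> (\<Sum>j\<le>m. q ^ (m - j))"
    proof (rule sum_mono)
      fix j assume "j \<in> {..m}"
      then have j: "j \<le> m" by simp
      have "exp (- (real m - real j)\<^sup>2 / 2) \<le> q powr (real m - real j)" using j by (intro pw) auto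
      also have "\<dots> = q ^ (m - j)" using q j by (simp add: powr_realpow[symmetric] of_nat_diff)
      finally show "exp (- (real m - real j)\<^sup>2 / 2) \<le> q ^ (m - j)" .
    qed
    also have "\<dots> \<le> 3"
    proof (induction m)
      case (Suc m)
      have "(\<Sum>j\<le>Suc m. q ^ (Suc m - j)) = q * (\<Sum>j\<le>m. q ^ (m - j)) + 1"
        by (simp add: sum_distrib_left Suc_diff_le)
      also have "\<dots> \<le> (2/3) * 3 + 1"
        using q Suc.IH by (intro add_right_mono mult_mono sum_nonneg) auto
      finally show ?case by simp
    qed simp
    finally show ?thesis .
  qed
  have "(\<Sum>j\<le>M. exp (- (real m - real j)\<^sup>2 / 2)) \<le> (\<Sum>j\<in>{..m} \<union> {m..M}. exp (- (real m - real j)\<^sup>2 / 2))"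
    by (intro sum_mono2) auto
  also have "\<dots> \<le> (\<Sum>j\<le>m. exp (- (real m - real j)\<^sup>2 / 2)) + (\<Sum>j\<in>{m..M}. exp (- (real m - real j)\<^sup>2 / 2))"
    by (subst sum.union_inter[symmetric]) (auto intro!: sum_nonneg)
  finally show ?thesis using up down by simp
qed

lemma integral_real2_iterated:
  fixes F :: "real^2 \<Rightarrow> complex"
  assumes F: "integrable lborel F"
  shows "integrable lborel (\<lambda>v. LINT u|lborel. F (vector [u, v]))"
    "(LINT x|lborel. F x) = (LINT v|lborel. LINT u|lborel. F (vector [u, v]))"
proof -
  have [measurable]: "F \<in> borel_measurable borel" using F by auto
  have i: "integrable (lborel \<Otimes>\<^sub>M lborel) (\<lambda>p. F (vector [fst p, snd p]))"
    using F by (subst (asm) lborel_real2, subst (asm) integrable_distr_eq) auto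
  then have i': "integrable (lborel \<Otimes>\<^sub>M lborel) (case_prod (\<lambda>u v. F (vector [u, v])))"
    by (simp add: case_prod_beta')
  show "integrable lborel (\<lambda>v. LINT u|lborel. F (vector [u, v]))"
    by (rule lborel_pair.integrable_snd[OF i'])
  have "(LINT x|lborel. F x) = (LINT p|(lborel \<Otimes>\<^sub>M lborel). F (vector [fst p, snd p]))"
    by (subst lborel_real2, subst integral_distr) auto
  also have "\<dots> = (LINT v|lborel. LINT u|lborel. F (vector [u, v]))"
    using lborel_pair.integral_snd[OF i'] by (simp add: case_prod_beta')
  finally show "(LINT x|lborel. F x) = (LINT v|lborel. LINT u|lborel. F (vector [u, v]))" .
qed

definition comb :: "real \<Rightarrow> nat \<Rightarrow> real \<Rightarrow> complex" where
  "comb h M u = (\<Sum>m\<le>M. cis (- (real m * h * u)))"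

definition bump_profile :: "real \<Rightarrow> real \<Rightarrow> nat \<Rightarrow> real \<Rightarrow> complex" where
  "bump_profile Lam h M u = complex_of_real (exp (- u\<^sup>2 / (2 * Lam\<^sup>2)) / Lam) * comb h M u"

text \<open>
  The Fourier transform, up to a constant, of a comb of \<open>M + 1\<close> Gaussian bumps in the first
  variable, of width \<open>1 / Lam\<close> and at distance \<open>h\<close>. The sharp cut-off in the second variable makes the
  second frequency constant up to an error of \<open>1\<close>, so that all of the wave moves with
  almost the same speed.
\<close>

definition wave_comb :: "real \<Rightarrow> real \<Rightarrow> nat \<Rightarrow> real^2 \<Rightarrow> complex" where
  "wave_comb Lam h M \<xi> = bump_profile Lam h M (\<xi> $ 1) * indicator {Lam..Lam+1} (\<xi> $ 2)"

lemma comb_measurable [measurable]: "comb h M \<in> borel_measurable borel"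
  unfolding comb_def[abs_def] by measurable

lemma bump_profile_measurable [measurable]: "bump_profile Lam h M \<in> borel_measurable borel"
  unfolding bump_profile_def[abs_def] by measurable

lemma wave_comb_measurable [measurable]: "wave_comb Lam h M \<in> borel_measurable borel"
  unfolding wave_comb_def[abs_def] by measurable

lemma
  assumes l: "Lam > 0"
  shows integrable_cis_bump_profile: "integrable lborel (\<lambda>u. cis (u * y) * bump_profile Lam h M u)"
    and integral_cis_bump_profile: "(LINT u|lborel. cis (u * y) * bump_profile Lam h M u)
      = complex_of_real (sqrt (2 * pi) * (\<Sum>m\<le>M. exp (- (Lam * (y - real m * h))\<^sup>2 / 2)))"
proof -
  define a where "a = 1 / Lam\<^sup>2"
  have a: "a > 0" using l by (simp add: a_def)
  have eq: "cis (u * y) * bump_profile Lam h M u = (\<Sum>m\<le>M. complex_of_real (1 / Lam) * (complex_of_real (exp (- a * u\<^sup>2 / 2)) * cis (u * (y - real m * h))))" for u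
  proof -
    have "cis (u * y) * bump_profile Lam h M u = (\<Sum>m\<le>M. complex_of_real (exp (- u\<^sup>2 / (2 * Lam\<^sup>2)) / Lam) * (cis (u * y) * cis (- (real m * h * u))))"
      unfolding bump_profile_def comb_def sum_distrib_left by (intro sum.cong refl) (simp only: mult_ac)
    also have "\<dots> = (\<Sum>m\<le>M. complex_of_real (1 / Lam) * (complex_of_real (exp (- a * u\<^sup>2 / 2)) * cis (u * (y - real m * h))))"
    proof (rule sum.cong[OF refl])
      fix m
      have "exp (- u\<^sup>2 / (2 * Lam\<^sup>2)) = exp (- a * u\<^sup>2 / 2)" by (simp add: a_def)
      moreover have "u * y + - (real m * h * u) = u * (y - real m * h)" by (simp add: algebra_simps)
      ultimately show "complex_of_real (exp (- u\<^sup>2 / (2 * Lam\<^sup>2)) / Lam) * (cis (u * y) * cis (- (real m * h * u))) = complex_of_real (1 / Lam) * (complex_of_real (exp (- a * u\<^sup>2 / 2)) * cis (u * (y - real m * h)))"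
        by (simp add: cis_mult)
    qed
    finally show ?thesis .
  qed
  have i: "integrable lborel (\<lambda>u. complex_of_real (1 / Lam) * (complex_of_real (exp (- a * u\<^sup>2 / 2)) * cis (u * w)))" for w
    by (intro integrable_mult_right integrable_gauss_real[OF a])
  show "integrable lborel (\<lambda>u. cis (u * y) * bump_profile Lam h M u)"
    unfolding eq by (intro Bochner_Integration.integrable_sum i)
  have "(LINT u|lborel. cis (u * y) * bump_profile Lam h M u) = (\<Sum>m\<le>M. complex_of_real (1 / Lam) * (sqrt (2 * pi / a) * exp (- (y - real m * h)\<^sup>2 / (2 * a))))"
    unfolding eq by (subst Bochner_Integration.integral_sum[OF i]) (simp only: integral_mult_right_zero integral_gauss_real[OF a])
  also have "\<dots> = (\<Sum>m\<le>M. complex_of_real (sqrt (2 * pi) * exp (- (Lam * (y - real m * h))\<^sup>2 / 2)))"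
  proof (rule sum.cong[OF refl])
    fix m
    have "1 / Lam * sqrt (2 * pi / a) = sqrt (2 * pi)"
      unfolding a_def using l by (simp add: real_sqrt_mult)
    moreover have "- (y - real m * h)\<^sup>2 / (2 * a) = - (Lam * (y - real m * h))\<^sup>2 / 2"
      unfolding a_def using l by (simp add: power_mult_distrib mult.commute)
    ultimately have "1 / Lam * (sqrt (2 * pi / a) * exp (- (y - real m * h)\<^sup>2 / (2 * a))) = sqrt (2 * pi) * exp (- (Lam * (y - real m * h))\<^sup>2 / 2)"
      by (metis mult.assoc)
    then show "complex_of_real (1 / Lam) * (sqrt (2 * pi / a) * exp (- (y - real m * h)\<^sup>2 / (2 * a))) = complex_of_real (sqrt (2 * pi) * exp (- (Lam * (y - real m * h))\<^sup>2 / 2))"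
      by (simp only: of_real_mult[symmetric])
  qed
  finally show "(LINT u|lborel. cis (u * y) * bump_profile Lam h M u)
      = complex_of_real (sqrt (2 * pi) * (\<Sum>m\<le>M. exp (- (Lam * (y - real m * h))\<^sup>2 / 2)))"
    by (simp add: sum_distrib_left)
qed

lemma integrable_wave_comb:
  assumes l: "Lam > 0"
  shows "integrable lborel (wave_comb Lam h M)"
proof -
  have "integrable lborel (bump_profile Lam h M)"
    using integrable_cis_bump_profile[OF l, of 0 h M] by simp
  moreover have "integrable lborel (\<lambda>v. complex_of_real (indicator {Lam..Lam+1} v))"
    unfolding complex_of_real_integrable_eq by (rule integrable_real_indicator) auto
  ultimately have "integrable lborel (\<lambda>\<xi>::real^2. bump_profile Lam h M (\<xi> $ 1) * complex_of_real (indicator {Lam..Lam+1} (\<xi> $ 2)))"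
    by (rule integrable_real2_prod)
  then show ?thesis unfolding wave_comb_def[abs_def] by (simp add: of_real_indicator)
qed

text \<open>
  Integrating in the first frequency at fixed second frequency \<open>v\<close> turns the phase \<open>t * \<xi>\<^sub>1 * v\<close> into
  a translation of the comb by \<open>- t * v\<close>. The bumps are positive and, for \<open>\<bar>x $ 2\<bar> \<le> 1\<close>, the remaining
  factors \<open>cis (x $ 2 * v)\<close> point into directions that differ by an angle of at most \<open>1\<close>, so
  that no cancellation occurs.
\<close>

lemma FT_modulate_wave_comb_lower:
  fixes x :: "real^2"
  assumes l: "Lam \<ge> 1" and x2: "\<bar>x $ 2\<bar> \<le> 1" and m: "m \<le> M"
    and near: "\<And>v. v \<in> {Lam..Lam+1} \<Longrightarrow> \<bar>x $ 1 + t * v - real m * h\<bar> \<le> 2 / Lam"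
  shows "cos 1 * exp (-2) \<le> cmod (FT 1 (modulate t (wave_comb Lam h M)) x)"
proof -
  have l0: "Lam > 0" using l by simp
  define g where "g y = sqrt (2 * pi) * (\<Sum>m\<le>M. exp (- (Lam * (y - real m * h))\<^sup>2 / 2))" for y
  define F where "F \<xi> = cis (- (x $ 2) * Lam) * (cis (1 * (x \<bullet> \<xi>)) * modulate t (wave_comb Lam h M) \<xi>)" for \<xi>
  have im: "integrable lborel (modulate t (wave_comb Lam h M))"
    unfolding modulate_def[abs_def] by (intro integrable_cis_mult integrable_wave_comb l0) measurable
  have iF: "integrable lborel F"
    unfolding F_def by (intro integrable_mult_right integrable_cis_mult im) measurable
  have F: "(LINT \<xi>|lborel. F \<xi>) = cis (- (x $ 2) * Lam) * FT 1 (modulate t (wave_comb Lam h M)) x"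
    unfolding F_def FT_def by simp
  have inner: "(LINT u|lborel. F (vector [u, v])) = cis (x $ 2 * (v - Lam)) * complex_of_real (indicator {Lam..Lam+1} v * g (x $ 1 + t * v))" for v
  proof -
    have "F (vector [u, v]) = (cis (x $ 2 * (v - Lam)) * complex_of_real (indicator {Lam..Lam+1} v)) * (cis (u * (x $ 1 + t * v)) * bump_profile Lam h M u)" for u
    proof -
      have "cis (- (x $ 2) * Lam) * (cis (x $ 1 * u + x $ 2 * v) * cis (t * u * v)) = cis (x $ 2 * (v - Lam)) * cis (u * (x $ 1 + t * v))"
        by (simp add: cis_mult algebra_simps)
      then show ?thesis
        unfolding F_def modulate_def wave_comb_def
        by (simp add: real2_inner of_real_indicator mult_ac)
    qed
    then have "(LINT u|lborel. F (vector [u, v])) = (cis (x $ 2 * (v - Lam)) * complex_of_real (indicator {Lam..Lam+1} v)) * complex_of_real (g (x $ 1 + t * v))"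
      unfolding g_def by (simp only: integral_mult_right_zero integral_cis_bump_profile[OF l0])
    then show ?thesis by (simp add: mult.assoc)
  qed
  note it = integral_real2_iterated[OF iF]
  have "cos 1 * exp (-2) = (LINT v|lborel. indicator {Lam..Lam+1} v * (cos 1 * exp (-2) :: real))"
    by simp
  also have "\<dots> \<le> (LINT v|lborel. Re (LINT u|lborel. F (vector [u, v])))"
  proof (rule Bochner_Integration.integral_mono)
    show "integrable lborel (\<lambda>v. indicator {Lam..Lam+1} v * (cos 1 * exp (-2)) :: real)"
      by (intro integrable_mult_left integrable_real_indicator) auto
    show "integrable lborel (\<lambda>v. Re (LINT u|lborel. F (vector [u, v])))" by (intro integrable_Re it)
    fix v
    show "indicator {Lam..Lam+1} v * (cos 1 * exp (-2)) \<le> Re (LINT u|lborel. F (vector [u, v]))"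
    proof (cases "v \<in> {Lam..Lam+1}")
      case True
      have "exp (-2) \<le> exp (- (Lam * (x $ 1 + t * v - real m * h))\<^sup>2 / 2)"
      proof -
        have "\<bar>Lam * (x $ 1 + t * v - real m * h)\<bar> \<le> 2"
          using mult_left_mono[OF near[OF True], of Lam] l0 unfolding abs_mult by simp
        then have "(Lam * (x $ 1 + t * v - real m * h))\<^sup>2 \<le> 2\<^sup>2" by (simp only: abs_le_square_iff[symmetric])
        then show ?thesis by simp
      qed
      also have "\<dots> \<le> (\<Sum>m\<le>M. exp (- (Lam * (x $ 1 + t * v - real m * h))\<^sup>2 / 2))"
        using m by (intro member_le_sum) auto
      also have "\<dots> \<le> g (x $ 1 + t * v)"
      proof -
        have "1 \<le> sqrt (2 * pi)" using pi_gt3 by simp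
        moreover have "0 \<le> (\<Sum>m\<le>M. exp (- (Lam * (x $ 1 + t * v - real m * h))\<^sup>2 / 2))" by (intro sum_nonneg) auto
        ultimately show ?thesis
          unfolding g_def using mult_right_mono[of 1 "sqrt (2 * pi)" "\<Sum>m\<le>M. exp (- (Lam * (x $ 1 + t * v - real m * h))\<^sup>2 / 2)"] by simp
      qed
      finally have g: "exp (-2) \<le> g (x $ 1 + t * v)" .
      have "\<bar>x $ 2 * (v - Lam)\<bar> \<le> 1 * 1" unfolding abs_mult using x2 True by (intro mult_mono) auto
      then have "cos 1 \<le> cos \<bar>x $ 2 * (v - Lam)\<bar>" using pi_gt3 by (intro cos_monotone_0_pi_le) auto
      then have c: "cos 1 \<le> cos (x $ 2 * (v - Lam))" by (simp only: cos_abs_real)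
      have "cos 1 * exp (-2) \<le> cos (x $ 2 * (v - Lam)) * g (x $ 1 + t * v)"
        using g c cos_ge_zero[of 1] pi_gt3 by (intro mult_mono) (auto intro: order_trans[of 0 "cos 1"])
      then show ?thesis unfolding inner using True by simp
    next
      case False
      then show ?thesis unfolding inner by simp
    qed
  qed
  also have "\<dots> = Re (LINT v|lborel. LINT u|lborel. F (vector [u, v]))"
    using it(1) by simp
  also have "\<dots> = Re (cis (- (x $ 2) * Lam) * FT 1 (modulate t (wave_comb Lam h M)) x)"
    unfolding it(2)[symmetric] F ..
  also have "\<dots> \<le> cmod (cis (- (x $ 2) * Lam) * FT 1 (modulate t (wave_comb Lam h M)) x)" by (rule complex_Re_le_cmod)
  also have "\<dots> = cmod (FT 1 (modulate t (wave_comb Lam h M)) x)" by (simp add: norm_mult)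
  finally show ?thesis .
qed

text \<open>
  Expand the square of the comb. The condition \<open>h * Lam \<ge> 1\<close> says that the teeth are separated by at
  least their width, so that \<open>sum_gauss_le\<close> bounds the sum over one of the two indices.
\<close>

lemma comb_energy:
  assumes l: "Lam > 0" and hl: "h * Lam \<ge> 1"
  shows "integrable lborel (\<lambda>u. exp (- u\<^sup>2 / (2 * Lam\<^sup>2)) * (cmod (comb h M u))\<^sup>2)"
    "(LINT u|lborel. exp (- u\<^sup>2 / (2 * Lam\<^sup>2)) * (cmod (comb h M u))\<^sup>2) \<le> 18 * Lam * (real M + 1)"
proof -
  define a where "a = 1 / Lam\<^sup>2"
  have a: "a > 0" using l by (simp add: a_def)
  define K where "K m j u = complex_of_real (exp (- a * u\<^sup>2 / 2)) * cis (u * (h * (real j - real m)))" for m j :: nat and u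
  have eq: "complex_of_real (exp (- u\<^sup>2 / (2 * Lam\<^sup>2)) * (cmod (comb h M u))\<^sup>2) = (\<Sum>m\<le>M. \<Sum>j\<le>M. K m j u)" for u
  proof -
    have e: "exp (- u\<^sup>2 / (2 * Lam\<^sup>2)) = exp (- a * u\<^sup>2 / 2)" by (simp add: a_def)
    have "complex_of_real ((cmod (comb h M u))\<^sup>2) = comb h M u * cnj (comb h M u)" by (rule complex_norm_square)
    also have "\<dots> = (\<Sum>m\<le>M. \<Sum>j\<le>M. cis (- (real m * h * u)) * cis (real j * h * u))"
      unfolding comb_def by (simp add: cis_cnj sum_product)
    also have "\<dots> = (\<Sum>m\<le>M. \<Sum>j\<le>M. cis (u * (h * (real j - real m))))"
      by (simp add: cis_mult algebra_simps)
    finally show ?thesis unfolding of_real_mult e K_def by (simp add: sum_distrib_left)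
  qed
  have iK: "integrable lborel (K m j)" for m j unfolding K_def[abs_def] by (rule integrable_gauss_real[OF a])
  have LK: "(LINT u|lborel. K m j u) = complex_of_real (sqrt (2 * pi) * Lam * exp (- (Lam * (h * (real j - real m)))\<^sup>2 / 2))" for m j
  proof -
    have "sqrt (2 * pi / a) = sqrt (2 * pi) * Lam" unfolding a_def using l by (simp add: real_sqrt_mult)
    moreover have "- (h * (real j - real m))\<^sup>2 / (2 * a) = - (Lam * (h * (real j - real m)))\<^sup>2 / 2"
      unfolding a_def using l by (simp add: power_mult_distrib mult.commute)
    ultimately show ?thesis unfolding K_def integral_gauss_real[OF a] by (simp only: of_real_mult)
  qed
  have i: "integrable lborel (\<lambda>u. complex_of_real (exp (- u\<^sup>2 / (2 * Lam\<^sup>2)) * (cmod (comb h M u))\<^sup>2))"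
    unfolding eq by (intro Bochner_Integration.integrable_sum iK)
  then show "integrable lborel (\<lambda>u. exp (- u\<^sup>2 / (2 * Lam\<^sup>2)) * (cmod (comb h M u))\<^sup>2)"
    by (simp only: complex_of_real_integrable_eq)
  have "complex_of_real (LINT u|lborel. exp (- u\<^sup>2 / (2 * Lam\<^sup>2)) * (cmod (comb h M u))\<^sup>2) = (LINT u|lborel. (\<Sum>m\<le>M. \<Sum>j\<le>M. K m j u))"
    unfolding integral_complex_of_real[symmetric] eq ..
  also have "\<dots> = (\<Sum>m\<le>M. \<Sum>j\<le>M. LINT u|lborel. K m j u)"
    by (simp add: Bochner_Integration.integral_sum Bochner_Integration.integrable_sum iK)
  also have "\<dots> = complex_of_real (\<Sum>m\<le>M. \<Sum>j\<le>M. sqrt (2 * pi) * Lam * exp (- (Lam * (h * (real j - real m)))\<^sup>2 / 2))"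
    unfolding LK by simp
  finally have "(LINT u|lborel. exp (- u\<^sup>2 / (2 * Lam\<^sup>2)) * (cmod (comb h M u))\<^sup>2) = (\<Sum>m\<le>M. \<Sum>j\<le>M. sqrt (2 * pi) * Lam * exp (- (Lam * (h * (real j - real m)))\<^sup>2 / 2))"
    by (simp only: of_real_eq_iff)
  also have "\<dots> \<le> (\<Sum>m\<le>M. \<Sum>j\<le>M. (3 * Lam) * exp (- (real m - real j)\<^sup>2 / 2))"
  proof (rule sum_mono, rule sum_mono, rule mult_mono)
    have "sqrt (2 * pi) \<le> 3" using pi_less_4 by (intro real_le_lsqrt) auto
    then show "sqrt (2 * pi) * Lam \<le> 3 * Lam" using l by (intro mult_right_mono) auto
    fix m j
    have "1 * (real m - real j)\<^sup>2 \<le> (h * Lam)\<^sup>2 * (real m - real j)\<^sup>2"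
      using hl by (intro mult_right_mono one_le_power) auto
    also have "\<dots> = (Lam * (h * (real j - real m)))\<^sup>2" by (simp add: power_mult_distrib power2_commute mult_ac)
    finally show "exp (- (Lam * (h * (real j - real m)))\<^sup>2 / 2) \<le> exp (- (real m - real j)\<^sup>2 / 2)" by simp
  qed (use l in auto)
  also have "\<dots> = (3 * Lam) * (\<Sum>m\<le>M. \<Sum>j\<le>M. exp (- (real m - real j)\<^sup>2 / 2))" by (simp add: sum_distrib_left)
  also have "\<dots> \<le> (3 * Lam) * (\<Sum>m\<le>M. 6)"
    using l by (intro mult_left_mono sum_mono sum_gauss_le) auto
  also have "\<dots> = 18 * Lam * (real M + 1)" by simp
  finally show "(LINT u|lborel. exp (- u\<^sup>2 / (2 * Lam\<^sup>2)) * (cmod (comb h M u))\<^sup>2) \<le> 18 * Lam * (real M + 1)" .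
qed

text \<open>
  The second frequency is about \<open>Lam\<close> and the first one is at most of that order, except for a
  Gaussian tail, one half of which absorbs the growth of the weight. So the weight costs a
  factor \<open>Lam powr (2 * s)\<close>; what remains is the number of teeth times their width \<open>1 / Lam\<close>.
\<close>

lemma sqnorm_wave_comb:
  assumes s: "0 < s" "s < 1" and l: "Lam \<ge> 1" and hl: "h * Lam \<ge> 1"
  shows "sqnorm (bessel_weight s) (wave_comb Lam h M) \<le> ennreal (180 * Lam powr (2 * s - 1) * (real M + 1))"
proof -
  have l0: "Lam > 0" using l by simp
  define p where "p u = exp (- u\<^sup>2 / (2 * Lam\<^sup>2)) * (cmod (comb h M u))\<^sup>2" for u
  define w where "w v = (indicator {Lam..Lam+1} v :: real)" for v
  have p0: "p u \<ge> 0" for u unfolding p_def by simp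
  have w0: "w v \<ge> 0" for v unfolding w_def by simp
  have [measurable]: "p \<in> borel_measurable borel" "w \<in> borel_measurable borel"
    unfolding p_def[abs_def] w_def[abs_def] by measurable
  have ip: "integrable lborel (\<lambda>u. complex_of_real (p u))" "integrable lborel (\<lambda>v. complex_of_real (w v))"
    unfolding complex_of_real_integrable_eq p_def w_def
    by (rule comb_energy[OF l0 hl], rule integrable_real_indicator) auto
  have I: "integrable lborel (\<lambda>\<xi>::real^2. p (\<xi> $ 1) * w (\<xi> $ 2))"
    using integrable_real2_prod[OF ip] unfolding of_real_mult[symmetric] complex_of_real_integrable_eq .
  have "complex_of_real (LINT \<xi>|lborel. p ((\<xi>::real^2) $ 1) * w (\<xi> $ 2)) = complex_of_real (LINT u|lborel. p u) * complex_of_real (LINT v|lborel. w v)"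
    using integral_real2_prod[OF ip] unfolding of_real_mult[symmetric] integral_complex_of_real .
  then have "(LINT \<xi>|lborel. p ((\<xi>::real^2) $ 1) * w (\<xi> $ 2)) = (LINT u|lborel. p u) * (LINT v|lborel. w v)"
    unfolding of_real_mult[symmetric] of_real_eq_iff .
  also have "(LINT v|lborel. w v) = 1" unfolding w_def by simp
  finally have IL: "(LINT \<xi>|lborel. p ((\<xi>::real^2) $ 1) * w (\<xi> $ 2)) \<le> 18 * Lam * (real M + 1)"
    using comb_energy(2)[OF l0 hl, of M] unfolding p_def by simp
  define B where "B = 10 * Lam powr (2 * s - 2)"
  have B0: "B \<ge> 0" by (simp add: B_def)
  have pt: "(1 + (norm \<xi>)\<^sup>2) powr s * (cmod (wave_comb Lam h M \<xi>))\<^sup>2 \<le> B * (p (\<xi> $ 1) * w (\<xi> $ 2))" for \<xi>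
  proof (cases "\<xi> $ 2 \<in> {Lam..Lam+1}")
    case False
    then show ?thesis by (simp add: wave_comb_def w_def)
  next
    case True
    define v where "v = (\<xi> $ 1)\<^sup>2 / Lam\<^sup>2"
    have v: "v \<ge> 0" by (simp add: v_def)
    have xi1: "(\<xi> $ 1)\<^sup>2 = v * Lam\<^sup>2" using l0 by (simp add: v_def)
    have "(\<xi> $ 2)\<^sup>2 \<le> (2 * Lam)\<^sup>2" using True l by (intro power_mono) auto
    moreover have "1 \<le> Lam\<^sup>2" using l by (simp add: one_le_power)
    moreover have "0 \<le> v * Lam\<^sup>2" using v by simp
    ultimately have "1 + (norm \<xi>)\<^sup>2 \<le> 5 * Lam\<^sup>2 * (1 + v)"
      unfolding real2_norm_sq xi1 by (simp add: power_mult_distrib algebra_simps)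
    then have "(1 + (norm \<xi>)\<^sup>2) powr s \<le> (5 * Lam\<^sup>2 * (1 + v)) powr s"
      using s by (intro powr_mono2) auto
    also have "\<dots> = 5 powr s * Lam powr (2 * s) * (1 + v) powr s"
    proof -
      have "(Lam\<^sup>2) powr s = Lam powr (2 * s)" using l0 powr_powr[of Lam 2 s] by simp
      then show ?thesis using v l0 by (simp add: powr_mult)
    qed
    also have "\<dots> \<le> 5 powr 1 * Lam powr (2 * s) * (1 + v) powr 1"
      using s v l by (intro mult_mono powr_mono) auto
    also have "\<dots> = 5 * Lam powr (2 * s) * (1 + v)" using v by simp
    also have "\<dots> \<le> 5 * Lam powr (2 * s) * (2 * exp (v / 2))"
    proof (intro mult_left_mono)
      show "1 + v \<le> 2 * exp (v / 2)" using exp_ge_add_one_self[of "v / 2"] by linarith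
    qed auto
    finally have w: "(1 + (norm \<xi>)\<^sup>2) powr s \<le> 10 * Lam powr (2 * s) * exp (v / 2)" by simp
    have "cmod (wave_comb Lam h M \<xi>) = exp (- (\<xi> $ 1)\<^sup>2 / (2 * Lam\<^sup>2)) / Lam * cmod (comb h M (\<xi> $ 1))"
      unfolding wave_comb_def bump_profile_def using True l0 by (simp add: norm_mult norm_divide)
    moreover have "- (\<xi> $ 1)\<^sup>2 / (2 * Lam\<^sup>2) = - v / 2" by (simp add: v_def)
    ultimately have W: "(cmod (wave_comb Lam h M \<xi>))\<^sup>2 = (exp (- v / 2))\<^sup>2 / Lam\<^sup>2 * (cmod (comb h M (\<xi> $ 1)))\<^sup>2"
      and P: "p (\<xi> $ 1) = exp (- v / 2) * (cmod (comb h M (\<xi> $ 1)))\<^sup>2"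
      unfolding p_def by (simp_all add: power_mult_distrib power_divide)
    have "(1 + (norm \<xi>)\<^sup>2) powr s * (cmod (wave_comb Lam h M \<xi>))\<^sup>2 \<le> (10 * Lam powr (2 * s) * exp (v / 2)) * ((exp (- v / 2))\<^sup>2 / Lam\<^sup>2 * (cmod (comb h M (\<xi> $ 1)))\<^sup>2)"
      unfolding W by (intro mult_right_mono w) auto
    also have "\<dots> = 10 * (Lam powr (2 * s) / Lam\<^sup>2) * ((exp (v / 2) * exp (- v / 2)) * exp (- v / 2)) * (cmod (comb h M (\<xi> $ 1)))\<^sup>2"
      by (simp add: power2_eq_square)
    also have "exp (v / 2) * exp (- v / 2) = 1" by (simp add: exp_add[symmetric])
    also have "Lam powr (2 * s) / Lam\<^sup>2 = Lam powr (2 * s - 2)"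
      using l0 by (simp add: powr_diff powr_numeral)
    finally show ?thesis unfolding P B_def w_def using True by (simp add: mult.assoc)
  qed
  have "sqnorm (bessel_weight s) (wave_comb Lam h M) \<le> (\<integral>\<^sup>+\<xi>. ennreal (B * (p ((\<xi>::real^2) $ 1) * w (\<xi> $ 2))) \<partial>lborel)"
    unfolding sqnorm_bessel_weight[OF wave_comb_measurable] by (intro nn_integral_mono ennreal_leI pt)
  also have "\<dots> = ennreal (LINT \<xi>|lborel. B * (p ((\<xi>::real^2) $ 1) * w (\<xi> $ 2)))"
    by (rule nn_integral_eq_integral) (use I B0 p0 w0 in auto)
  also have "\<dots> \<le> ennreal (B * (18 * Lam * (real M + 1)))"
    using IL B0 by (intro ennreal_leI) (simp add: mult_left_mono)
  also have "B * (18 * Lam * (real M + 1)) = 180 * Lam powr (2 * s - 1) * (real M + 1)"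
  proof -
    have "Lam powr (2 * s - 2) * Lam = Lam powr (2 * s - 1)"
      using powr_add[of Lam "2 * s - 2" 1] l0 by simp
    moreover have "B * (18 * Lam * (real M + 1)) = 180 * (Lam powr (2 * s - 2) * Lam) * (real M + 1)"
      by (simp add: B_def)
    ultimately show ?thesis by simp
  qed
  finally show ?thesis .
qed

section \<open>Small data whose waves cover a box\<close>

lemma gap_pos:
  fixes t :: "nat \<Rightarrow> real"
  assumes t: "\<And>n. 0 < t n" "decseq t" "t \<longlonglongrightarrow> 0" and gaps: "decseq (\<lambda>n. t n - t (Suc n))"
  shows "0 < t n - t (Suc n)"
proof (rule ccontr)
  assume "\<not> ?thesis"
  then have le: "t n \<le> t (Suc n)" by simp
  have "t n \<le> t k" if "k \<ge> n" for k
    using that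
  proof (induction k rule: dec_induct)
    case (step k)
    have "t k - t (Suc k) \<le> t n - t (Suc n)" using decseqD[OF gaps step.hyps(1)] .
    then show ?case using step.IH le by linarith
  qed simp
  then have "t n \<le> 0" by (intro LIMSEQ_le_const[OF t(3)]) auto
  then show False using t(1)[of n] by simp
qed

text \<open>
  Two consecutive times from \<open>n0\<close> on differ by at most \<open>\<delta>\<close>, so that the first time not above \<open>y\<close> is
  close to \<open>y\<close>; below \<open>t N'\<close>, the time \<open>t N'\<close> itself is. Finitely many times suffice, which the
  gliding hump needs.
\<close>

lemma times_cover:
  fixes t :: "nat \<Rightarrow> real"
  assumes t: "\<And>n. 0 < t n" "decseq t" and gaps: "decseq (\<lambda>n. t n - t (Suc n))"
    and \<delta>: "t n0 - t (Suc n0) = \<delta>" and N': "n0 \<le> N'" "t N' \<le> \<delta>"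
    and y: "0 \<le> y" "y \<le> t n0"
  shows "\<exists>n\<in>{n0..N'}. \<bar>t n - y\<bar> \<le> \<delta> \<and> (t n \<le> y \<or> t n \<le> \<delta>)"
proof (cases "y < t N'")
  case True
  then have "\<bar>t N' - y\<bar> \<le> \<delta>" using y N' by simp
  then show ?thesis using N' by (intro bexI[of _ N']) auto
next
  case False
  have ex: "n0 \<le> N' \<and> t N' \<le> y" using False N' by simp
  define n where "n = (LEAST n. n0 \<le> n \<and> t n \<le> y)"
  have n: "n0 \<le> n" "t n \<le> y" using LeastI[of "\<lambda>n. n0 \<le> n \<and> t n \<le> y", OF ex] unfolding n_def by auto
  have nN: "n \<le> N'" unfolding n_def by (rule Least_le[of "\<lambda>n. n0 \<le> n \<and> t n \<le> y", OF ex])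
  have d0: "0 \<le> \<delta>" using \<delta> decseqD[OF t(2), of n0 "Suc n0"] by simp
  have "\<bar>t n - y\<bar> \<le> \<delta>"
  proof (cases "n = n0")
    case True
    then show ?thesis using n y d0 by simp
  next
    case False
    then obtain k where k: "n = Suc k" "n0 \<le> k" using n(1) by (cases n) auto
    have "\<not> (n0 \<le> k \<and> t k \<le> y)" unfolding n_def[symmetric] using not_less_Least[of k "\<lambda>n. n0 \<le> n \<and> t n \<le> y"] k n_def by simp
    then have "y < t k" using k by simp
    moreover have "t k - t (Suc k) \<le> \<delta>" using decseqD[OF gaps k(2)] \<delta> by simp
    ultimately show ?thesis using n k by simp
  qed
  then show ?thesis using n nN by (intro bexI[of _ n]) auto
qed

text \<open>
  Let \<open>\<delta>\<close> be a small gap at \<open>n0\<close> and \<open>L = \<delta> powr (-1/2)\<close>. The spacing \<open>h\<close> of the teeth is the distance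
  \<open>t n0 * L\<close> that the wave travels, but at most \<open>1\<close>: this keeps the relevant times below \<open>1 / L\<close>, so
  that the spread of the speeds over \<open>[L, L + 1]\<close> blurs the wave by at most \<open>1 / L\<close>. The two cases in
  the estimate of the norm are the two values of the minimum; the second one is small by
  \<open>s < 1/2\<close>.
\<close>

lemma wave_comb_covering:
  fixes s :: real and t :: "nat \<Rightarrow> real"
  assumes s: "0 < s" "s < 1/2" and t: "\<And>n. 0 < t n" "\<And>n. t n < 1" "decseq t" "t \<longlonglongrightarrow> 0"
    and gaps: "decseq (\<lambda>n. t n - t (Suc n))"
    and nw: "t \<notin> weak_lspace (s / (1 - s))" and e: "e > 0"
  obtains G n0 N' where "G \<in> borel_measurable borel" "integrable lborel G" "sqnorm (bessel_weight s) G \<le> ennreal e"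
    "N \<le> n0" "n0 \<le> N'"
    "\<And>x::real^2. 0 \<le> x $ 1 \<Longrightarrow> x $ 1 \<le> 1 \<Longrightarrow> \<bar>x $ 2\<bar> \<le> 1 \<Longrightarrow>
       \<exists>n\<in>{n0..N'}. cos 1 * exp (-2) \<le> cmod (FT 1 (modulate (t n) G) x)"
proof -
  define r where "r = s / (1 - s)"
  have r: "r > 0" using s by (simp add: r_def)
  \<comment> \<open>The norm will be at most \<open>540 * c powr (1/2 - s)\<close>.\<close>
  define c where "c = min 1 ((e / 540) powr (1 / (1/2 - s)))"
  have c: "0 < c" "c \<le> 1" using e by (auto simp: c_def)
  have ce: "540 * c powr (1/2 - s) \<le> e"
  proof -
    have "c powr (1/2 - s) \<le> ((e / 540) powr (1 / (1/2 - s))) powr (1/2 - s)"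
      using c s by (intro powr_mono2) (auto simp: c_def)
    also have "\<dots> = e / 540" using s e by (simp add: powr_powr)
    finally show ?thesis by simp
  qed
  obtain n0 where n0: "N \<le> n0" and gap: "t n0 - t (Suc n0) < c * t n0 powr (1 + r)"
    using exists_small_gap[OF t(1-3) r nw[folded r_def] c(1)] by blast
  define \<delta> where "\<delta> = t n0 - t (Suc n0)"
  define b where "b = t n0"
  have d0: "\<delta> > 0" unfolding \<delta>_def by (rule gap_pos[OF t(1,3,4) gaps])
  have b: "0 < b" "b < 1" unfolding b_def using t by auto
  have db: "\<delta> \<le> b" unfolding \<delta>_def b_def using t(1)[of "Suc n0"] by simp
  have dc: "\<delta> < c * b powr (1 + r)" using gap unfolding \<delta>_def b_def .
  define L where "L = \<delta> powr (- (1/2))"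
  have L0: "L > 0" unfolding L_def using d0 by simp
  \<comment> \<open>The wave moves by \<open>\<delta> * L = 1 / L\<close>, the width of a tooth, during a time \<open>\<delta>\<close>.\<close>
  have LL: "\<delta> * L * L = 1"
  proof -
    have "L * L = \<delta> powr (-1)" unfolding L_def by (simp add: powr_add[symmetric])
    then show ?thesis using d0 by (simp add: powr_minus mult.assoc)
  qed
  have L1: "L \<ge> 1"
  proof -
    have "\<delta> powr 0 \<le> \<delta> powr (- (1/2))" using d0 db b by (intro powr_mono') auto
    then show ?thesis using d0 by (simp add: L_def)
  qed
  define h where "h = min (b * L) 1"
  have h: "0 < h" "h \<le> 1" "h \<le> b * L" unfolding h_def using b L0 by auto
  have hL: "h * L \<ge> 1"
  proof (cases "b * L \<le> 1")
    case True
    have "1 = \<delta> * L * L" using LL by simp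
    also have "\<dots> \<le> b * L * L" using db L0 by (intro mult_right_mono) auto
    finally show ?thesis using True by (simp add: h_def)
  next
    case False
    then show ?thesis using L1 by (simp add: h_def)
  qed
  define M where "M = nat \<lceil>1 / h\<rceil>"
  have M1: "1 / h \<le> real M" "real M + 1 \<le> 3 / h"
  proof -
    have "0 \<le> 1 / h" using h by simp
    then show "1 / h \<le> real M" unfolding M_def by linarith
    have "real M \<le> 1 / h + 1" unfolding M_def using \<open>0 \<le> 1 / h\<close> by linarith
    moreover have "1 \<le> 1 / h" using h by simp
    moreover have "3 / h = 1 / h + 1 / h + 1 / h" by simp
    ultimately show "real M + 1 \<le> 3 / h" by linarith
  qed
  define G where "G = wave_comb L h M"
  have nrm: "180 * L powr (2 * s - 1) * (real M + 1) \<le> e"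
  proof -
    have "L powr (2 * s - 1) \<le> c powr (1/2 - s) * h"
    proof (cases "b * L \<le> 1")
      case True
      have "(1 + r) * (1 - s) = 1" using s by (simp add: r_def field_simps)
      have "L powr (2 * s - 1) = L powr (2 * s - 2) * L"
        using powr_add[of L "2 * s - 2" 1] L0 by simp
      also have "L powr (2 * s - 2) = \<delta> powr (1 - s)"
      proof -
        have "- (1/2) * (2 * s - 2) = 1 - s" by (simp add: field_simps)
        then show ?thesis unfolding L_def powr_powr by (rule arg_cong)
      qed
      also have "\<delta> powr (1 - s) \<le> (c * b powr (1 + r)) powr (1 - s)"
        using dc d0 s by (intro powr_mono2) auto
      also have "\<dots> = c powr (1 - s) * b"
        using c b \<open>(1 + r) * (1 - s) = 1\<close> by (simp add: powr_mult powr_powr)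
      also have "c powr (1 - s) * b \<le> c powr (1/2 - s) * b"
        using c b by (intro mult_right_mono powr_mono') auto
      finally have "L powr (2 * s - 1) \<le> c powr (1/2 - s) * b * L" using L0 by (simp add: mult_right_mono)
      then show ?thesis using True by (simp add: h_def mult.assoc)
    next
      case False
      have "L powr (2 * s - 1) = \<delta> powr (1/2 - s)"
      proof -
        have "- (1/2) * (2 * s - 1) = 1/2 - s" by (simp add: field_simps)
        then show ?thesis unfolding L_def powr_powr by (rule arg_cong)
      qed
      also have "\<dots> \<le> c powr (1/2 - s)"
      proof (intro powr_mono2)
        have "b powr (1 + r) \<le> 1" using b r by (intro powr_le1) auto
        then have "c * b powr (1 + r) \<le> c" using c mult_left_mono[of "b powr (1 + r)" 1 c] by simp
        then show "\<delta> \<le> c" using dc by simp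
      qed (use s d0 in auto)
      finally show ?thesis using False by (simp add: h_def)
    qed
    then have "180 * L powr (2 * s - 1) * (real M + 1) \<le> 180 * (c powr (1/2 - s) * h) * (3 / h)"
      using M1 h by (intro mult_mono) auto
    also have "\<dots> = 540 * c powr (1/2 - s)" using h by simp
    finally show ?thesis using ce by linarith
  qed
  have "\<forall>\<^sub>F n in sequentially. t n < \<delta>" by (rule order_tendstoD(2)[OF t(4) d0])
  then obtain N1 where N1: "\<And>n. n \<ge> N1 \<Longrightarrow> t n < \<delta>" by (auto simp: eventually_sequentially)
  define N' where "N' = max n0 N1"
  have N': "n0 \<le> N'" "t N' \<le> \<delta>" using N1[of N'] by (auto simp: N'_def)
  show thesis
  proof (rule that[of G n0 N'])
    show "G \<in> borel_measurable borel" unfolding G_def by simp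
    show "integrable lborel G" unfolding G_def by (rule integrable_wave_comb[OF L0])
    have "sqnorm (bessel_weight s) G \<le> ennreal (180 * L powr (2 * s - 1) * (real M + 1))"
      unfolding G_def by (rule sqnorm_wave_comb) (use s L1 hL in auto)
    also have "\<dots> \<le> ennreal e" by (rule ennreal_leI[OF nrm])
    finally show "sqnorm (bessel_weight s) G \<le> ennreal e" .
    show "N \<le> n0" "n0 \<le> N'" by fact+
    fix x :: "real^2" assume x: "0 \<le> x $ 1" "x $ 1 \<le> 1" "\<bar>x $ 2\<bar> \<le> 1"
    define m where "m = nat \<lceil>x $ 1 / h\<rceil>"
    have xh: "0 \<le> x $ 1 / h" using x h by simp
    have mM: "m \<le> M" unfolding m_def M_def using x h by (intro nat_mono ceiling_mono divide_right_mono) auto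
    have m1: "x $ 1 / h \<le> real m" "real m \<le> x $ 1 / h + 1" unfolding m_def using xh by linarith+
    define y where "y = (real m * h - x $ 1) / L"
    have my: "0 \<le> real m * h - x $ 1" "real m * h - x $ 1 \<le> h"
      using m1 h by (simp_all add: field_simps)
    have y: "0 \<le> y" "y \<le> t n0"
    proof -
      show "0 \<le> y" unfolding y_def using my L0 by simp
      have "y \<le> (b * L) / L" unfolding y_def using my h(3) L0 by (intro divide_right_mono) auto
      then show "y \<le> t n0" using L0 by (simp add: b_def)
    qed
    have yL': "L * y = real m * h - x $ 1" unfolding y_def using L0 by simp
    have yL: "y \<le> 1 / L" unfolding y_def using my h(2) L0 by (intro divide_right_mono) auto
    obtain n where n: "n \<in> {n0..N'}" "\<bar>t n - y\<bar> \<le> \<delta>" "t n \<le> y \<or> t n \<le> \<delta>"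
      using times_cover[OF t(1,3) gaps \<delta>_def[symmetric] N' y] by blast
    have dL: "\<delta> * L = 1 / L" using LL L0 by (simp add: field_simps)
    have "\<delta> \<le> \<delta> * L" using L1 d0 by simp
    then have tL: "t n \<le> 1 / L" using n(3) yL dL by linarith
    have "cos 1 * exp (-2) \<le> cmod (FT 1 (modulate (t n) G) x)"
      unfolding G_def
    proof (rule FT_modulate_wave_comb_lower[OF L1 x(3) mM])
      fix v assume v: "v \<in> {L..L+1}"
      have "x $ 1 + t n * v - real m * h = L * (t n - y) + t n * (v - L)"
        using yL' by (simp add: algebra_simps)
      also have "\<bar>\<dots>\<bar> \<le> \<bar>L * (t n - y)\<bar> + \<bar>t n * (v - L)\<bar>" by (rule abs_triangle_ineq)
      also have "\<bar>L * (t n - y)\<bar> \<le> L * \<delta>" using n(2) L0 by (simp add: abs_mult)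
      also have "\<bar>t n * (v - L)\<bar> \<le> 1 / L * 1"
        unfolding abs_mult using tL v t(1)[of n] L0 by (intro mult_mono) auto
      finally show "\<bar>x $ 1 + t n * v - real m * h\<bar> \<le> 2 / L" using dL by (simp add: mult.commute)
    qed
    then show "\<exists>n\<in>{n0..N'}. cos 1 * exp (-2) \<le> cmod (FT 1 (modulate (t n) G) x)" using n(1) by blast
  qed
qed

section \<open>The gliding hump\<close>

text \<open>
  A representative of the difference between the solution at time \<open>\<tau>\<close> and its datum.
\<close>

definition time_incr :: "real \<Rightarrow> (real^2 \<Rightarrow> complex) \<Rightarrow> real^2 \<Rightarrow> complex" where
  "time_incr \<tau> G = (SOME v. is_FT 1 (\<lambda>\<xi>. modulate \<tau> G \<xi> - G \<xi>) v)"

lemma cmod_modulate_minus_le: "cmod (modulate \<tau> G \<xi> - G \<xi>) \<le> 2 * cmod (G \<xi>)"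
  using norm_triangle_ineq4[of "modulate \<tau> G \<xi>" "G \<xi>"] by simp

lemma sqnorm_modulate_minus_le:
  assumes [measurable]: "G \<in> borel_measurable borel"
  shows "sqnorm lborel (\<lambda>\<xi>. modulate \<tau> G \<xi> - G \<xi>) \<le> 4 * sqnorm lborel G"
proof -
  have "sqnorm lborel (\<lambda>\<xi>. modulate \<tau> G \<xi> - G \<xi>) \<le> sqnorm lborel (\<lambda>\<xi>. 2 * G \<xi>)"
    by (rule sqnorm_mono) (use cmod_modulate_minus_le in \<open>auto simp: norm_mult\<close>)
  also have "\<dots> = ennreal 4 * sqnorm lborel G" by (subst sqnorm_cmult) auto
  finally show ?thesis by simp
qed

lemma is_FT_time_incr:
  assumes [measurable]: "G \<in> borel_measurable borel" and fin: "sqnorm lborel G < \<infinity>"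
  shows "is_FT 1 (\<lambda>\<xi>. modulate \<tau> G \<xi> - G \<xi>) (time_incr \<tau> G)"
proof -
  have "sqnorm lborel (\<lambda>\<xi>. modulate \<tau> G \<xi> - G \<xi>) < \<infinity>"
    using sqnorm_modulate_minus_le[OF assms(1), of \<tau>] fin
    by (auto simp: ennreal_mult_less_top elim!: le_less_trans)
  then have "\<exists>v. is_FT 1 (\<lambda>\<xi>. modulate \<tau> G \<xi> - G \<xi>) v" by (intro is_FT_exists) auto
  then show ?thesis unfolding time_incr_def by (rule someI_ex)
qed

lemma time_incr_eq:
  assumes g: "is_FT 1 (modulate \<tau> G) p" "is_FT 1 G f"
  shows "AE x in lborel. time_incr \<tau> G x = p x - f x"
  by (rule is_FT_unique[OF _ is_FT_time_incr[OF is_FT_D(1,2)[OF g(2)]] is_FT_diff[OF g]]) simp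

lemma time_incr_lipschitz:
  assumes [measurable]: "G \<in> borel_measurable borel" "G' \<in> borel_measurable borel"
    and fin: "sqnorm lborel G < \<infinity>" "sqnorm lborel G' < \<infinity>"
  shows "sqnorm lborel (\<lambda>x. time_incr \<tau> G x - time_incr \<tau> G' x) \<le> ennreal (8 * (2*pi)\<^sup>2) * sqnorm lborel (\<lambda>\<xi>. G \<xi> - G' \<xi>)"
proof -
  define H where "H \<xi> = G \<xi> - G' \<xi>" for \<xi>
  have [measurable]: "H \<in> borel_measurable borel" unfolding H_def by measurable
  have eq: "(\<lambda>\<xi>. (modulate \<tau> G \<xi> - G \<xi>) - (modulate \<tau> G' \<xi> - G' \<xi>)) = (\<lambda>\<xi>. modulate \<tau> H \<xi> - H \<xi>)"
    unfolding H_def modulate_def by (simp add: algebra_simps)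
  have "sqnorm lborel (\<lambda>x. time_incr \<tau> G x - time_incr \<tau> G' x) \<le> ennreal (2 * (2*pi)\<^sup>2) * sqnorm lborel (\<lambda>\<xi>. modulate \<tau> H \<xi> - H \<xi>)"
    using is_FT_bound[OF _ is_FT_diff[OF is_FT_time_incr[OF assms(1) fin(1), of \<tau>] is_FT_time_incr[OF assms(2) fin(2), of \<tau>]]]
    unfolding eq by simp
  also have "\<dots> \<le> ennreal (2 * (2*pi)\<^sup>2) * (ennreal 4 * sqnorm lborel H)"
    using sqnorm_modulate_minus_le[of H \<tau>] by (intro mult_left_mono) auto
  also have "\<dots> = ennreal (2 * (2*pi)\<^sup>2 * 4) * sqnorm lborel H"
    by (subst mult.assoc[symmetric], subst ennreal_mult[symmetric]) auto
  also have "2 * (2*pi)\<^sup>2 * 4 = 8 * (2*pi)\<^sup>2" by simp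
  finally show ?thesis unfolding H_def .
qed

lemma Chebyshev_sqnorm:
  assumes [measurable]: "f \<in> borel_measurable M" and a: "a > 0"
  shows "emeasure M {x\<in>space M. a \<le> cmod (f x)} \<le> ennreal (1 / a\<^sup>2) * sqnorm M f"
proof -
  have "emeasure M {x\<in>space M. a \<le> cmod (f x)} = (\<integral>\<^sup>+x. indicator {x\<in>space M. a \<le> cmod (f x)} x \<partial>M)"
    by simp
  also have "\<dots> \<le> (\<integral>\<^sup>+x. ennreal (1 / a\<^sup>2) * ennreal ((cmod (f x))\<^sup>2) \<partial>M)"
  proof (rule nn_integral_mono)
    fix x
    show "indicator {x\<in>space M. a \<le> cmod (f x)} x \<le> ennreal (1 / a\<^sup>2) * ennreal ((cmod (f x))\<^sup>2)"
    proof (cases "a \<le> cmod (f x)")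
      case True
      then have "a\<^sup>2 \<le> (cmod (f x))\<^sup>2" using a by (intro power_mono) auto
      then have "1 \<le> 1 / a\<^sup>2 * (cmod (f x))\<^sup>2" using a by (simp add: field_simps)
      then have "ennreal 1 \<le> ennreal (1 / a\<^sup>2 * (cmod (f x))\<^sup>2)" by (rule ennreal_leI)
      also have "\<dots> = ennreal (1 / a\<^sup>2) * ennreal ((cmod (f x))\<^sup>2)" by (rule ennreal_mult) auto
      finally show ?thesis by (auto simp: indicator_def)
    qed simp
  qed
  also have "\<dots> = ennreal (1 / a\<^sup>2) * sqnorm M f"
    unfolding sqnorm_def by (rule nn_integral_cmult) measurable
  finally show ?thesis .
qed

text \<open>
  The sets decrease with \<open>m\<close> to a null set inside a set of finite measure.
\<close>

lemma Egorov_tail: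
  fixes v :: "nat \<Rightarrow> 'a \<Rightarrow> complex"
  assumes [measurable]: "\<And>n. v n \<in> borel_measurable M" "Q \<in> sets M" and Q: "emeasure M Q < \<infinity>"
    and conv: "AE x in M. (\<lambda>n. v n x) \<longlonglongrightarrow> 0" and a: "a > 0" and e: "e > (0::real)"
  obtains n1 where "\<And>m. m \<ge> n1 \<Longrightarrow> emeasure M {x\<in>Q. \<exists>n\<ge>m. a \<le> cmod (v n x)} \<le> ennreal e"
proof -
  have Qs: "x \<in> space M" if "x \<in> Q" for x using sets.sets_into_space[OF assms(2)] that by auto
  define B where "B m = {x\<in>Q. \<exists>n\<ge>m. a \<le> cmod (v n x)}" for m
  have Beq: "B m = Q \<inter> {x\<in>space M. \<exists>n\<in>{m..}. a \<le> cmod (v n x)}" for m unfolding B_def using Qs by auto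
  have Bm: "B m \<in> sets M" for m unfolding Beq by measurable
  have dec: "decseq B" unfolding B_def decseq_def by (auto intro: order_trans)
  have "emeasure M (B m) \<le> emeasure M Q" for m by (rule emeasure_mono) (auto simp: B_def)
  then have finB: "emeasure M (B m) \<noteq> \<infinity>" for m using Q by (metis le_less_trans less_irrefl)
  have lim: "(\<lambda>m. emeasure M (B m)) \<longlonglongrightarrow> emeasure M (\<Inter>m. B m)"
    using Lim_emeasure_decseq[OF _ dec, of M] Bm finB by auto
  have "emeasure M (\<Inter>m. B m) = 0"
  proof -
    have "AE x in M. x \<notin> (\<Inter>m. B m)"
      using conv
    proof eventually_elim
      case (elim x)
      then have "\<forall>\<^sub>F n in sequentially. dist (v n x) 0 < a" by (rule tendstoD) (rule a)
      then obtain k where k: "\<And>n. n \<ge> k \<Longrightarrow> cmod (v n x) < a" by (auto simp: eventually_sequentially)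
      have "x \<notin> B k"
      proof
        assume "x \<in> B k"
        then obtain n where "n \<ge> k" "a \<le> cmod (v n x)" unfolding B_def by auto
        then show False using k[of n] by simp
      qed
      then show ?case by auto
    qed
    then have "emeasure M {x\<in>space M. x \<in> (\<Inter>m. B m)} = 0" by (rule emeasure_eq_0_AE)
    moreover have "{x\<in>space M. x \<in> (\<Inter>m. B m)} = (\<Inter>m. B m)"
      using Qs unfolding B_def by auto
    ultimately show ?thesis by simp
  qed
  then have "(\<lambda>m. emeasure M (B m)) \<longlonglongrightarrow> 0" using lim by simp
  from ennreal_tendsto_0D[OF this e] show thesis
    using that unfolding eventually_sequentially B_def by blast
qed

definition test_box :: "(real^2) set" where
  "test_box = cbox (vector [0, -1]) (vector [1, 1])"

lemma mem_test_box: "x \<in> test_box \<longleftrightarrow> 0 \<le> x $ 1 \<and> x $ 1 \<le> 1 \<and> \<bar>x $ 2\<bar> \<le> 1"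
  by (auto simp: test_box_def mem_box_cart forall_2 abs_le_iff)

lemma test_box_borel [measurable]: "test_box \<in> sets borel"
  by (simp add: test_box_def)

lemma emeasure_test_box: "emeasure lborel test_box = ennreal 2"
proof -
  define l u :: "real^2" where "l = vector [0, -1]" and "u = vector [1, 1]"
  have lu: "(u - l) \<bullet> axis 1 1 = 1" "(u - l) \<bullet> axis 2 1 = 2"
    by (simp_all add: l_def u_def inner_axis)
  have B: "(Basis :: (real^2) set) = {axis 1 1, axis 2 1}"
    by (auto simp: Basis_vec_def UNIV_2)
  have "emeasure lborel (cbox l u) = ennreal (\<Prod>b\<in>Basis. (u - l) \<bullet> b)"
    by (rule emeasure_lborel_cbox) (auto simp: B l_def u_def inner_axis)
  also have "(\<Prod>b\<in>Basis. (u - l) \<bullet> b) = 2"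
    unfolding B by (subst prod.insert) (auto simp: lu axis_eq_axis)
  finally show ?thesis unfolding test_box_def l_def u_def .
qed

text \<open>
  The lower bound of \<open>FT_modulate_wave_comb_lower\<close>.
\<close>

definition hump_level :: real where
  "hump_level = cos 1 * exp (-2)"

lemma hump_level_pos: "hump_level > 0"
  unfolding hump_level_def using pi_gt3 by (simp add: cos_gt_zero_pi)

text \<open>
  This bounds the distance between two partial sums of a series by the later terms alone, which
  the total sum in \<open>Riesz_Fischer\<close> does not give.
\<close>

lemma sqnorm_block_le:
  fixes d :: "nat \<Rightarrow> 'a \<Rightarrow> complex"
  assumes [measurable]: "\<And>k. d k \<in> borel_measurable M"
  shows "sqnorm M (\<lambda>x. \<Sum>k=K..<L. d k x) \<le> ennreal (2 * (1/2)^K) * (\<Sum>k=K..<L. ennreal (2 ^ k) * sqnorm M (d k))"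
proof -
  have "sqnorm M (\<lambda>x. \<Sum>k=K..<L. d k x) \<le> (\<integral>\<^sup>+x. ennreal (2 * (1/2)^K) * (\<Sum>k=K..<L. ennreal (2 ^ k) * ennreal ((cmod (d k x))\<^sup>2)) \<partial>M)"
    unfolding sqnorm_def
  proof (rule nn_integral_mono)
    fix x
    have "(cmod (\<Sum>k=K..<L. d k x))\<^sup>2 \<le> (\<Sum>k=K..<L. 1 / 2^k) * (\<Sum>k=K..<L. 2^k * (cmod (d k x))\<^sup>2)"
      by (rule cmod_sum_sq_weighted_le) auto
    also have "\<dots> \<le> (2 * (1/2)^K) * (\<Sum>k=K..<L. 2^k * (cmod (d k x))\<^sup>2)"
      by (intro mult_right_mono sum_half_powers_le) (auto intro: sum_nonneg)
    finally have "ennreal ((cmod (\<Sum>k=K..<L. d k x))\<^sup>2) \<le> ennreal ((2 * (1/2)^K) * (\<Sum>k=K..<L. 2^k * (cmod (d k x))\<^sup>2))"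
      by (rule ennreal_leI)
    also have "\<dots> = ennreal (2 * (1/2)^K) * ennreal (\<Sum>k=K..<L. 2^k * (cmod (d k x))\<^sup>2)"
      by (rule ennreal_mult) (auto intro: sum_nonneg)
    also have "ennreal (\<Sum>k=K..<L. 2^k * (cmod (d k x))\<^sup>2) = (\<Sum>k=K..<L. ennreal (2 ^ k) * ennreal ((cmod (d k x))\<^sup>2))"
      by (subst sum_ennreal[symmetric]) (auto simp: ennreal_mult)
    finally show "ennreal ((cmod (\<Sum>k=K..<L. d k x))\<^sup>2) \<le> ennreal (2 * (1/2)^K) * (\<Sum>k=K..<L. ennreal (2 ^ k) * ennreal ((cmod (d k x))\<^sup>2))" .
  qed
  also have "\<dots> = ennreal (2 * (1/2)^K) * (\<Sum>k=K..<L. ennreal (2 ^ k) * sqnorm M (d k))"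
    unfolding sqnorm_def by (simp add: nn_integral_cmult nn_integral_sum del: sum_ennreal)
  finally show ?thesis .
qed

text \<open>
  To be refuted: convergence holds for all data of finite Sobolev norm, but the sequence is not in
  the weak space.
\<close>

context
  fixes s :: real and t :: "nat \<Rightarrow> real"
  assumes s: "0 < s" "s < 1/2"
    and t: "\<And>n. 0 < t n" "\<And>n. t n < 1" "decseq t" "t \<longlonglongrightarrow> 0"
    and gaps: "decseq (\<lambda>n. t n - t (Suc n))"
    and conv: "\<And>G P f. G \<in> borel_measurable borel \<Longrightarrow> sqnorm (bessel_weight s) G < \<infinity> \<Longrightarrow>
      (\<And>n. is_FT 1 (modulate (t n) G) (P n)) \<Longrightarrow> is_FT 1 G f \<Longrightarrow> AE x in lborel. (\<lambda>n. P n x) \<longlonglongrightarrow> f x"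
    and nw: "t \<notin> weak_lspace (s / (1 - s))"
begin

lemma L2_of_weighted:
  assumes "G \<in> borel_measurable borel" "sqnorm (bessel_weight s) G < \<infinity>"
  shows "sqnorm lborel G < \<infinity>"
  using sqnorm_le_bessel_weight[OF assms(1), of s] assms(2) s by (auto elim: le_less_trans)

lemma time_incr_tendsto_0:
  assumes [measurable]: "G \<in> borel_measurable borel" and fin: "sqnorm (bessel_weight s) G < \<infinity>"
  shows "AE x in lborel. (\<lambda>n. time_incr (t n) G x) \<longlonglongrightarrow> 0"
proof -
  have fl: "sqnorm lborel G < \<infinity>" by (rule L2_of_weighted[OF assms])
  obtain f where f: "is_FT 1 G f" using is_FT_exists[of 1 G] fl by auto
  have "\<forall>n. \<exists>p. is_FT 1 (modulate (t n) G) p" using fl by (intro allI is_FT_exists) auto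
  then obtain P where P: "\<And>n. is_FT 1 (modulate (t n) G) (P n)" by metis
  have "AE x in lborel. \<forall>n. time_incr (t n) G x = P n x - f x"
    unfolding AE_all_countable by (intro allI time_incr_eq P f)
  with conv[OF assms P f] show ?thesis
  proof eventually_elim
    case (elim x)
    then have "(\<lambda>n. P n x - f x) \<longlonglongrightarrow> f x - f x" by (intro tendsto_intros) auto
    then show ?case using elim by simp
  qed
qed

lemma time_incr_measurable:
  assumes "G \<in> borel_measurable borel" "sqnorm (bessel_weight s) G < \<infinity>"
  shows "time_incr \<tau> G \<in> borel_measurable borel"
  by (rule is_FT_D(3)[OF is_FT_time_incr[OF assms(1) L2_of_weighted[OF assms]]])

text \<open>
  Add to \<open>G\<close> a travelling comb \<open>F\<close> that acts only at times so late that the solution with datum \<open>G\<close> has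
  already converged on most of the box. The comb itself is small in \<open>L2\<close>, hence small at time \<open>0\<close>
  outside a small set, and there its wave is a deviation of size \<open>hump_level\<close> at some time.
\<close>

lemma hump_step:
  assumes G [measurable]: "G \<in> borel_measurable borel" and fin: "sqnorm (bessel_weight s) G < \<infinity>" and e: "e > 0"
  shows "\<exists>G' N'. G' \<in> borel_measurable borel \<and> sqnorm (bessel_weight s) G' < \<infinity> \<and> N < N' \<and>
    sqnorm (bessel_weight s) (\<lambda>\<xi>. G' \<xi> - G \<xi>) \<le> ennreal e \<and>
    emeasure lborel {x\<in>test_box. \<forall>n\<in>{N..N'}. cmod (time_incr (t n) G' x) < hump_level / 2} \<le> ennreal e"
proof -
  define a where "a = hump_level / 4"
  have a: "a > 0" using hump_level_pos by (simp add: a_def)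
  have fl: "sqnorm lborel G < \<infinity>" by (rule L2_of_weighted[OF G fin])
  note tm [measurable] = time_incr_measurable[OF G fin]
  obtain n1 where n1: "\<And>m. m \<ge> n1 \<Longrightarrow> emeasure lborel {x\<in>test_box. \<exists>n\<ge>m. a \<le> cmod (time_incr (t n) G x)} \<le> ennreal (e / 2)"
  proof (rule Egorov_tail[where Q = test_box, OF _ _ _ time_incr_tendsto_0[OF G fin] a])
    show "0 < e / 2" using e by simp
  qed (auto simp: emeasure_test_box test_box_borel tm)
  \<comment> \<open>\<open>B * e'\<close> bounds the measure of the set where the comb exceeds \<open>a\<close> at time \<open>0\<close>.\<close>
  define B where "B = 2 * (2*pi)\<^sup>2 / a\<^sup>2"
  have B: "B > 0" using a by (simp add: B_def)
  define e' where "e' = min e (e / 2 / B)"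
  have e': "e' > 0" "e' \<le> e" "B * e' \<le> e / 2"
  proof -
    show "e' > 0" using e B by (simp add: e'_def)
    show "e' \<le> e" by (simp add: e'_def)
    have "B * e' \<le> B * (e / 2 / B)" using B by (intro mult_left_mono) (auto simp: e'_def)
    then show "B * e' \<le> e / 2" using B by simp
  qed
  obtain F n0 N' where F [measurable]: "F \<in> borel_measurable borel" and iF: "integrable lborel F"
    and nF: "sqnorm (bessel_weight s) F \<le> ennreal e'" and N0: "max N n1 \<le> n0" "n0 \<le> N'"
    and cov: "\<And>x::real^2. 0 \<le> x $ 1 \<Longrightarrow> x $ 1 \<le> 1 \<Longrightarrow> \<bar>x $ 2\<bar> \<le> 1 \<Longrightarrow>
       \<exists>n\<in>{n0..N'}. cos 1 * exp (-2) \<le> cmod (FT 1 (modulate (t n) F) x)"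
    using wave_comb_covering[OF s t gaps nw e'(1), where N = "max N n1"] by metis
  have finF: "sqnorm (bessel_weight s) F < \<infinity>" using nF by (rule le_less_trans) simp
  have flF: "sqnorm lborel F < \<infinity>" by (rule L2_of_weighted[OF F finF])
  have isF: "is_FT 1 F (FT 1 F)" by (rule is_FT_integrable[OF _ iF flF]) simp
  have isFn: "is_FT 1 (modulate \<tau> F) (FT 1 (modulate \<tau> F))" for \<tau>
  proof (rule is_FT_integrable)
    show "integrable lborel (modulate \<tau> F)"
      unfolding modulate_def[abs_def] by (intro integrable_cis_mult iF) measurable
  qed (use flF in auto)
  define G' where "G' \<xi> = G \<xi> + F \<xi>" for \<xi>
  have G' [measurable]: "G' \<in> borel_measurable borel" unfolding G'_def by measurable
  have finG': "sqnorm (bessel_weight s) G' < \<infinity>"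
  proof -
    have "sqnorm (bessel_weight s) G' \<le> 2 * sqnorm (bessel_weight s) G + 2 * sqnorm (bessel_weight s) F"
      unfolding G'_def by (rule sqnorm_add_le) measurable
    also have "\<dots> < \<infinity>" using fin finF by (simp add: ennreal_mult_less_top)
    finally show ?thesis .
  qed
  have add: "AE x in lborel. \<forall>n. time_incr (t n) G' x = time_incr (t n) G x + (FT 1 (modulate (t n) F) x - FT 1 F x)"
    unfolding AE_all_countable
  proof
    fix n
    have "is_FT 1 (\<lambda>\<xi>. (modulate (t n) G \<xi> - G \<xi>) + 1 * (modulate (t n) F \<xi> - F \<xi>))
      (\<lambda>x. time_incr (t n) G x + 1 * (FT 1 (modulate (t n) F) x - FT 1 F x))"
      by (rule is_FT_lincomb[OF is_FT_time_incr[OF G fl] is_FT_diff[OF isFn isF]])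
    moreover have "(\<lambda>\<xi>. (modulate (t n) G \<xi> - G \<xi>) + 1 * (modulate (t n) F \<xi> - F \<xi>)) = (\<lambda>\<xi>. modulate (t n) G' \<xi> - G' \<xi>)"
      unfolding G'_def modulate_def by (simp add: algebra_simps)
    ultimately have "is_FT 1 (\<lambda>\<xi>. modulate (t n) G' \<xi> - G' \<xi>) (\<lambda>x. time_incr (t n) G x + (FT 1 (modulate (t n) F) x - FT 1 F x))"
      by simp
    then show "AE x in lborel. time_incr (t n) G' x = time_incr (t n) G x + (FT 1 (modulate (t n) F) x - FT 1 F x)"
      by (intro is_FT_unique[OF _ is_FT_time_incr[OF G' L2_of_weighted[OF G' finG']]]) auto
  qed
  define B1 where "B1 = {x\<in>test_box. \<exists>n\<ge>n0. a \<le> cmod (time_incr (t n) G x)}"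
  define B2 where "B2 = {x\<in>space lborel. a \<le> cmod (FT 1 F x)}"
  have B1eq: "B1 = test_box \<inter> {x\<in>space borel. \<exists>n\<in>{n0..}. a \<le> cmod (time_incr (t n) G x)}" unfolding B1_def by auto
  have Bs: "B1 \<in> sets lborel" "B2 \<in> sets lborel"
    unfolding B1eq B2_def by measurable
  have b1: "emeasure lborel B1 \<le> ennreal (e / 2)" unfolding B1_def by (rule n1) (use N0 in simp)
  have b2: "emeasure lborel B2 \<le> ennreal (e / 2)"
  proof -
    have "emeasure lborel B2 \<le> ennreal (1 / a\<^sup>2) * sqnorm lborel (FT 1 F)"
      unfolding B2_def by (rule Chebyshev_sqnorm[OF _ a]) measurable
    also have "\<dots> \<le> ennreal (1 / a\<^sup>2) * (ennreal (2 * (2*pi)\<^sup>2) * ennreal e')"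
    proof (intro mult_left_mono)
      have "sqnorm lborel (FT 1 F) \<le> ennreal (2 * (2*pi)\<^sup>2) * sqnorm lborel F" by (rule is_FT_bound[OF _ isF]) simp
      also have "\<dots> \<le> ennreal (2 * (2*pi)\<^sup>2) * ennreal e'"
        using sqnorm_le_bessel_weight[OF F, of s] nF s by (intro mult_left_mono) auto
      finally show "sqnorm lborel (FT 1 F) \<le> ennreal (2 * (2*pi)\<^sup>2) * ennreal e'" .
    qed simp
    also have "\<dots> = ennreal (1 / a\<^sup>2 * (2 * (2*pi)\<^sup>2 * e'))"
      using e'(1) a by (simp only: ennreal_mult[symmetric] zero_le_power2 mult_nonneg_nonneg zero_le_numeral less_imp_le divide_nonneg_nonneg zero_le_one)
    also have "1 / a\<^sup>2 * (2 * (2*pi)\<^sup>2 * e') = B * e'" unfolding B_def by simp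
    also have "ennreal (B * e') \<le> ennreal (e / 2)" by (rule ennreal_leI[OF e'(3)])
    finally show ?thesis .
  qed
  have "emeasure lborel {x\<in>test_box. \<forall>n\<in>{N..Suc N'}. cmod (time_incr (t n) G' x) < hump_level / 2} \<le> emeasure lborel (B1 \<union> B2)"
  proof (rule emeasure_mono_AE)
    show "AE x in lborel. x \<in> {x\<in>test_box. \<forall>n\<in>{N..Suc N'}. cmod (time_incr (t n) G' x) < hump_level / 2} \<longrightarrow> x \<in> B1 \<union> B2"
      using add
    proof eventually_elim
      case (elim x)
      show ?case
      proof (rule impI, rule ccontr)
        assume x: "x \<in> {x\<in>test_box. \<forall>n\<in>{N..Suc N'}. cmod (time_incr (t n) G' x) < hump_level / 2}" and nb: "x \<notin> B1 \<union> B2"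
        then have xb: "x \<in> test_box" by simp
        then obtain n where n: "n \<in> {n0..N'}" "hump_level \<le> cmod (FT 1 (modulate (t n) F) x)"
          using cov[of x] unfolding mem_test_box hump_level_def by auto
        have "n \<in> {N..Suc N'}" using n N0 by auto
        then have lt: "cmod (time_incr (t n) G' x) < hump_level / 2" using x by auto
        have "\<not> a \<le> cmod (time_incr (t n) G x)" using nb xb n unfolding B1_def by auto
        then have "cmod (time_incr (t n) G x) < a" by simp
        moreover have "cmod (FT 1 F x) < a" using nb unfolding B2_def by (auto simp: not_le)
        moreover have "FT 1 (modulate (t n) F) x = time_incr (t n) G' x - time_incr (t n) G x + FT 1 F x"
          using elim by simp
        then have "cmod (FT 1 (modulate (t n) F) x) \<le> cmod (time_incr (t n) G' x) + cmod (time_incr (t n) G x) + cmod (FT 1 F x)"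
          using norm_triangle_ineq[of "time_incr (t n) G' x - time_incr (t n) G x" "FT 1 F x"]
            norm_triangle_ineq4[of "time_incr (t n) G' x" "time_incr (t n) G x"] by simp
        ultimately show False using n(2) lt unfolding a_def by linarith
      qed
    qed
  qed (use Bs in auto)
  also have "\<dots> \<le> emeasure lborel B1 + emeasure lborel B2" by (rule emeasure_subadditive[OF Bs])
  also have "\<dots> \<le> ennreal (e / 2) + ennreal (e / 2)" by (rule add_mono[OF b1 b2])
  also have "\<dots> = ennreal e" using e by (subst ennreal_plus[symmetric]) auto
  finally have bad: "emeasure lborel {x\<in>test_box. \<forall>n\<in>{N..Suc N'}. cmod (time_incr (t n) G' x) < hump_level / 2} \<le> ennreal e" .
  have diff: "sqnorm (bessel_weight s) (\<lambda>\<xi>. G' \<xi> - G \<xi>) \<le> ennreal e"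
    using nF e'(2) unfolding G'_def by (simp add: order_trans[OF _ ennreal_leI])
  show ?thesis
    by (intro exI[of _ G'] exI[of _ "Suc N'"] conjI G' finG' diff bad) (use N0 in auto)
qed

text \<open>
  Iterating \<open>hump_step\<close> gives data \<open>Gk k\<close> and times \<open>Nk k\<close> such that, on most of the box, the datum
  \<open>Gk (Suc k)\<close> has a large deviation at some index between \<open>Nk k\<close> and \<open>Nk (Suc k)\<close>. The sizes
  \<open>\<epsilon> k N\<close> of the later steps contain the factor \<open>1 / (N + 1)\<close>, so that the limit \<open>U\<close> of the data can be
  compared with \<open>Gk (Suc k)\<close> at all indices up to \<open>Nk (Suc k)\<close> simultaneously. Hence \<open>U\<close> has large
  deviations at arbitrarily late times on most of the box, against \<open>Egorov_tail\<close>.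
\<close>

lemma gliding_hump_contradiction: False
proof -
  define \<epsilon> where "\<epsilon> k N = (1/8) ^ k / (real N + 1)" for k N :: nat
  have \<epsilon>: "\<epsilon> k N > 0" "\<epsilon> k N \<le> (1/8) ^ k" for k N
  proof -
    show "\<epsilon> k N > 0" by (simp add: \<epsilon>_def)
    have "(1/8 :: real) ^ k / (real N + 1) \<le> (1/8) ^ k / 1" by (intro divide_left_mono) auto
    then show "\<epsilon> k N \<le> (1/8) ^ k" by (simp add: \<epsilon>_def)
  qed
  define adm where "adm z \<longleftrightarrow> fst z \<in> borel_measurable borel \<and> sqnorm (bessel_weight s) (fst z) < \<infinity>"
    for z :: "(real^2 \<Rightarrow> complex) \<times> nat"
  define nxt where "nxt k z z' \<longleftrightarrow> snd z < snd z' \<and>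
    sqnorm (bessel_weight s) (\<lambda>\<xi>. fst z' \<xi> - fst z \<xi>) \<le> ennreal (\<epsilon> k (snd z)) \<and>
    emeasure lborel {x\<in>test_box. \<forall>n\<in>{snd z..snd z'}. cmod (time_incr (t n) (fst z') x) < hump_level / 2} \<le> ennreal (\<epsilon> k (snd z))"
    for k and z z' :: "(real^2 \<Rightarrow> complex) \<times> nat"
  have "\<exists>z. \<forall>k. adm (z k) \<and> nxt k (z k) (z (Suc k))"
  proof (rule dependent_nat_choice)
    have "adm (\<lambda>_. 0, 0)" unfolding adm_def sqnorm_def by simp
    then show "\<exists>z. adm z" by blast
    fix z k assume "adm z"
    then obtain G' N' where "G' \<in> borel_measurable borel" "sqnorm (bessel_weight s) G' < \<infinity>" "snd z < N'"
      "sqnorm (bessel_weight s) (\<lambda>\<xi>. G' \<xi> - fst z \<xi>) \<le> ennreal (\<epsilon> k (snd z))"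
      "emeasure lborel {x\<in>test_box. \<forall>n\<in>{snd z..N'}. cmod (time_incr (t n) G' x) < hump_level / 2} \<le> ennreal (\<epsilon> k (snd z))"
      using hump_step[of "fst z" "\<epsilon> k (snd z)" "snd z"] \<epsilon>(1) unfolding adm_def by auto
    then have "adm (G', N') \<and> nxt k z (G', N')" unfolding adm_def nxt_def by simp
    then show "\<exists>z'. adm z' \<and> nxt k z z'" by blast
  qed
  then obtain z where z: "\<And>k. adm (z k)" "\<And>k. nxt k (z k) (z (Suc k))" by auto
  define Gk where "Gk k = fst (z k)" for k
  define Nk where "Nk k = snd (z k)" for k
  have Gm [measurable]: "Gk k \<in> borel_measurable borel" and Gf: "sqnorm (bessel_weight s) (Gk k) < \<infinity>" for k
    using z(1)[of k] unfolding adm_def Gk_def by auto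
  have Nlt: "Nk k < Nk (Suc k)" and dle: "sqnorm (bessel_weight s) (\<lambda>\<xi>. Gk (Suc k) \<xi> - Gk k \<xi>) \<le> ennreal (\<epsilon> k (Nk k))"
    and bad: "emeasure lborel {x\<in>test_box. \<forall>n\<in>{Nk k..Nk (Suc k)}. cmod (time_incr (t n) (Gk (Suc k)) x) < hump_level / 2} \<le> ennreal (\<epsilon> k (Nk k))" for k
    using z(2)[of k] unfolding nxt_def Gk_def Nk_def by auto
  have Nmono: "Nk j \<le> Nk k" if "j \<le> k" for j k
    using lift_Suc_mono_le[of Nk, OF less_imp_le[OF Nlt] that] .
  have Nk_ge: "k \<le> Nk k" for k
    by (induction k) (use Nlt Suc_leI le_less_trans in blast)+
  define d where "d k \<xi> = Gk (Suc k) \<xi> - Gk k \<xi>" for k \<xi>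
  have [measurable]: "d k \<in> borel_measurable (bessel_weight s)" for k unfolding d_def by measurable
  define S where "S = (\<Sum>k. ennreal (2 ^ k) * sqnorm (bessel_weight s) (d k))"
  have term_le: "ennreal (2 ^ k) * sqnorm (bessel_weight s) (d k) \<le> ennreal (1 / 2 ^ k * (1 / (real (Nk j) + 1)))" if "j \<le> k" for j k
  proof -
    have "ennreal (2 ^ k) * sqnorm (bessel_weight s) (d k) \<le> ennreal (2 ^ k) * ennreal (\<epsilon> k (Nk k))"
      unfolding d_def by (intro mult_left_mono dle) auto
    also have "\<dots> = ennreal (2 ^ k * \<epsilon> k (Nk k))" using \<epsilon>(1)[of k "Nk k"] by (subst ennreal_mult) auto
    also have "\<dots> \<le> ennreal (1 / 2 ^ k * (1 / (real (Nk j) + 1)))"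
    proof (rule ennreal_leI)
      have "(2::real) ^ k * (1/8) ^ k = (1/4) ^ k" by (simp add: power_mult_distrib[symmetric])
      also have "\<dots> \<le> (1/2) ^ k" by (intro power_mono) auto
      finally have 1: "(2::real) ^ k * (1/8) ^ k \<le> 1 / 2 ^ k" by (simp add: power_one_over)
      have 2: "1 / (real (Nk k) + 1) \<le> 1 / (real (Nk j) + 1)"
        using Nmono[OF that] by (intro divide_left_mono) auto
      have "2 ^ k * \<epsilon> k (Nk k) = (2 ^ k * (1/8) ^ k) * (1 / (real (Nk k) + 1))" by (simp add: \<epsilon>_def)
      also have "\<dots> \<le> 1 / 2 ^ k * (1 / (real (Nk j) + 1))" by (rule mult_mono[OF 1 2]) auto
      finally show "2 ^ k * \<epsilon> k (Nk k) \<le> 1 / 2 ^ k * (1 / (real (Nk j) + 1))" .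
    qed
    finally show ?thesis .
  qed
  have "S \<le> (\<Sum>k. ennreal ((1/2) ^ k))"
    unfolding S_def
  proof (rule suminf_le)
    fix k
    have "1 / 2 ^ k * (1 / (real (Nk 0) + 1)) \<le> (1 / 2 ^ k :: real)" by (intro mult_left_le) auto
    then have "ennreal (1 / 2 ^ k * (1 / (real (Nk 0) + 1))) \<le> ennreal ((1/2) ^ k)"
      by (intro ennreal_leI) (simp add: power_one_over)
    then show "ennreal (2 ^ k) * sqnorm (bessel_weight s) (d k) \<le> ennreal ((1/2) ^ k)"
      by (rule order_trans[OF term_le[OF le0]])
  qed auto
  also have "\<dots> = ennreal (\<Sum>k. (1/2) ^ k)"
    by (rule suminf_ennreal2) (auto intro: summable_geometric)
  finally have S: "S < \<infinity>" using le_less_trans by fastforce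
  obtain g where gm: "g \<in> borel_measurable (bessel_weight s)" and
    g: "\<And>K. sqnorm (bessel_weight s) (\<lambda>\<xi>. g \<xi> - (\<Sum>k<K. d k \<xi>)) \<le> ennreal (2 * (1/2)^K) * S"
    using Riesz_Fischer[of d "bessel_weight s"] S unfolding S_def by auto
  have [measurable]: "g \<in> borel_measurable borel" using gm measurable_cong_sets[OF sets_bessel_weight refl] by blast
  define U where "U \<xi> = Gk 0 \<xi> + g \<xi>" for \<xi>
  have Um [measurable]: "U \<in> borel_measurable borel" unfolding U_def by measurable
  have tele: "(\<Sum>k<K. d k \<xi>) = Gk K \<xi> - Gk 0 \<xi>" for K \<xi>
    unfolding d_def by (induction K) auto
  have UK: "sqnorm (bessel_weight s) (\<lambda>\<xi>. U \<xi> - Gk K \<xi>) \<le> ennreal (2 * (1/2)^K) * S" for K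
    using g[of K] unfolding tele U_def by (simp add: algebra_simps)
  have Ufin: "sqnorm (bessel_weight s) U < \<infinity>"
  proof -
    have "sqnorm (bessel_weight s) (\<lambda>\<xi>. (U \<xi> - Gk 0 \<xi>) + Gk 0 \<xi>) \<le> 2 * sqnorm (bessel_weight s) (\<lambda>\<xi>. U \<xi> - Gk 0 \<xi>) + 2 * sqnorm (bessel_weight s) (Gk 0)"
      by (rule sqnorm_add_le) measurable
    also have "\<dots> \<le> 2 * (ennreal (2 * (1/2)^0) * S) + 2 * sqnorm (bessel_weight s) (Gk 0)"
      by (intro add_mono mult_left_mono UK) auto
    also have "\<dots> < \<infinity>" using S Gf[of 0] by (simp add: ennreal_mult_less_top)
    finally show ?thesis by simp
  qed
  have tail: "sqnorm (bessel_weight s) (\<lambda>\<xi>. U \<xi> - Gk K \<xi>) \<le> ennreal (8 * (1/4)^K / (real (Nk K) + 1))" for K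
  proof -
    define q where "q = 1 / (real (Nk K) + 1)"
    have q: "q \<ge> 0" by (simp add: q_def)
    have le: "sqnorm (bessel_weight s) (\<lambda>\<xi>. U \<xi> - Gk K \<xi>) \<le> (4 * S) * ennreal ((1/2)^L) + ennreal (8 * (1/4)^K * q)" if L: "L \<ge> K" for L
    proof -
      have GLK: "(\<lambda>\<xi>. Gk L \<xi> - Gk K \<xi>) = (\<lambda>\<xi>. \<Sum>k=K..<L. d k \<xi>)"
      proof
        fix \<xi>
        have "(\<Sum>k<L. d k \<xi>) - (\<Sum>k<K. d k \<xi>) = (\<Sum>k=K..<L. d k \<xi>)"
          using L by (simp add: lessThan_atLeast0 sum_diff_nat_ivl)
        then show "Gk L \<xi> - Gk K \<xi> = (\<Sum>k=K..<L. d k \<xi>)" unfolding tele by simp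
      qed
      have "(\<Sum>k=K..<L. ennreal (2 ^ k) * sqnorm (bessel_weight s) (d k)) \<le> (\<Sum>k=K..<L. ennreal (1 / 2 ^ k * q))"
        unfolding q_def by (intro sum_mono term_le) auto
      also have "\<dots> = ennreal ((\<Sum>k=K..<L. 1 / 2 ^ k) * q)"
        using q by (subst sum_ennreal) (auto simp: sum_distrib_right)
      also have "\<dots> \<le> ennreal (2 * (1/2)^K * q)"
        using q by (intro ennreal_leI mult_right_mono sum_half_powers_le)
      finally have 1: "(\<Sum>k=K..<L. ennreal (2 ^ k) * sqnorm (bessel_weight s) (d k)) \<le> ennreal (2 * (1/2)^K * q)" .
      have "sqnorm (bessel_weight s) (\<lambda>\<xi>. Gk L \<xi> - Gk K \<xi>) \<le> ennreal (2 * (1/2)^K) * (\<Sum>k=K..<L. ennreal (2 ^ k) * sqnorm (bessel_weight s) (d k))"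
        unfolding GLK by (rule sqnorm_block_le) measurable
      also have "\<dots> \<le> ennreal (2 * (1/2)^K) * ennreal (2 * (1/2)^K * q)" by (intro mult_left_mono 1) auto
      also have "\<dots> = ennreal (2 * (1/2)^K * (2 * (1/2)^K * q))" using q by (subst ennreal_mult) auto
      also have "2 * (1/2)^K * (2 * (1/2)^K * q) = 4 * (1/4)^K * q"
      proof -
        have "(1/2::real)^K * (1/2)^K = (1/4)^K" by (simp add: power_mult_distrib[symmetric])
        then show ?thesis by (simp add: mult_ac)
      qed
      finally have 2: "sqnorm (bessel_weight s) (\<lambda>\<xi>. Gk L \<xi> - Gk K \<xi>) \<le> ennreal (4 * (1/4)^K * q)" .
      have "sqnorm (bessel_weight s) (\<lambda>\<xi>. U \<xi> - Gk K \<xi>) \<le> 2 * sqnorm (bessel_weight s) (\<lambda>\<xi>. U \<xi> - Gk L \<xi>) + 2 * sqnorm (bessel_weight s) (\<lambda>\<xi>. Gk L \<xi> - Gk K \<xi>)"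
        by (rule sqnorm_diff_triangle) measurable
      also have "\<dots> \<le> 2 * (ennreal (2 * (1/2)^L) * S) + 2 * ennreal (4 * (1/4)^K * q)"
        by (intro add_mono mult_left_mono UK 2) auto
      also have "2 * ennreal (4 * (1/4)^K * q) = ennreal (8 * (1/4)^K * q)"
        using q by (simp add: numeral_mult_ennreal mult.assoc)
      also have "2 * (ennreal (2 * (1/2)^L) * S) = (4 * S) * ennreal ((1/2)^L)"
        by (simp add: ennreal_mult mult_ac)
      finally show ?thesis .
    qed
    have "(\<lambda>L. (4 * S) * ennreal ((1/2)^L) + ennreal (8 * (1/4)^K * q)) \<longlonglongrightarrow> (4 * S) * ennreal 0 + ennreal (8 * (1/4)^K * q)"
      using S by (intro tendsto_add tendsto_const ennreal_tendsto_cmult tendsto_ennrealI LIMSEQ_realpow_zero) (auto simp: ennreal_mult_less_top)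
    then have "sqnorm (bessel_weight s) (\<lambda>\<xi>. U \<xi> - Gk K \<xi>) \<le> (4 * S) * ennreal 0 + ennreal (8 * (1/4)^K * q)"
      by (rule LIMSEQ_le_const) (use le in blast)
    then show ?thesis by (simp add: q_def)
  qed
  define a where "a = hump_level / 4"
  have a: "a > 0" using hump_level_pos by (simp add: a_def)
  define C where "C = 1 / a\<^sup>2 * (8 * (2*pi)\<^sup>2)"
  have C: "C \<ge> 0" unfolding C_def by simp
  have tmU [measurable]: "time_incr \<tau> U \<in> borel_measurable borel" for \<tau> by (rule time_incr_measurable[OF Um Ufin])
  have tmG [measurable]: "time_incr \<tau> (Gk k) \<in> borel_measurable borel" for \<tau> k by (rule time_incr_measurable[OF Gm Gf])
  have far: "emeasure lborel {x\<in>space lborel. a \<le> cmod (time_incr \<tau> U x - time_incr \<tau> (Gk k) x)} \<le> ennreal (C * (8 * (1/4)^k / (real (Nk k) + 1)))" for \<tau> k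
  proof -
    have "emeasure lborel {x\<in>space lborel. a \<le> cmod (time_incr \<tau> U x - time_incr \<tau> (Gk k) x)} \<le> ennreal (1 / a\<^sup>2) * sqnorm lborel (\<lambda>x. time_incr \<tau> U x - time_incr \<tau> (Gk k) x)"
      by (rule Chebyshev_sqnorm[OF _ a]) measurable
    also have "\<dots> \<le> ennreal (1 / a\<^sup>2) * (ennreal (8 * (2*pi)\<^sup>2) * sqnorm lborel (\<lambda>\<xi>. U \<xi> - Gk k \<xi>))"
      by (intro mult_left_mono time_incr_lipschitz Um Gm L2_of_weighted Ufin Gf) auto
    also have "\<dots> \<le> ennreal (1 / a\<^sup>2) * (ennreal (8 * (2*pi)\<^sup>2) * ennreal (8 * (1/4)^k / (real (Nk k) + 1)))"
      by (intro mult_left_mono order_trans[OF sqnorm_le_bessel_weight tail]) (use s in auto)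
    also have "\<dots> = ennreal (C * (8 * (1/4)^k / (real (Nk k) + 1)))"
      unfolding C_def by (subst ennreal_mult[symmetric], simp, simp, subst ennreal_mult[symmetric]) (auto simp: mult.assoc)
    finally show ?thesis .
  qed
  obtain n1 where n1: "\<And>m. m \<ge> n1 \<Longrightarrow> emeasure lborel {x\<in>test_box. \<exists>n\<ge>m. a \<le> cmod (time_incr (t n) U x)} \<le> ennreal (1/2)"
  proof (rule Egorov_tail[where Q = test_box, OF _ _ _ time_incr_tendsto_0[OF Um Ufin] a])
    show "0 < (1/2::real)" by simp
  qed (auto simp: emeasure_test_box test_box_borel tmU)
  have "(\<lambda>K. C * 8 * (1/4)^Suc K) \<longlonglongrightarrow> C * 8 * 0"
    by (intro tendsto_intros LIMSEQ_Suc LIMSEQ_realpow_zero) auto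
  then have "\<forall>\<^sub>F K in sequentially. C * 8 * (1/4)^Suc K < 1/2"
    by (intro order_tendstoD(2)[where y = "C * 8 * 0"]) auto
  then obtain K0 where K0: "\<And>K. K \<ge> K0 \<Longrightarrow> C * 8 * (1/4)^Suc K < 1/2" by (auto simp: eventually_sequentially)
  define K where "K = max (Suc n1) K0"
  have K: "K \<ge> 1" "n1 \<le> Nk K" "C * 8 * (1/4)^Suc K < 1/2"
    using K0[of K] Nk_ge[of K] unfolding K_def by auto
  define E1 where "E1 = {x\<in>test_box. \<exists>n\<ge>Nk K. a \<le> cmod (time_incr (t n) U x)}"
  define E2 where "E2 = {x\<in>test_box. \<forall>n\<in>{Nk K..Nk (Suc K)}. cmod (time_incr (t n) (Gk (Suc K)) x) < hump_level / 2}"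
  define E3 where "E3 n = {x\<in>space lborel. a \<le> cmod (time_incr (t n) U x - time_incr (t n) (Gk (Suc K)) x)}" for n
  have E1eq: "E1 = test_box \<inter> {x\<in>space borel. \<exists>n\<in>{Nk K..}. a \<le> cmod (time_incr (t n) U x)}" unfolding E1_def by auto
  have E2eq: "E2 = test_box \<inter> {x\<in>space borel. \<forall>n\<in>{Nk K..Nk (Suc K)}. cmod (time_incr (t n) (Gk (Suc K)) x) < hump_level / 2}" unfolding E2_def by auto
  have Es: "E1 \<in> sets lborel" "E2 \<in> sets lborel" "E3 n \<in> sets lborel" for n
    unfolding E1eq E2eq E3_def by measurable
  \<comment> \<open>Late deviations of \<open>U\<close>, failure of the hump of step \<open>K\<close>, and a large effect of the later humps:
      each of these sets has measure at most \<open>1/2\<close>, whereas the box has measure \<open>2\<close>.\<close>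
  have sub: "test_box \<subseteq> E1 \<union> E2 \<union> (\<Union>n\<le>Nk (Suc K). E3 n)"
  proof
    fix x assume x: "x \<in> test_box"
    show "x \<in> E1 \<union> E2 \<union> (\<Union>n\<le>Nk (Suc K). E3 n)"
    proof (rule ccontr)
      assume nx: "x \<notin> E1 \<union> E2 \<union> (\<Union>n\<le>Nk (Suc K). E3 n)"
      then have "x \<notin> E2" by simp
      then obtain n where n: "n \<in> {Nk K..Nk (Suc K)}" "hump_level / 2 \<le> cmod (time_incr (t n) (Gk (Suc K)) x)"
        unfolding E2_def using x by (auto simp: not_less)
      have "x \<notin> E1" using nx by simp
      then have "\<not> a \<le> cmod (time_incr (t n) U x)" unfolding E1_def using x n(1) by auto
      then have "cmod (time_incr (t n) U x) < a" by simp
      moreover have "x \<notin> E3 n" using nx n(1) by auto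
      then have "cmod (time_incr (t n) U x - time_incr (t n) (Gk (Suc K)) x) < a" unfolding E3_def by (auto simp: not_le)
      moreover have "cmod (time_incr (t n) (Gk (Suc K)) x) \<le> cmod (time_incr (t n) U x) + cmod (time_incr (t n) U x - time_incr (t n) (Gk (Suc K)) x)"
        using norm_triangle_ineq4[of "time_incr (t n) U x" "time_incr (t n) U x - time_incr (t n) (Gk (Suc K)) x"] by simp
      ultimately show False using n(2) unfolding a_def by linarith
    qed
  qed
  have e3: "emeasure lborel (\<Union>n\<le>Nk (Suc K). E3 n) \<le> ennreal (1/2)"
  proof -
    have "emeasure lborel (\<Union>n\<le>Nk (Suc K). E3 n) \<le> (\<Sum>n\<le>Nk (Suc K). emeasure lborel (E3 n))"
      by (rule emeasure_subadditive_finite) (use Es in auto)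
    also have "\<dots> \<le> (\<Sum>n\<le>Nk (Suc K). ennreal (C * (8 * (1/4)^Suc K / (real (Nk (Suc K)) + 1))))"
      unfolding E3_def by (intro sum_mono far)
    also have "\<dots> = ennreal (\<Sum>n\<le>Nk (Suc K). C * (8 * (1/4)^Suc K / (real (Nk (Suc K)) + 1)))"
      using C by (subst sum_ennreal) auto
    also have "(\<Sum>n\<le>Nk (Suc K). C * (8 * (1/4)^Suc K / (real (Nk (Suc K)) + 1))) = (real (Nk (Suc K)) + 1) * (C * (8 * (1/4)^Suc K / (real (Nk (Suc K)) + 1)))"
      by (simp only: sum_constant card_atMost of_nat_Suc add.commute)
    also have "\<dots> = C * 8 * (1/4)^Suc K"
    proof -
      have "y * (C * (v / y)) = C * v" if "y > 0" for y v :: real using that by simp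
      moreover have "real (Nk (Suc K)) + 1 > 0" by simp
      ultimately show ?thesis by (metis mult.assoc)
    qed
    finally show ?thesis using K(3) by (meson ennreal_leI less_imp_le order_trans)
  qed
  have e2: "emeasure lborel E2 \<le> ennreal (1/2)"
  proof -
    have "emeasure lborel E2 \<le> ennreal (\<epsilon> K (Nk K))" unfolding E2_def by (rule bad)
    also have "\<dots> \<le> ennreal (1/2)"
    proof (rule ennreal_leI)
      have "(1/8::real) ^ K \<le> (1/8) ^ 1" using K(1) by (intro power_decreasing) auto
      then show "\<epsilon> K (Nk K) \<le> 1/2" using \<epsilon>(2)[of K "Nk K"] by simp
    qed
    finally show ?thesis .
  qed
  have e1: "emeasure lborel E1 \<le> ennreal (1/2)" unfolding E1_def by (rule n1[OF K(2)])
  have "ennreal 2 = emeasure lborel test_box" by (rule emeasure_test_box[symmetric])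
  also have "\<dots> \<le> emeasure lborel (E1 \<union> E2 \<union> (\<Union>n\<le>Nk (Suc K). E3 n))"
    by (rule emeasure_mono[OF sub]) (use Es in auto)
  also have "\<dots> \<le> emeasure lborel (E1 \<union> E2) + emeasure lborel (\<Union>n\<le>Nk (Suc K). E3 n)"
    by (rule emeasure_subadditive) (use Es in auto)
  also have "\<dots> \<le> (emeasure lborel E1 + emeasure lborel E2) + emeasure lborel (\<Union>n\<le>Nk (Suc K). E3 n)"
    by (intro add_right_mono emeasure_subadditive) (use Es in auto)
  also have "\<dots> \<le> (ennreal (1/2) + ennreal (1/2)) + ennreal (1/2)" by (intro add_mono e1 e2 e3)
  also have "\<dots> = ennreal (3/2)" 
  proof -
    have "ennreal (1/2) + ennreal (1/2) = ennreal 1" by (subst ennreal_plus[symmetric]) auto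
    moreover have "ennreal 1 + ennreal (1/2) = ennreal (3/2)" by (subst ennreal_plus[symmetric]) auto
    ultimately show ?thesis by simp
  qed
  finally show False by (subst (asm) ennreal_le_iff) auto
qed

end

section \<open>Convergence and weak summability are equivalent\<close>

theorem theorem1p1:
  fixes s :: real and t :: "nat \<Rightarrow> real"
  assumes "0 < s" and "s < 1 / 2"
    and "range t \<subseteq> {0<..<1}"
    and "decseq t"
    and "t \<longlonglongrightarrow> 0"
    and "decseq (\<lambda>n. t n - t (Suc n))"
  shows "(\<forall>f\<in>sobolev s. AE x in lebesgue. (\<lambda>n. nonelliptic_propagator (t n) f x) \<longlonglongrightarrow> f x)
     \<longleftrightarrow> t \<in> weak_lspace (s / (1 - s))"
proof
  have t: "0 < t n" "t n < 1" for n using assms(3) by (auto simp: subset_iff)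
  assume weak: "t \<in> weak_lspace (s / (1 - s))"
  show "\<forall>f\<in>sobolev s. AE x in lebesgue. (\<lambda>n. nonelliptic_propagator (t n) f x) \<longlonglongrightarrow> f x"
  proof
    fix f assume f: "f \<in> sobolev s"
    then have sf: "square_integrable f" by (simp add: sobolev_def)
    from propagator_Fourier_representation[OF sf]
    obtain G f' P where rep: "G \<in> borel_measurable borel \<and> (AE \<xi> in lborel. fourier f \<xi> = G \<xi>) \<and>
      fourier f \<in> borel_measurable lebesgue \<and> is_FT 1 G f' \<and> (AE x in lborel. f x = f' x) \<and>
      (\<forall>\<tau>. is_FT 1 (modulate \<tau> G) (P \<tau>) \<and> (AE x in lborel. nonelliptic_propagator \<tau> f x = P \<tau> x))"
      by (elim exE) (rule that)
    have G: "G \<in> borel_measurable borel" "AE \<xi> in lborel. fourier f \<xi> = G \<xi>"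
      "fourier f \<in> borel_measurable lebesgue" "is_FT 1 G f'" "AE x in lborel. f x = f' x"
      "is_FT 1 (modulate \<tau> G) (P \<tau>)" "AE x in lborel. nonelliptic_propagator \<tau> f x = P \<tau> x" for \<tau>
      using rep by (elim conjE; simp)+
    have fin: "sqnorm (bessel_weight s) G < \<infinity>"
      using sobolev_iff_bessel_weight[OF sf G(3) G(1) G(2), of s] f by simp
    have "AE x in lborel. (\<lambda>n. P (t n) x) \<longlonglongrightarrow> P 0 x"
      by (rule a_e_convergence_of_weak_lspace[OF assms(1,2) t assms(5) weak G(1) fin G(6)])
    moreover have "AE x in lborel. P 0 x = f' x"
      using is_FT_unique[OF _ G(6)[of 0], of f'] G(4) by simp
    moreover have "AE x in lborel. \<forall>n. nonelliptic_propagator (t n) f x = P (t n) x"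
      unfolding AE_all_countable using G(7) by blast
    ultimately have "AE x in lborel. (\<lambda>n. nonelliptic_propagator (t n) f x) \<longlonglongrightarrow> f x"
      using G(5) by eventually_elim simp
    then show "AE x in lebesgue. (\<lambda>n. nonelliptic_propagator (t n) f x) \<longlonglongrightarrow> f x"
      by (rule AE_completion)
  qed
next
  have t: "0 < t n" "t n < 1" for n using assms(3) by (auto simp: subset_iff)
  assume conv: "\<forall>f\<in>sobolev s. AE x in lebesgue. (\<lambda>n. nonelliptic_propagator (t n) f x) \<longlonglongrightarrow> f x"
  show "t \<in> weak_lspace (s / (1 - s))"
  proof (rule ccontr)
    assume nw: "t \<notin> weak_lspace (s / (1 - s))"
    have "AE x in lborel. (\<lambda>n. P n x) \<longlonglongrightarrow> f x"
      if G: "G \<in> borel_measurable borel" "sqnorm (bessel_weight s) G < \<infinity>"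
        and P: "\<And>n. is_FT 1 (modulate (t n) G) (P n)" and f: "is_FT 1 G f" for G P f
    proof -
      note D = propagator_of_Fourier_data[OF f]
      have "f \<in> sobolev s"
        using sobolev_iff_bessel_weight[OF D(1,3) G(1) D(2), of s] G(2) by simp
      then have "AE x in lborel. (\<lambda>n. nonelliptic_propagator (t n) f x) \<longlonglongrightarrow> f x"
        using conv by (simp add: AE_completion_iff)
      moreover have "AE x in lborel. \<forall>n. nonelliptic_propagator (t n) f x = P n x"
        unfolding AE_all_countable using D(4)[OF P] by blast
      ultimately show ?thesis by eventually_elim simp
    qed
    then show False
      using gliding_hump_contradiction[OF assms(1,2) t assms(4,5,6) _ nw] by blast
  qed
qed

end
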